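(* Let $G$ be the open unit disc $\mathbb{D}$ or the complex plane $\mathbb{C}$. Then there exist nuclear Fréchet spaces of holomorphic functions on $G$ without the bounded approximation property, and there exist nuclear Fréchet spaces of holomorphic functions on $G$ which have the bounded approximation property but do not have a Schauder basis.
   Context: $H(G)$ denotes the Fréchet space of holomorphic functions on $G$, endowed with the topology of uniform convergence on compact subsets of $G$. A Fréchet space $E$ of holomorphic functions on $G$ is a complex Fréchet space that is a (linear) subspace of $H(G)$, with its own Fréchet topology, such that the inclusion map $E \subset H(G)$ is continuous and $E$ contains the polynomials (i.e. the restrictions to $G$ of all complex polynomials in $z$). It is called nuclear if it is nuclear for its own Fréchet topology. A Fréchet space $F$ has the bounded approximation property if there is an equicontinuous net $(T_{\alpha})_{\alpha}$ of finite rank (continuous linear) operators on $F$ such that $T_{\alpha} x$ converges to $x$ for each $x \in F$. *)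

theory Defs
  imports
    "HOL-Complex_Analysis.Complex_Analysis"
    "HOL-Library.Function_Algebras"
begin

section \<open>Topologies given by seminorms\<close>

definition seminorm_nhd ::
    "'v::ab_group_add set \<Rightarrow> ('v \<Rightarrow> real) set \<Rightarrow> 'v set \<Rightarrow> 'v \<Rightarrow> bool" where
  "seminorm_nhd E P U x \<longleftrightarrow>
     (\<exists>F r. finite F \<and> F \<subseteq> P \<and> 0 < r \<and> {y\<in>E. \<forall>p\<in>F. p (y - x) < r} \<subseteq> U)"

definition seminorm_topology ::
    "'v::ab_group_add set \<Rightarrow> ('v \<Rightarrow> real) set \<Rightarrow> 'v topology" where
  "seminorm_topology E P = topology (\<lambda>U. U \<subseteq> E \<and> (\<forall>x\<in>U. seminorm_nhd E P U x))"

lemma seminorm_nhdI: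
  "finite F \<Longrightarrow> F \<subseteq> P \<Longrightarrow> 0 < r \<Longrightarrow> {y\<in>E. \<forall>p\<in>F. p (y - x) < r} \<subseteq> U \<Longrightarrow>
   seminorm_nhd E P U x"
  unfolding seminorm_nhd_def by (intro exI conjI)

lemma seminorm_nhdE:
  assumes "seminorm_nhd E P U x"
  obtains F r where "finite F" "F \<subseteq> P" "0 < r" "{y\<in>E. \<forall>p\<in>F. p (y - x) < r} \<subseteq> U"
  using assms unfolding seminorm_nhd_def by (elim exE conjE)

lemma seminorm_nhd_mono: "seminorm_nhd E P U x \<Longrightarrow> U \<subseteq> V \<Longrightarrow> seminorm_nhd E P V x"
  by (elim seminorm_nhdE, rule seminorm_nhdI) (assumption | erule (1) subset_trans)+

lemma seminorm_nhd_int: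
  assumes "seminorm_nhd E P U x" "seminorm_nhd E P V x"
  shows "seminorm_nhd E P (U \<inter> V) x"
proof -
    obtain F r where F: "finite F" "F \<subseteq> P" "0 < r" "{y\<in>E. \<forall>p\<in>F. p (y - x) < r} \<subseteq> U"
      using assms(1) by (rule seminorm_nhdE)
    obtain F' r' where F': "finite F'" "F' \<subseteq> P" "0 < r'" "{y\<in>E. \<forall>p\<in>F'. p (y - x) < r'} \<subseteq> V"
      using assms(2) by (rule seminorm_nhdE)
    show ?thesis by (rule seminorm_nhdI[of "F \<union> F'" _ "min r r'"]) (use F F' in auto)
qed

lemma istopology_seminorm_topology:
  "istopology (\<lambda>U. U \<subseteq> E \<and> (\<forall>x\<in>U. seminorm_nhd E P U x))"
  unfolding istopology_def
  by (auto intro: seminorm_nhd_int seminorm_nhd_mono)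

lemma openin_seminorm_topology:
  "openin (seminorm_topology E P) U \<longleftrightarrow> U \<subseteq> E \<and> (\<forall>x\<in>U. seminorm_nhd E P U x)"
  unfolding seminorm_topology_def
  by (rule fun_cong[OF topology_inverse'[OF istopology_seminorm_topology]])

lemma topspace_seminorm_topology [simp]: "topspace (seminorm_topology E P) = E"
proof
  show "topspace (seminorm_topology E P) \<subseteq> E"
    using openin_topspace[of "seminorm_topology E P"] unfolding openin_seminorm_topology
    by (rule conjunct1)
  have "openin (seminorm_topology E P) E" unfolding openin_seminorm_topology
    by (auto intro: seminorm_nhdI[of "{}" _ 1])
  then show "E \<subseteq> topspace (seminorm_topology E P)" by (rule openin_subset)
qed

section \<open>Locally convex spaces\<close>

text \<open>
  A topological vector space is a pair of a linear subspace E of the ambient complex vector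
  space and a topology with topspace E, so that seminorms, functionals and operators only
  matter on E.
\<close>

locale complex_vector_space = vector_space scale
  for scale :: "complex \<Rightarrow> 'v::ab_group_add \<Rightarrow> 'v" (infixr \<open>*c\<close> 75)
begin

definition seminorm_on :: "'v set \<Rightarrow> ('v \<Rightarrow> real) \<Rightarrow> bool" where
  "seminorm_on E p \<longleftrightarrow>
     (\<forall>x\<in>E. \<forall>y\<in>E. p (x + y) \<le> p x + p y) \<and> (\<forall>c. \<forall>x\<in>E. p (c *c x) = cmod c * p x)"

definition Cauchy_sequence :: "'v topology \<Rightarrow> (nat \<Rightarrow> 'v) \<Rightarrow> bool" where
  "Cauchy_sequence \<tau> x \<longleftrightarrow> range x \<subseteq> topspace \<tau> \<and>
     (\<forall>U. openin \<tau> U \<and> 0 \<in> U \<longrightarrow> (\<exists>N. \<forall>m\<ge>N. \<forall>n\<ge>N. x m - x n \<in> U))"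

text \<open>
  Sequential completeness suffices, since the topology has a countable base at 0.
\<close>

definition frechet_space :: "'v set \<Rightarrow> 'v topology \<Rightarrow> bool" where
  "frechet_space E \<tau> \<longleftrightarrow> subspace E \<and>
     (\<exists>p :: nat \<Rightarrow> 'v \<Rightarrow> real. (\<forall>k. seminorm_on E (p k)) \<and> \<tau> = seminorm_topology E (range p)) \<and>
     Hausdorff_space \<tau> \<and>
     (\<forall>x. Cauchy_sequence \<tau> x \<longrightarrow> (\<exists>l. limitin \<tau> x l sequentially))"

definition continuous_seminorm :: "'v set \<Rightarrow> 'v topology \<Rightarrow> ('v \<Rightarrow> real) \<Rightarrow> bool" where
  "continuous_seminorm E \<tau> p \<longleftrightarrow> seminorm_on E p \<and> continuous_map \<tau> euclideanreal p"

definition linear_functional_on :: "'v set \<Rightarrow> ('v \<Rightarrow> complex) \<Rightarrow> bool" where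
  "linear_functional_on E a \<longleftrightarrow>
     (\<forall>x\<in>E. \<forall>y\<in>E. a (x + y) = a x + a y) \<and> (\<forall>c. \<forall>x\<in>E. a (c *c x) = c * a x)"

text \<open>
  For seminorms \<open>p \<le> q\<close> on E, let \<open>E\<^sub>p\<close> be the normed space obtained by dividing E by the kernel
  of p. The predicate says that the canonical map from \<open>E\<^sub>q\<close> to \<open>E\<^sub>p\<close> is nuclear, that is, of the
  form \<open>x \<mapsto> (\<Sum>n. a n x *c y n)\<close> with the sum of all \<open>\<parallel>a n\<parallel> * \<parallel>y n\<parallel>\<close> finite, written with
  representatives in E; \<open>C n\<close> bounds the dual norm of \<open>a n\<close>. Replacing \<open>E\<^sub>p\<close> and \<open>E\<^sub>q\<close> by their
  completions gives the same notion: a vector of the completion of \<open>E\<^sub>p\<close> is the sum of a series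
  in \<open>E\<^sub>p\<close> whose norms add up to nearly its own norm.
\<close>

definition canonical_map_nuclear :: "'v set \<Rightarrow> ('v \<Rightarrow> real) \<Rightarrow> ('v \<Rightarrow> real) \<Rightarrow> bool" where
  "canonical_map_nuclear E q p \<longleftrightarrow>
     (\<forall>x\<in>E. p x \<le> q x) \<and>
     (\<exists>(a :: nat \<Rightarrow> 'v \<Rightarrow> complex) (C :: nat \<Rightarrow> real) (y :: nat \<Rightarrow> 'v).
        (\<forall>n. linear_functional_on E (a n)) \<and>
        (\<forall>n. 0 \<le> C n \<and> (\<forall>x\<in>E. cmod (a n x) \<le> C n * q x)) \<and>
        (\<forall>n. y n \<in> E) \<and>
        summable (\<lambda>n. C n * p (y n)) \<and>
        (\<forall>x\<in>E. (\<lambda>N. p (x - (\<Sum>n<N. a n x *c y n))) \<longlonglongrightarrow> 0))"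

definition nuclear :: "'v set \<Rightarrow> 'v topology \<Rightarrow> bool" where
  "nuclear E \<tau> \<longleftrightarrow>
     (\<forall>p. continuous_seminorm E \<tau> p \<longrightarrow>
        (\<exists>q. continuous_seminorm E \<tau> q \<and> canonical_map_nuclear E q p))"

definition finite_rank_operator :: "'v set \<Rightarrow> 'v topology \<Rightarrow> ('v \<Rightarrow> 'v) \<Rightarrow> bool" where
  "finite_rank_operator E \<tau> T \<longleftrightarrow>
     continuous_map \<tau> \<tau> T \<and>
     (\<forall>x\<in>E. \<forall>y\<in>E. T (x + y) = T x + T y) \<and> (\<forall>c. \<forall>x\<in>E. T (c *c x) = c *c T x) \<and>
     (\<exists>B. finite B \<and> T ` E \<subseteq> span B)"

definition equicontinuous :: "'v topology \<Rightarrow> ('v \<Rightarrow> 'v) set \<Rightarrow> bool" where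
  "equicontinuous \<tau> \<T> \<longleftrightarrow>
     (\<forall>V. openin \<tau> V \<and> 0 \<in> V \<longrightarrow> (\<exists>U. openin \<tau> U \<and> 0 \<in> U \<and> (\<forall>T\<in>\<T>. T ` U \<subseteq> V)))"

text \<open>
  A net of operators with values in the set \<open>\<T>\<close> is represented by the filter \<open>\<F>\<close> generated by its
  tails, which is proper and contains \<open>\<T>\<close>. Conversely, every such filter is the tail filter of a
  net in \<open>\<T>\<close>.
\<close>

definition bounded_approximation_property :: "'v set \<Rightarrow> 'v topology \<Rightarrow> bool" where
  "bounded_approximation_property E \<tau> \<longleftrightarrow>
     (\<exists>\<T> \<F>. (\<forall>T\<in>\<T>. finite_rank_operator E \<tau> T) \<and> equicontinuous \<tau> \<T> \<and>
        \<F> \<noteq> bot \<and> \<F> \<le> principal \<T> \<and>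
        (\<forall>x\<in>E. limitin \<tau> (\<lambda>T. T x) x \<F>))"

definition schauder_basis :: "'v set \<Rightarrow> 'v topology \<Rightarrow> (nat \<Rightarrow> 'v) \<Rightarrow> bool" where
  "schauder_basis E \<tau> e \<longleftrightarrow> range e \<subseteq> E \<and>
     (\<forall>x\<in>E. \<exists>!c :: nat \<Rightarrow> complex. limitin \<tau> (\<lambda>N. \<Sum>n<N. c n *c e n) x sequentially)"

end

section \<open>Spaces of holomorphic functions\<close>

interpretation cfun: complex_vector_space "\<lambda>(c::complex) (f :: complex \<Rightarrow> complex) z. c * f z"
  by unfold_locales (auto simp: fun_eq_iff algebra_simps)

text \<open>
  A function on G is represented by its extension by 0 to the whole plane.
\<close>

definition hol_funs :: "complex set \<Rightarrow> (complex \<Rightarrow> complex) set" where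
  "hol_funs G = {f. f holomorphic_on G \<and> (\<forall>z. z \<notin> G \<longrightarrow> f z = 0)}"

definition hol_topology :: "complex set \<Rightarrow> (complex \<Rightarrow> complex) topology" where
  "hol_topology G = seminorm_topology (hol_funs G)
     {\<lambda>f. SUP z\<in>K. cmod (f z) |K. compact K \<and> K \<noteq> {} \<and> K \<subseteq> G}"

definition frechet_space_of_hol_funs ::
    "complex set \<Rightarrow> (complex \<Rightarrow> complex) set \<Rightarrow> (complex \<Rightarrow> complex) topology \<Rightarrow> bool" where
  "frechet_space_of_hol_funs G E \<tau> \<longleftrightarrow>
     cfun.frechet_space E \<tau> \<and> E \<subseteq> hol_funs G \<and>
     continuous_map \<tau> (hol_topology G) id \<and>
     (\<forall>p :: complex poly. (\<lambda>z. if z \<in> G then poly p z else 0) \<in> E)"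

end

theory Submission
  imports Defs
begin

text \<open>
  Both examples are spaces of sequences on which every seminorm is an \<open>l\<^sup>1\<close>-norm
  \<open>(\<Sum>j. cmod (a l j x))\<close> of functionals depending on two coordinates each. They embed into
  the entire functions by \<open>x \<mapsto> (\<lambda>z. \<Sum>j. \<gamma> j * \<phi> j x * z ^ j)\<close>, where the \<open>\<phi> j\<close> separate points, are bounded by the
  smallest norm and have a biorthogonal system, which yields the monomials; the \<open>\<gamma> j\<close> decay rapidly.

  If a Frechet space with increasing norms \<open>p\<^sub>l\<close> has the bounded approximation property, then there is a
  level m such that for each k, some larger level n satisfies: a \<open>p\<^sub>n\<close>-Cauchy sequence which is \<open>p\<^sub>m\<close>-null
  is \<open>p\<^sub>k\<close>-null, because all norms are equivalent on the range of a finite rank operator.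
  In the first example this fails for the partial sums of a formal series \<open>\<Sum>j. e j\<close>.

  The second example is a direct sum of two-dimensional blocks. A Schauder basis of a nuclear Frechet space
  is absolute, so it decomposes the identity of a block into rank one operators R which are
  absolutely summable with respect to all pairs of norms. The norms of a block are very eccentric
  ellipses: two of them have the same axes with opposite eccentricity and force R to be almost
  diagonal, the axes of the third are rotated by 45 degrees, which forces the diagonal entries to be almost equal,
  and a rank one operator with these properties has a small trace.
\<close>

section \<open>Frechet spaces with increasing norms\<close>

text \<open>Continuity of the inclusion gives every such space a continuous norm, for instance the
  supremum over a small disc, so failure of approximation cannot come from kernels of the norms
  themselves. The first example places it in the linking maps between completions: for each starting
  norm some linking map, arbitrarily far up, is not injective. One group of coordinates spoils one
  pair of levels, so there is one group for each pair. In the second example the unknown basis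
  dictates, for each level \<open>l\<close>, a constant and a level \<open>\<mu> l\<close> whose
  norm absorbs the absolute expansion. A block must keep its first shape from 0 up to
  \<open>\<mu> 0\<close>, the second from the next level up to the corresponding
  \<open>\<mu>\<close>, and the third beyond. Hence all pairs of switching levels occur, and
  infinitely often, so that some block is eccentric enough to beat the three constants. Both
  examples rest on one estimate: coordinate \<open>j\<close> gains a factor \<open>2 ^ Suc j\<close>
  per level. It yields monotone norms, nuclearity and the width bound behind absoluteness of
  bases.\<close>

locale graded_frechet = complex_vector_space scale
  for scale :: "complex \<Rightarrow> 'v::ab_group_add \<Rightarrow> 'v" (infixr \<open>*c\<close> 75) +
  fixes E :: "'v set" and p :: "nat \<Rightarrow> 'v \<Rightarrow> real"
  assumes subspace_E: "subspace E"
    and seminorm_p: "seminorm_on E (p l)"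
    and p_Suc: "x \<in> E \<Longrightarrow> p l x \<le> p (Suc l) x"
    and p_zero_imp: "x \<in> E \<Longrightarrow> p 0 x = 0 \<Longrightarrow> x = 0"
    and complete: "(\<And>n. X n \<in> E) \<Longrightarrow>
       (\<And>l e. 0 < e \<Longrightarrow> \<exists>N. \<forall>m\<ge>N. \<forall>n\<ge>N. p l (X m - X n) < e) \<Longrightarrow>
       \<exists>x\<in>E. \<forall>l. (\<lambda>n. p l (X n - x)) \<longlonglongrightarrow> 0"
begin

abbreviation \<tau> :: "'v topology" where "\<tau> \<equiv> seminorm_topology E (range p)"

lemma zero_in [simp]: "0 \<in> E" by (rule subspace_0[OF subspace_E])
lemma add_in [simp]: "x \<in> E \<Longrightarrow> y \<in> E \<Longrightarrow> x + y \<in> E" by (rule subspace_add[OF subspace_E])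
lemma diff_in [simp]: "x \<in> E \<Longrightarrow> y \<in> E \<Longrightarrow> x - y \<in> E" by (rule subspace_diff[OF subspace_E])
lemma scale_in [simp]: "x \<in> E \<Longrightarrow> c *c x \<in> E" by (rule subspace_scale[OF subspace_E])
lemma sum_in [simp]: "(\<And>i. i \<in> I \<Longrightarrow> f i \<in> E) \<Longrightarrow> sum f I \<in> E" by (rule subspace_sum[OF subspace_E])

lemma p_add: "x \<in> E \<Longrightarrow> y \<in> E \<Longrightarrow> p l (x + y) \<le> p l x + p l y"
  using seminorm_p[of l] unfolding seminorm_on_def by blast
lemma p_scale: "x \<in> E \<Longrightarrow> p l (c *c x) = cmod c * p l x"
  using seminorm_p[of l] unfolding seminorm_on_def by blast
lemma p_0 [simp]: "p l 0 = 0"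
  using p_scale[of 0 l 0] by simp
lemma p_minus: "x \<in> E \<Longrightarrow> p l (- x) = p l x"
  using p_scale[of x l "-1"] by simp
lemma p_commute: "x \<in> E \<Longrightarrow> y \<in> E \<Longrightarrow> p l (x - y) = p l (y - x)"
  using p_minus[of "x - y" l] by simp
lemma p_diff: "x \<in> E \<Longrightarrow> y \<in> E \<Longrightarrow> p l (x - y) \<le> p l x + p l y"
  using p_add[of x "- y" l] p_minus[of y l] subspace_neg[OF subspace_E] by simp
lemma p_triangle: "x \<in> E \<Longrightarrow> y \<in> E \<Longrightarrow> z \<in> E \<Longrightarrow> p l (x - z) \<le> p l (x - y) + p l (y - z)"
  using p_add[of "x - y" "y - z" l] by simp
lemma p_nonneg: "x \<in> E \<Longrightarrow> 0 \<le> p l x"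
  using p_diff[of x x l] by simp
lemma p_mono: "l \<le> m \<Longrightarrow> x \<in> E \<Longrightarrow> p l x \<le> p m x"
  by (rule lift_Suc_mono_le[of "\<lambda>l. p l x"]) (auto intro: p_Suc)
lemma p_sum: "finite I \<Longrightarrow> (\<And>i. i \<in> I \<Longrightarrow> f i \<in> E) \<Longrightarrow> p l (sum f I) \<le> (\<Sum>i\<in>I. p l (f i))"
proof (induction I rule: finite_induct)
  case (insert i I)
  then show ?case using p_add[of "f i" "sum f I" l] by force
qed simp
lemma p_pos: "x \<in> E \<Longrightarrow> x \<noteq> 0 \<Longrightarrow> 0 < p l x"
  using p_zero_imp[of x] p_mono[of 0 l x] p_nonneg[of x 0] by force
lemma p_le_diff: "x \<in> E \<Longrightarrow> y \<in> E \<Longrightarrow> p l x \<le> p l y + p l (x - y)"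
  using p_add[of y "x - y" l] by simp

section \<open>Neighbourhoods, limits and operators in terms of the norms\<close>

lemma openin_ball: 
  assumes "x \<in> E"
  shows "openin \<tau> {y\<in>E. p l (y - x) < r}"
  unfolding openin_seminorm_topology
proof safe
  fix y assume y: "y \<in> E" "p l (y - x) < r"
  show "seminorm_nhd E (range p) {y\<in>E. p l (y - x) < r} y"
  proof (rule seminorm_nhdI[of "{p l}" _ "r - p l (y - x)"])
    show "{z\<in>E. \<forall>q\<in>{p l}. q (z - y) < r - p l (y - x)} \<subseteq> {y\<in>E. p l (y - x) < r}"
      using p_triangle[of _ y x l] y assms by force
  qed (use y in auto)
qed

lemma openin_nhd:
  assumes "openin \<tau> U" "x \<in> U"
  obtains l r where "0 < r" "{y\<in>E. p l (y - x) < r} \<subseteq> U"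
proof -
  have "x \<in> E" and "seminorm_nhd E (range p) U x"
    using assms unfolding openin_seminorm_topology by auto
  then obtain F r where F: "finite F" "F \<subseteq> range p" "0 < r" "{y\<in>E. \<forall>q\<in>F. q (y - x) < r} \<subseteq> U"
    by (elim seminorm_nhdE)
  obtain I where I: "finite I" "F = p ` I"
    using finite_subset_image[OF F(1,2)] by auto
  have "p i (y - x) < r" if "p (Max (insert 0 I)) (y - x) < r" "y \<in> E" "i \<in> I" for i y
    using p_mono[of i "Max (insert 0 I)" "y - x"] that I \<open>x \<in> E\<close> by auto
  then have "{y\<in>E. p (Max (insert 0 I)) (y - x) < r} \<subseteq> U"
    using F(4) I by auto
  then show ?thesis using F(3) that by blast
qed

lemma limitin_D:
  assumes "limitin \<tau> f x F"
  shows "x \<in> E" "\<forall>\<^sub>F a in F. f a \<in> E" "((\<lambda>a. p l (f a - x)) \<longlongrightarrow> 0) F"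
proof -
  show x: "x \<in> E" using assms by (auto simp: limitin_def)
  have ev: "\<forall>\<^sub>F a in F. f a \<in> {y\<in>E. p l (y - x) < r}" if "0 < r" for r l
    using assms openin_ball[OF x, of l r] x that unfolding limitin_def by auto
  show ee: "\<forall>\<^sub>F a in F. f a \<in> E" using ev[of 1 0] by (auto elim: eventually_mono)
  show "((\<lambda>a. p l (f a - x)) \<longlongrightarrow> 0) F"
    unfolding tendsto_iff
  proof safe
    fix e :: real assume "0 < e"
    from ev[OF this, of l] show "\<forall>\<^sub>F a in F. dist (p l (f a - x)) 0 < e"
      by eventually_elim (use x p_nonneg in auto)
  qed
qed

lemma limitin_I:
  assumes "x \<in> E" "\<forall>\<^sub>F a in F. f a \<in> E" "\<And>l. ((\<lambda>a. p l (f a - x)) \<longlongrightarrow> 0) F"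
  shows "limitin \<tau> f x F"
  unfolding limitin_def
proof safe
  show "x \<in> topspace \<tau>" using assms by simp
  fix U assume "openin \<tau> U" "x \<in> U"
  then obtain l r where lr: "0 < r" "{y\<in>E. p l (y - x) < r} \<subseteq> U" by (rule openin_nhd)
  have "\<forall>\<^sub>F a in F. p l (f a - x) < r" using order_tendstoD(2)[OF assms(3) lr(1)] .
  with assms(2) show "\<forall>\<^sub>F a in F. f a \<in> U" by eventually_elim (use lr in auto)
qed

lemma Hausdorff: "Hausdorff_space \<tau>"
  unfolding Hausdorff_space_def
proof safe
  fix x y assume xy: "x \<in> topspace \<tau>" "y \<in> topspace \<tau>" "x \<noteq> y"
  define r where "r = p 0 (x - y) / 2"
  have r: "0 < r" using xy p_pos[of "x - y" 0] by (auto simp: r_def)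
  have "disjnt {z\<in>E. p 0 (z - x) < r} {z\<in>E. p 0 (z - y) < r}"
    using xy p_triangle[of x _ y 0] p_commute[of x _ 0] unfolding disjnt_def r_def by fastforce
  with r xy show "\<exists>U V. openin \<tau> U \<and> openin \<tau> V \<and> x \<in> U \<and> y \<in> V \<and> disjnt U V"
    by (intro exI[of _ "{z\<in>E. p 0 (z - x) < r}"] exI[of _ "{z\<in>E. p 0 (z - y) < r}"])
       (auto intro: openin_ball)
qed

lemma frechet: "frechet_space E \<tau>"
  unfolding frechet_space_def
proof (intro conjI allI impI exI[of _ p])
  fix X assume X: "Cauchy_sequence \<tau> X"
  then have XE: "X n \<in> E" for n by (auto simp: Cauchy_sequence_def)
  have "\<exists>N. \<forall>m\<ge>N. \<forall>n\<ge>N. p l (X m - X n) < e" if "0 < e" for l e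
  proof -
    have "openin \<tau> {y\<in>E. p l (y - 0) < e} \<and> 0 \<in> {y\<in>E. p l (y - 0) < e}"
      using openin_ball[of 0 l e] that by simp
    from X[unfolded Cauchy_sequence_def, THEN conjunct2, rule_format, OF this]
    obtain N where "\<forall>m\<ge>N. \<forall>n\<ge>N. X m - X n \<in> {y\<in>E. p l (y - 0) < e}" by (elim exE)
    then show ?thesis by (intro exI[of _ N]) simp
  qed
  from complete[OF XE this] obtain x where "x \<in> E" "\<forall>l. (\<lambda>n. p l (X n - x)) \<longlonglongrightarrow> 0" by blast
  then have "limitin \<tau> X x sequentially" using XE by (intro limitin_I) auto
  then show "\<exists>l. limitin \<tau> X l sequentially" by blast
qed (use subspace_E seminorm_p Hausdorff in auto)

lemma continuous_seminorm_scaled: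
  assumes "0 \<le> C"
  shows "continuous_seminorm E \<tau> (\<lambda>x. C * p l x)"
  unfolding continuous_seminorm_def
proof
  show "seminorm_on E (\<lambda>x. C * p l x)"
    using assms p_add p_scale unfolding seminorm_on_def
    by (auto simp flip: distrib_left intro!: mult_left_mono)
  have "continuous_map \<tau> euclideanreal (p l)"
    unfolding continuous_map_atin limitin_canonical_iff
  proof (clarsimp simp: tendsto_iff)
    fix x and e :: real assume x: "x \<in> E" "0 < e"
    have "dist (p l y) (p l x) < e" if "y \<in> E" "p l (y - x) < e" for y
      using p_le_diff[of y x l] p_le_diff[of x y l] p_commute[of x y l] that x
      by (auto simp: dist_real_def abs_if)
    with x show "\<forall>\<^sub>F y in atin \<tau> x. dist (p l y) (p l x) < e"
      unfolding eventually_atin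
      by (auto intro!: exI[of _ "{y\<in>E. p l (y - x) < e}"] openin_ball)
  qed
  then show "continuous_map \<tau> euclideanreal (\<lambda>x. C * p l x)"
    by (intro continuous_map_real_mult) auto
qed

lemma bounded_by_seminorm:
  assumes hom: "\<And>c x. x \<in> E \<Longrightarrow> q (c *c x) = cmod c * q x"
    and U: "openin \<tau> U" "0 \<in> U" "\<And>x. x \<in> U \<Longrightarrow> q x < 1"
  obtains l C where "0 < C" "\<And>x. x \<in> E \<Longrightarrow> q x \<le> C * p l x"
proof -
  obtain l r where lr: "0 < r" "{y\<in>E. p l (y - 0) < r} \<subseteq> U" using U(1,2) by (rule openin_nhd)
  have small: "q x < 1" if "x \<in> E" "p l x < r" for x using lr that U(3) by auto
  have "q x \<le> 1 / r * p l x" if x: "x \<in> E" for x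
  proof (rule field_le_epsilon)
    fix e :: real assume e: "0 < e"
    \<comment> \<open>The summand \<open>r * e\<close> covers the case \<open>p l x = 0\<close>, and
      it makes \<open>1 / t\<close> exactly the desired bound plus \<open>e\<close>.\<close>
    define t where "t = r / (p l x + r * e)"
    have pos: "0 < p l x + r * e" using p_nonneg[OF x, of l] lr e by (simp add: add_nonneg_pos)
    then have t: "0 < t" using lr by (simp add: t_def)
    have "t * p l x < r" using pos lr e by (simp add: t_def divide_simps)
    then have "q (of_real t *c x) < 1"
      using x t p_scale[of x l "of_real t"] by (intro small) auto
    then have "t * q x < 1" using hom[OF x, of "of_real t"] t by simp
    then have "q x < 1 / t" using t by (simp add: field_simps)
    also have "1 / t = 1 / r * p l x + e" using lr by (simp add: t_def field_simps)
    finally show "q x \<le> 1 / r * p l x + e" by simp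
  qed
  then show ?thesis using that[of "1 / r" l] lr by simp
qed

lemma continuous_seminorm_bounded:
  assumes "continuous_seminorm E \<tau> q"
  obtains l C where "0 < C" "\<And>x. x \<in> E \<Longrightarrow> q x \<le> C * p l x"
proof (rule bounded_by_seminorm)
  show hom: "\<And>c x. x \<in> E \<Longrightarrow> q (c *c x) = cmod c * q x"
    using assms by (auto simp: continuous_seminorm_def seminorm_on_def)
  have "openin \<tau> {x \<in> topspace \<tau>. q x \<in> {..<1}}"
    using assms unfolding continuous_seminorm_def
    by (intro openin_continuous_map_preimage[of _ euclideanreal]) auto
  then show "openin \<tau> {x \<in> E. q x < 1}" by simp
  show "0 \<in> {x \<in> E. q x < 1}" using hom[of 0 0] by simp
qed (auto intro: that)

lemma continuous_map_operator:
  assumes T: "\<And>x. x \<in> E \<Longrightarrow> T x \<in> E" "\<And>x y. x \<in> E \<Longrightarrow> y \<in> E \<Longrightarrow> T (x - y) = T x - T y"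
    and bd: "\<And>l. \<exists>m C. 0 \<le> C \<and> (\<forall>x\<in>E. p l (T x) \<le> C * p m x)"
  shows "continuous_map \<tau> \<tau> T"
  unfolding continuous_map_def
proof (intro conjI allI impI)
  show "T \<in> topspace \<tau> \<rightarrow> topspace \<tau>" using T by auto
  fix U assume U: "openin \<tau> U"
  show "openin \<tau> {x \<in> topspace \<tau>. T x \<in> U}"
  proof (subst openin_subopen, safe)
    fix x assume x: "x \<in> topspace \<tau>" "T x \<in> U"
    obtain l r where lr: "0 < r" "{y\<in>E. p l (y - T x) < r} \<subseteq> U" using U x(2) by (rule openin_nhd)
    obtain m C where C: "0 \<le> C" "\<And>x. x \<in> E \<Longrightarrow> p l (T x) \<le> C * p m x" using bd[of l] by auto
    have "T y \<in> U" if y: "y \<in> E" "p m (y - x) < r / (C + 1)" for y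
    proof -
      have "p l (T y - T x) \<le> C * p m (y - x)" using C(2)[of "y - x"] T x y by simp
      also have "\<dots> \<le> (C + 1) * p m (y - x)" using p_nonneg[of "y - x" m] x y by (simp add: algebra_simps)
      also have "\<dots> < r" using y(2) C(1) by (simp add: field_simps)
      finally show ?thesis using lr T y by auto
    qed
    then show "\<exists>V. openin \<tau> V \<and> x \<in> V \<and> V \<subseteq> {x \<in> topspace \<tau>. T x \<in> U}"
      using x lr C by (intro exI[of _ "{y\<in>E. p m (y - x) < r / (C + 1)}"]) (auto intro: openin_ball)
  qed
qed


text \<open>If \<open>P\<close> does not fix \<open>b\<close>, a \<open>p 0\<close>-bounded
  functional that is nonzero at the residual \<open>b' = b - P b\<close> provides a rank one
  correction of \<open>P\<close>; it does not disturb \<open>span B\<close>, because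
  \<open>x - P x\<close> is 0 there. Bounds by the smallest norm are what makes all norms comparable
  on a finite-dimensional subspace.\<close>

lemma bounded_projection:
  assumes sep: "\<And>b. b \<in> E \<Longrightarrow> b \<noteq> 0 \<Longrightarrow>
      \<exists>\<phi> C. linear_functional_on E \<phi> \<and> (\<forall>x\<in>E. cmod (\<phi> x) \<le> C * p 0 x) \<and> \<phi> b \<noteq> 0"
    and B: "finite B" "B \<subseteq> E"
  shows "\<exists>P C. (\<forall>x\<in>E. P x \<in> E \<and> p k (P x) \<le> C * p 0 x) \<and>
      (\<forall>x\<in>E. \<forall>y\<in>E. P (x + y) = P x + P y) \<and> (\<forall>c. \<forall>x\<in>E. P (c *c x) = c *c P x) \<and>
      (\<forall>x\<in>span B. P x = x)"
  using B
proof (induction B rule: finite_induct)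
  case empty
  then show ?case by (intro exI[of _ "\<lambda>_. 0"] exI[of _ 0]) auto
next
  case (insert b B)
  have BE: "B \<subseteq> E" using insert.prems by simp
  obtain P C where P0: "\<forall>x\<in>E. P x \<in> E \<and> p k (P x) \<le> C * p 0 x"
      "\<forall>x\<in>E. \<forall>y\<in>E. P (x + y) = P x + P y" "\<forall>c. \<forall>x\<in>E. P (c *c x) = c *c P x"
      "\<forall>x\<in>span B. P x = x"
    using insert.IH[OF BE] by (elim exE conjE) (rule that)
  have P: "\<And>x. x \<in> E \<Longrightarrow> P x \<in> E" "\<And>x. x \<in> E \<Longrightarrow> p k (P x) \<le> C * p 0 x"
      "\<And>x y. x \<in> E \<Longrightarrow> y \<in> E \<Longrightarrow> P (x + y) = P x + P y"
      "\<And>c x. x \<in> E \<Longrightarrow> P (c *c x) = c *c P x" "\<And>x. x \<in> span B \<Longrightarrow> P x = x"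
    using P0 by blast+
  have b: "b \<in> E" using insert by auto
  have span_E: "span (insert b B) \<subseteq> E"
    using insert.prems subspace_E by (intro span_minimal) auto
  have span_B: "span B \<subseteq> E"
    using insert.prems subspace_E by (intro span_minimal) auto
  show ?case
  proof (cases "P b = b")
    case True
    have "P x = x" if x: "x \<in> span (insert b B)" for x
    proof -
      obtain c where c: "x - c *c b \<in> span B" using x by (auto simp: span_insert)
      have "P x = P ((x - c *c b) + c *c b)" by simp
      also have "\<dots> = P (x - c *c b) + P (c *c b)" using c span_B b by (intro P(3)) auto
      also have "\<dots> = x" using c True b P(4,5) by simp
      finally show ?thesis .
    qed
    with P show ?thesis by (intro exI[of _ P] exI[of _ C]) auto
  next
    case False
    define b' where "b' = b - P b"
    have b': "b' \<in> E" "b' \<noteq> 0" using False b P(1) by (auto simp: b'_def)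
    obtain \<phi> D where \<phi>: "linear_functional_on E \<phi>" "\<And>x. x \<in> E \<Longrightarrow> cmod (\<phi> x) \<le> D * p 0 x" "\<phi> b' \<noteq> 0"
      using sep[OF b'] by auto
    note \<phi>_add = \<phi>(1)[unfolded linear_functional_on_def, THEN conjunct1, rule_format]
    note \<phi>_scale = \<phi>(1)[unfolded linear_functional_on_def, THEN conjunct2, rule_format]
    have \<phi>_0: "\<phi> 0 = 0" using \<phi>_scale[of 0 0] by simp
    define Q where "Q x = P x + (\<phi> (x - P x) / \<phi> b') *c b'" for x
    have Q_E: "Q x \<in> E" if "x \<in> E" for x using that P(1) b' by (simp add: Q_def)
    define D' where "D' = \<bar>D\<bar> * (1 + C) / cmod (\<phi> b') * p k b'"
    have Q_bd: "p k (Q x) \<le> (C + D') * p 0 x" if x: "x \<in> E" for x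
    proof -
      have "p 0 (x - P x) \<le> p 0 x + p 0 (P x)" using x P(1) by (intro p_diff) auto
      moreover have "p 0 (P x) \<le> p k (P x)" using x P(1) by (intro p_mono) auto
      ultimately have "p 0 (x - P x) \<le> (1 + C) * p 0 x" using P(2)[OF x] by (simp add: algebra_simps)
      then have "\<bar>D\<bar> * p 0 (x - P x) \<le> \<bar>D\<bar> * ((1 + C) * p 0 x)" by (intro mult_left_mono) auto
      moreover have "D * p 0 (x - P x) \<le> \<bar>D\<bar> * p 0 (x - P x)"
        using x P(1) by (intro mult_right_mono p_nonneg) auto
      moreover have "cmod (\<phi> (x - P x)) \<le> D * p 0 (x - P x)" using x P(1) by (intro \<phi>(2)) auto
      ultimately have 1: "cmod (\<phi> (x - P x)) \<le> \<bar>D\<bar> * (1 + C) * p 0 x"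
        by (simp only: mult.assoc)
      have "p k (Q x) \<le> p k (P x) + p k ((\<phi> (x - P x) / \<phi> b') *c b')"
        unfolding Q_def using x P(1) b' by (intro p_add) auto
      also have "p k ((\<phi> (x - P x) / \<phi> b') *c b') = cmod (\<phi> (x - P x)) / cmod (\<phi> b') * p k b'"
        using b' by (simp add: p_scale norm_divide)
      also have "\<dots> \<le> (\<bar>D\<bar> * (1 + C) * p 0 x) / cmod (\<phi> b') * p k b'"
        using 1 p_nonneg[OF b'(1)] by (intro mult_right_mono divide_right_mono) auto
      finally show ?thesis using P(2)[OF x] by (simp add: D'_def algebra_simps)
    qed
    have Q_add: "Q (x + y) = Q x + Q y" if xy: "x \<in> E" "y \<in> E" for x y
    proof -
      have eq: "(x + y) - P (x + y) = (x - P x) + (y - P y)" using xy P(3) by simp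
      have "\<phi> ((x + y) - P (x + y)) = \<phi> (x - P x) + \<phi> (y - P y)"
        unfolding eq using xy P(1) by (intro \<phi>_add) auto
      then show ?thesis using xy P(3) by (simp add: Q_def add_divide_distrib scale_left_distrib)
    qed
    have Q_scale: "Q (c *c x) = c *c Q x" if x: "x \<in> E" for x c
    proof -
      have eq: "c *c x - P (c *c x) = c *c (x - P x)" using x P(4) by (simp add: scale_right_diff_distrib)
      have "\<phi> (c *c x - P (c *c x)) = c * \<phi> (x - P x)"
        unfolding eq using x P(1) by (intro \<phi>_scale) auto
      then show ?thesis using x P(4) by (simp add: Q_def scale_right_distrib)
    qed
    have Q_id: "Q x = x" if x: "x \<in> span (insert b B)" for x
    proof -
      obtain c where c: "x - c *c b \<in> span B" using x by (auto simp: span_insert)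
      have 1: "Q (x - c *c b) = x - c *c b" using c P(5) \<phi>_0 by (simp add: Q_def)
      have 2: "Q b = b" using \<phi>(3) by (simp add: Q_def flip: b'_def) (simp add: b'_def)
      have "Q x = Q ((x - c *c b) + c *c b)" by simp
      also have "\<dots> = Q (x - c *c b) + Q (c *c b)" using c span_B b by (intro Q_add) auto
      also have "\<dots> = x" using 1 2 b Q_scale by simp
      finally show ?thesis .
    qed
    show ?thesis using Q_E Q_bd Q_add Q_scale Q_id
      by (intro exI[of _ Q] exI[of _ "C + D'"]) auto
  qed
qed

text \<open>A projection onto the span of the range fixes every \<open>T x\<close>, so its bound
  from \<open>p 0\<close> to \<open>p k\<close> is the claim. The constant depends on
  \<open>T\<close>; there is no uniformity over an equicontinuous family.\<close>

lemma finite_rank_norm_equivalence: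
  assumes sep: "\<And>b. b \<in> E \<Longrightarrow> b \<noteq> 0 \<Longrightarrow>
      \<exists>\<phi> C. linear_functional_on E \<phi> \<and> (\<forall>x\<in>E. cmod (\<phi> x) \<le> C * p 0 x) \<and> \<phi> b \<noteq> 0"
    and T: "finite_rank_operator E \<tau> T"
  shows "\<exists>C. \<forall>x\<in>E. p k (T x) \<le> C * p 0 (T x)"
proof -
  have TE: "T x \<in> E" if "x \<in> E" for x
    using T that unfolding finite_rank_operator_def continuous_map_def by auto
  obtain B where B: "finite B" "T ` E \<subseteq> span B" using T by (auto simp: finite_rank_operator_def)
  \<comment> \<open>The spanning set \<open>B\<close> may leave \<open>E\<close>, so a basis is
    taken inside the range of \<open>T\<close>.\<close>
  obtain B' where B': "B' \<subseteq> T ` E" "independent B'" "T ` E \<subseteq> span B'"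
    using maximal_independent_subset[of "T ` E"] by auto
  have fin: "finite B'" using independent_span_bound[OF B(1) B'(2)] B' B by auto
  have "B' \<subseteq> E" using B' TE by auto
  from bounded_projection[OF sep fin this, of k] obtain P C where
    P: "\<And>x. x \<in> E \<Longrightarrow> p k (P x) \<le> C * p 0 x" "\<And>x. x \<in> span B' \<Longrightarrow> P x = x" by blast
  have "p k (T x) \<le> C * p 0 (T x)" if "x \<in> E" for x
  proof -
    have "P (T x) = T x" using that B' by (intro P(2)) auto
    then show ?thesis using P(1)[OF TE[OF that]] by simp
  qed
  then show ?thesis by blast
qed

lemma equicontinuous_bounded:
  assumes eq: "equicontinuous \<tau> \<T>" and T: "\<And>T. T \<in> \<T> \<Longrightarrow> finite_rank_operator E \<tau> T"
  shows "\<exists>m C. 0 < C \<and> (\<forall>T\<in>\<T>. \<forall>x\<in>E. p l (T x) \<le> C * p m x)"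
proof -
  have "openin \<tau> {y\<in>E. p l (y - 0) < 1} \<and> 0 \<in> {y\<in>E. p l (y - 0) < 1}"
    using openin_ball[of 0 l 1] by simp
  then obtain U where U: "openin \<tau> U" "0 \<in> U" "\<And>T. T \<in> \<T> \<Longrightarrow> T ` U \<subseteq> {y\<in>E. p l (y - 0) < 1}"
    using eq unfolding equicontinuous_def by meson
  obtain m r where r: "0 < r" "{y\<in>E. p m (y - 0) < r} \<subseteq> U" using U(1,2) by (rule openin_nhd)
  have "p l (T x) \<le> 2 / r * p m x" if "T \<in> \<T>" and x: "x \<in> E" for T x
  proof (rule field_le_epsilon)
    fix e :: real assume e: "0 < e"
    have sc: "T (c *c x) = c *c T x" for c
      using T[OF that(1)] x by (auto simp: finite_rank_operator_def)
    have Tx: "T x \<in> E"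
      using T[OF that(1)] x unfolding finite_rank_operator_def continuous_map_def by auto
    define t where "t = r / (2 * p m x + r * e)"
    have pos: "0 < 2 * p m x + r * e" using p_nonneg[OF x, of m] r e by (simp add: add_nonneg_pos)
    then have t: "0 < t" using r by (simp add: t_def)
    have "t * p m x < r" using pos r e p_nonneg[OF x, of m] 
      by (simp add: t_def divide_simps) (simp add: add_nonneg_pos)
    then have "of_real t *c x \<in> U" using x t r(2) p_scale[of x m "of_real t"] by auto
    then have "p l (of_real t *c T x) < 1" using U(3)[OF that(1)] sc by auto
    then have "t * p l (T x) < 1" using p_scale[OF Tx, of l "of_real t"] t by simp
    then have "p l (T x) < 1 / t" using t by (simp add: field_simps)
    also have "1 / t = 2 / r * p m x + e" using r by (simp add: t_def field_simps)
    finally show "p l (T x) \<le> 2 / r * p m x + e" by simp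
  qed
  then show ?thesis using r by (intro exI[of _ m] exI[of _ "2 / r"]) auto
qed

text \<open>The levels are fixed in the order \<open>a\<close> (bounding \<open>p 0\<close> of the
  operators), \<open>k\<close> (from \<open>z\<close>), \<open>m0\<close> (bounding
  \<open>p k\<close> of the operators), \<open>m\<close>. An operator \<open>T\<close> close to the
  identity at one late term \<open>z M\<close> keeps all later \<open>T (z N)\<close> near
  \<open>z M\<close> in \<open>p k\<close>, by the \<open>p m\<close>-Cauchy property. But for this
  fixed \<open>T\<close> they are \<open>p k\<close>-null, since \<open>p k\<close> is comparable
  with \<open>p 0\<close> on the range and \<open>p 0 (T (z N)) \<le> A * p a (z N)\<close>.\<close>

theorem not_bounded_approximation_property:
  assumes sep: "\<And>b. b \<in> E \<Longrightarrow> b \<noteq> 0 \<Longrightarrow>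
      \<exists>\<phi> C. linear_functional_on E \<phi> \<and> (\<forall>x\<in>E. cmod (\<phi> x) \<le> C * p 0 x) \<and> \<phi> b \<noteq> 0"
    and z: "\<And>a. \<exists>k. \<forall>m0. \<exists>m\<ge>m0. \<exists>z w. range z \<subseteq> E \<and> (\<lambda>N. p a (z N)) \<longlonglongrightarrow> 0 \<and>
        (\<forall>e>0. \<exists>M. \<forall>N\<ge>M. p m (z N - z M) < e) \<and> 0 < w \<and> (\<forall>\<^sub>F N in sequentially. w \<le> p k (z N))"
  shows "\<not> bounded_approximation_property E \<tau>"
proof
  assume "bounded_approximation_property E \<tau>"
  then obtain \<T> \<F> where T: "\<And>T. T \<in> \<T> \<Longrightarrow> finite_rank_operator E \<tau> T" "equicontinuous \<tau> \<T>"
      and F: "\<F> \<noteq> bot" "\<F> \<le> principal \<T>" "\<And>x. x \<in> E \<Longrightarrow> limitin \<tau> (\<lambda>T. T x) x \<F>"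
    unfolding bounded_approximation_property_def by blast
  obtain a A where A: "0 < A" "\<And>T x. T \<in> \<T> \<Longrightarrow> x \<in> E \<Longrightarrow> p 0 (T x) \<le> A * p a x"
    using equicontinuous_bounded[OF T(2,1), of 0] by blast
  obtain k where k: "\<And>m0. \<exists>m\<ge>m0. \<exists>z w. range z \<subseteq> E \<and> (\<lambda>N. p a (z N)) \<longlonglongrightarrow> 0 \<and>
        (\<forall>e>0. \<exists>M. \<forall>N\<ge>M. p m (z N - z M) < e) \<and> 0 < w \<and> (\<forall>\<^sub>F N in sequentially. w \<le> p k (z N))"
    using z[of a] by blast
  obtain m0 D where D0: "0 < D" "\<And>T x. T \<in> \<T> \<Longrightarrow> x \<in> E \<Longrightarrow> p k (T x) \<le> D * p m0 x"
    using equicontinuous_bounded[OF T(2,1), of k] by blast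
  obtain m z w where z: "range z \<subseteq> E" "(\<lambda>N. p a (z N)) \<longlonglongrightarrow> 0" "0 < w"
      "\<And>e. e > 0 \<Longrightarrow> \<exists>M. \<forall>N\<ge>M. p m (z N - z M) < e" "\<forall>\<^sub>F N in sequentially. w \<le> p k (z N)"
      and "m0 \<le> m"
    using k[of m0] by blast
  have D: "p k (T x) \<le> D * p m x" if "T \<in> \<T>" "x \<in> E" for T x
    using D0(2)[OF that] mult_left_mono[OF p_mono[OF \<open>m0 \<le> m\<close> that(2)], of D] D0(1) by linarith
  have zE: "z N \<in> E" for N using z(1) by auto
  obtain N0 where N0: "\<And>N. N \<ge> N0 \<Longrightarrow> w \<le> p k (z N)"
    using z(5) by (auto simp: eventually_sequentially)
  \<comment> \<open>Two differences below \<open>w / 8 / D\<close> give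
    \<open>D * p m (z N - z M) < w / 4\<close>; the three errors of this size at the end add up to
    less than \<open>w\<close>.\<close>
  have *: "min (w / 8) (w / 8 / D) > 0" using z(3) D0 by simp
  then obtain M0 where M0: "\<And>N. N \<ge> M0 \<Longrightarrow> p m (z N - z M0) < min (w / 8) (w / 8 / D)" using z(4) by blast
  define M where "M = max M0 N0"
  have M: "D * p m (z N - z M) < w / 4" if "N \<ge> M" for N
  proof -
    have "p m (z N - z M) \<le> p m (z N - z M0) + p m (z M0 - z M)" using zE by (intro p_triangle) auto
    also have "p m (z M0 - z M) = p m (z M - z M0)" using zE by (intro p_commute) auto
    also have "p m (z N - z M0) + \<dots> < w / 8 / D + w / 8 / D"
      using M0[of N] M0[of M] that by (auto simp: M_def)
    finally show ?thesis using D0(1) by (simp add: field_simps)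
  qed
  have "\<forall>\<^sub>F T in \<F>. T \<in> \<T>" using F(2) by (simp add: le_principal)
  moreover have "\<forall>\<^sub>F T in \<F>. p k (T (z M) - z M) < w / 4"
    by (rule order_tendstoD(2)[OF limitin_D(3)[OF F(3)[OF zE]]]) (use z(3) in simp)
  ultimately have "\<forall>\<^sub>F T in \<F>. T \<in> \<T> \<and> p k (T (z M) - z M) < w / 4" by eventually_elim simp
  then obtain T where TT: "T \<in> \<T>" "p k (T (z M) - z M) < w / 4"
    using eventually_happens'[OF F(1)] by blast
  have TE: "T x \<in> E" if "x \<in> E" for x
    using T(1)[OF TT(1)] that unfolding finite_rank_operator_def continuous_map_def by auto
  have Tadd: "T (x + y) = T x + T y" if "x \<in> E" "y \<in> E" for x y
    using T(1)[OF TT(1)] that unfolding finite_rank_operator_def by auto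
  obtain C where C: "\<And>x. x \<in> E \<Longrightarrow> p k (T x) \<le> C * p 0 (T x)"
    using finite_rank_norm_equivalence[OF sep T(1)[OF TT(1)], of k] by blast
  \<comment> \<open>\<open>C\<close> depends on \<open>T\<close>, so \<open>N\<close> is chosen only
    after \<open>T\<close>.\<close>
  have lim: "(\<lambda>N. \<bar>C\<bar> * (A * p a (z N))) \<longlonglongrightarrow> \<bar>C\<bar> * (A * 0)" by (intro tendsto_intros z)
  have "\<forall>\<^sub>F N in sequentially. N \<ge> M \<and> \<bar>C\<bar> * (A * p a (z N)) < w / 4"
    by (intro eventually_conj eventually_ge_at_top order_tendstoD(2)[OF lim]) (use z(3) in simp)
  then obtain N where N: "N \<ge> M" "\<bar>C\<bar> * (A * p a (z N)) < w / 4"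
    using eventually_happens'[OF sequentially_bot] by blast
  have "w \<le> p k (z M)" using N0 by (simp add: M_def)
  moreover have "p k (z M) \<le> p k (T (z M)) + p k (z M - T (z M))" using zE TE by (intro p_le_diff) auto
  moreover have "p k (z M - T (z M)) < w / 4" using TT(2) p_commute[OF zE TE[OF zE]] by simp
  moreover have "p k (T (z M)) \<le> p k (T (z N)) + p k (T (z M) - T (z N))"
    using zE TE by (intro p_le_diff) auto
  moreover have "T (z M) - T (z N) = T (z M - z N)"
    using Tadd[of "z M - z N" "z N"] zE by (simp add: algebra_simps)
  moreover have "p k (T (z M - z N)) \<le> D * p m (z M - z N)" using D[OF TT(1)] zE by simp
  moreover have "D * p m (z M - z N) < w / 4" using M[OF N(1)] p_commute[OF zE zE] by simp
  moreover have "p k (T (z N)) \<le> C * p 0 (T (z N))" using C zE by simp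
  moreover have "C * p 0 (T (z N)) \<le> \<bar>C\<bar> * p 0 (T (z N))"
    using p_nonneg[OF TE[OF zE]] by (intro mult_right_mono) auto
  moreover have "\<bar>C\<bar> * p 0 (T (z N)) \<le> \<bar>C\<bar> * (A * p a (z N))"
    using A(2)[OF TT(1) zE] by (intro mult_left_mono) auto
  ultimately show False using z(3) N(2) by simp
qed

end

section \<open>Schauder bases\<close>

context graded_frechet
begin

text \<open>If no \<open>B r\<close> were dense in a ball, every ball would contain a smaller closed
  ball missing \<open>B r\<close>; nested choices have a common point, which lies in no
  \<open>B r\<close>. Density is meant in every norm \<open>p m'\<close>, although the ball belongs
  to a single \<open>p m\<close>.\<close>

lemma Baire_category:
  fixes B :: "nat \<Rightarrow> 'v set"
  assumes cover: "\<And>x. x \<in> E \<Longrightarrow> \<exists>r. x \<in> B r"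
  shows "\<exists>r x m d. x \<in> E \<and> 0 < d \<and>
    (\<forall>y\<in>E. p m (y - x) < d \<longrightarrow> (\<forall>m' h. 0 < h \<longrightarrow> (\<exists>b\<in>B r \<inter> E. p m' (y - b) < h)))"
proof (rule ccontr)
  assume "\<not> ?thesis"
  then have neg: "\<not> (\<forall>y\<in>E. p m (y - x) < d \<longrightarrow> (\<forall>m' h. 0 < h \<longrightarrow> (\<exists>b\<in>B r \<inter> E. p m' (y - b) < h)))"
    if "x \<in> E" "0 < d" for r x m d
    using that by (elim contrapos_nn) (intro exI conjI)
  have H: "\<exists>y m' h. y \<in> E \<and> p m (y - x) < d \<and> 0 < h \<and> (\<forall>b\<in>B r \<inter> E. h \<le> p m' (y - b))"
    if "x \<in> E" "0 < d" for r x m d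
    using neg[OF that, of m r] unfolding not_less[symmetric] by blast
  \<comment> \<open>A state is a triple of centre, level and radius. The balls are closed so that
    the limit of the centres stays in all of them; step \<open>r\<close> avoids
    \<open>B r\<close>.\<close>
  define P where "P = (\<lambda>s :: 'v \<times> nat \<times> real. fst s \<in> E \<and> 0 < snd (snd s))"
  define ball where "ball = (\<lambda>s :: 'v \<times> nat \<times> real. {z\<in>E. p (fst (snd s)) (z - fst s) \<le> snd (snd s)})"
  define Q where "Q = (\<lambda>r (s :: 'v \<times> nat \<times> real) (t :: 'v \<times> nat \<times> real).
      ball t \<subseteq> ball s \<and> ball t \<inter> B r = {} \<and>
      Suc (fst (snd s)) \<le> fst (snd t) \<and> snd (snd t) \<le> snd (snd s) / 2)"
  have step: "\<exists>t. P t \<and> Q r s t" if "P s" for r s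
  proof -
    obtain x m d where s: "s = (x, m, d)" by (metis prod_cases3)
    have xd: "x \<in> E" "0 < d" using that s by (auto simp: P_def)
    then obtain y m' h where y: "y \<in> E" "p m (y - x) < d / 2" "0 < h" "\<And>b. b \<in> B r \<inter> E \<Longrightarrow> h \<le> p m' (y - b)"
      using H[of x "d / 2" m r] by auto
    \<comment> \<open>Raising the level in each step makes the centres Cauchy for every
      norm.\<close>
    define M where "M = max (Suc m) m'"
    have A: "p m (z - x) \<le> d" if z: "z \<in> E" "p M (z - y) \<le> min (h / 2) (d / 2)" for z
    proof -
      have "p m (z - y) \<le> p M (z - y)" using z y by (intro p_mono) (auto simp: M_def)
      then show ?thesis using p_triangle[OF z(1) y(1) xd(1), of m] z y(2) by simp
    qed
    have "z \<notin> B r" if z: "z \<in> E" "p M (z - y) \<le> min (h / 2) (d / 2)" for z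
    proof
      assume "z \<in> B r"
      then have "h \<le> p m' (z - y)" using y(4)[of z] z(1) p_commute[OF z(1) y(1), of m'] by simp
      also have "\<dots> \<le> p M (z - y)" using z y by (intro p_mono) (auto simp: M_def)
      finally show False using z(2) y(3) by simp
    qed
    with A show ?thesis using y xd
      by (intro exI[of _ "(y, M, min (h / 2) (d / 2))"]) (auto simp: P_def Q_def s M_def ball_def)
  qed
  have "\<exists>f. \<forall>n. P (f n) \<and> Q n (f n) (f (Suc n))"
  proof (rule dependent_nat_choice)
    show "\<exists>s. P s" by (rule exI[of _ "(0, 0, 1)"]) (simp add: P_def)
  qed (rule step)
  then obtain f where f: "\<And>n. P (f n)" "\<And>n. Q n (f n) (f (Suc n))" by auto
  define X where "X n = fst (f n)" for n
  define M where "M n = fst (snd (f n))" for n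
  define D where "D n = snd (snd (f n))" for n
  have ball: "ball (f n) = {z\<in>E. p (M n) (z - X n) \<le> D n}" for n
    by (simp add: ball_def X_def M_def D_def)
  have XE: "X n \<in> E" and D0: "0 < D n" for n using f(1)[of n] by (auto simp: P_def X_def D_def)
  have sub: "ball (f (Suc n)) \<subseteq> ball (f n)" and dis: "ball (f (Suc n)) \<inter> B n = {}"
    and MS: "Suc (M n) \<le> M (Suc n)" and DS: "D (Suc n) \<le> D n / 2" for n
    using f(2)[of n] by (auto simp: Q_def M_def D_def)
  have Mn: "n \<le> M n" for n by (induction n) (use MS in \<open>auto intro: order_trans[OF _ MS]\<close>)
  have Dn: "D n \<le> D 0 * (1 / 2) ^ n" for n
  proof (induction n)
    case (Suc n) then show ?case using DS[of n] by simp
  qed simp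
  have nest: "ball (f j) \<subseteq> ball (f i)" if "i \<le> j" for i j
    using lift_Suc_antimono_le[of "\<lambda>n. ball (f n)", OF sub that] .
  have Xij: "p (M i) (X j - X i) \<le> D i" if "i \<le> j" for i j
    using nest[OF that] XE[of j] D0[of j] by (auto simp: ball)
  have "\<exists>N. \<forall>m\<ge>N. \<forall>n\<ge>N. p l (X m - X n) < e" if e: "0 < e" for l e
  proof -
    have "(\<lambda>n. D 0 * (1 / 2) ^ n) \<longlonglongrightarrow> D 0 * 0" by (intro tendsto_intros LIMSEQ_power_zero) auto
    then have "\<forall>\<^sub>F n in sequentially. l \<le> n \<and> D 0 * (1 / 2) ^ n < e / 2"
      by (intro eventually_conj eventually_ge_at_top, elim order_tendstoD(2)) (use e in simp)
    then obtain N where N: "l \<le> N" "D 0 * (1 / 2) ^ N < e / 2"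
      using eventually_happens'[OF sequentially_bot] by blast
    have 1: "p l (X m - X N) < e / 2" if "m \<ge> N" for m
      using p_mono[of l "M N" "X m - X N"] Xij[OF that] Dn[of N] N Mn[of N] XE by auto
    have "p l (X m - X n) < e" if "m \<ge> N" "n \<ge> N" for m n
      using 1[OF that(1)] 1[OF that(2)] p_triangle[OF XE XE XE, of l m n N] p_commute[OF XE XE, of l n N]
      by linarith
    then show ?thesis by blast
  qed
  from complete[OF XE this] obtain x where x: "x \<in> E" "\<And>l. (\<lambda>n. p l (X n - x)) \<longlonglongrightarrow> 0" by blast
  have "x \<in> ball (f i)" for i
  proof -
    have "p (M i) (x - X i) \<le> D i"
    proof (rule LIMSEQ_le_const[of "\<lambda>j. p (M i) (X j - x) + D i"])
      show "(\<lambda>j. p (M i) (X j - x) + D i) \<longlonglongrightarrow> D i"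
        using tendsto_add[OF x(2)[of "M i"] tendsto_const[of "D i"]] by simp
      show "\<exists>N. \<forall>n\<ge>N. p (M i) (x - X i) \<le> p (M i) (X n - x) + D i"
      proof (intro exI[of _ i] allI impI)
        fix n assume "i \<le> n"
        from Xij[OF this] show "p (M i) (x - X i) \<le> p (M i) (X n - x) + D i"
          using p_triangle[of x "X n" "X i" "M i"] p_commute[OF XE x(1), of "M i" n] XE x(1) by simp
      qed
    qed
    with x show ?thesis by (simp add: ball)
  qed
  then have "x \<notin> B r" for r using dis[of r] by blast
  with cover[OF x(1)] show False by blast
qed

end

section \<open>Coefficients and partial sums of a Schauder basis\<close>

locale basis_graded_frechet = graded_frechet scale E p
  for scale :: "complex \<Rightarrow> 'v::ab_group_add \<Rightarrow> 'v" (infixr \<open>*c\<close> 75)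
    and E :: "'v set" and p :: "nat \<Rightarrow> 'v \<Rightarrow> real" +
  fixes e :: "nat \<Rightarrow> 'v"
  assumes basis: "schauder_basis E \<tau> e"
begin

definition coef :: "'v \<Rightarrow> nat \<Rightarrow> complex" where
  "coef x = (THE c. limitin \<tau> (\<lambda>N. \<Sum>n<N. c n *c e n) x sequentially)"

definition psum :: "nat \<Rightarrow> 'v \<Rightarrow> 'v" where
  "psum N x = (\<Sum>n<N. coef x n *c e n)"

lemma e_in [simp]: "e n \<in> E"
  using basis by (auto simp: schauder_basis_def)

lemma psum_in [simp]: "psum N x \<in> E" by (simp add: psum_def)

lemma coef_limitin: "x \<in> E \<Longrightarrow> limitin \<tau> (\<lambda>N. psum N x) x sequentially"
  unfolding coef_def psum_def
  by (rule theI'[OF basis[unfolded schauder_basis_def, THEN conjunct2, rule_format]])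

lemma coef_tendsto: "x \<in> E \<Longrightarrow> (\<lambda>N. p l (psum N x - x)) \<longlonglongrightarrow> 0"
  by (rule limitin_D(3)[OF coef_limitin])

lemma coef_eqI:
  assumes "x \<in> E" "\<And>l. (\<lambda>N. p l ((\<Sum>n<N. c n *c e n) - x)) \<longlonglongrightarrow> 0"
  shows "coef x = c"
proof -
  have "limitin \<tau> (\<lambda>N. \<Sum>n<N. c n *c e n) x sequentially"
    using assms by (intro limitin_I) auto
  then show ?thesis unfolding coef_def
    by (rule the1_equality[OF basis[unfolded schauder_basis_def, THEN conjunct2, rule_format, OF assms(1)]])
qed

lemma coef_add:
  assumes "x \<in> E" "y \<in> E"
  shows "coef (x + y) n = coef x n + coef y n"
proof -
  have "coef (x + y) = (\<lambda>n. coef x n + coef y n)"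
  proof (rule coef_eqI)
    fix l
    have *: "(\<Sum>n<N. (coef x n + coef y n) *c e n) - (x + y) = (psum N x - x) + (psum N y - y)" for N
      by (simp add: psum_def scale_left_distrib sum.distrib)
    have lim: "(\<lambda>N. p l (psum N x - x) + p l (psum N y - y)) \<longlonglongrightarrow> 0"
      using tendsto_add[OF coef_tendsto[OF assms(1)] coef_tendsto[OF assms(2)], of l l] by simp
    show "(\<lambda>N. p l ((\<Sum>n<N. (coef x n + coef y n) *c e n) - (x + y))) \<longlonglongrightarrow> 0"
      unfolding * by (rule Lim_null_comparison[OF _ lim])
        (use assms p_add[of "psum _ x - x" "psum _ y - y" l] in \<open>auto simp: p_nonneg\<close>)
  qed (use assms in auto)
  then show ?thesis by simp
qed

lemma coef_scale:
  assumes "x \<in> E"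
  shows "coef (a *c x) n = a * coef x n"
proof -
  have "coef (a *c x) = (\<lambda>n. a * coef x n)"
  proof (rule coef_eqI)
    fix l
    have *: "(\<Sum>n<N. (a * coef x n) *c e n) - a *c x = a *c (psum N x - x)" for N
      by (simp add: psum_def scale_right_diff_distrib scale_sum_right)
    have "(\<lambda>N. cmod a * p l (psum N x - x)) \<longlonglongrightarrow> cmod a * 0"
      using assms by (intro tendsto_mult tendsto_const coef_tendsto)
    then show "(\<lambda>N. p l ((\<Sum>n<N. (a * coef x n) *c e n) - a *c x)) \<longlonglongrightarrow> 0"
      unfolding * using assms by (simp add: p_scale)
  qed (use assms in auto)
  then show ?thesis by simp
qed

lemma coef_finite_sum:
  assumes "finite I"
  shows "coef (\<Sum>i\<in>I. c i *c e i) = (\<lambda>n. if n \<in> I then c n else 0)"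
proof (rule coef_eqI)
  fix l
  obtain N0 where N0: "I \<subseteq> {..<N0}" using assms finite_nat_bounded by blast
  have "(\<Sum>n<N. (if n \<in> I then c n else 0) *c e n) = (\<Sum>i\<in>I. c i *c e i)" if "N0 \<le> N" for N
  proof -
    have "(\<Sum>n<N. (if n \<in> I then c n else 0) *c e n) = (\<Sum>n\<in>I. (if n \<in> I then c n else 0) *c e n)"
      using N0 that by (intro sum.mono_neutral_right) auto
    then show ?thesis by simp
  qed
  then show "(\<lambda>N. p l ((\<Sum>n<N. (if n \<in> I then c n else 0) *c e n) - (\<Sum>i\<in>I. c i *c e i))) \<longlonglongrightarrow> 0"
    by (intro tendsto_eventually) (auto simp: eventually_sequentially intro!: exI[of _ N0])
qed auto

lemma e_nonzero: "e n \<noteq> 0"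
proof
  assume "e n = 0"
  then have "(\<Sum>i\<in>{n}. 1 *c e i) = (\<Sum>i\<in>{}. 1 *c e i)" by simp
  then show False using coef_finite_sum[of "{n}" "\<lambda>_. 1"] coef_finite_sum[of "{}" "\<lambda>_. 1"]
    by (metis emptyE finite.emptyI finite.insertI insertI1 zero_neq_one)
qed

lemma psum_add: "x \<in> E \<Longrightarrow> y \<in> E \<Longrightarrow> psum N (x + y) = psum N x + psum N y"
  by (simp add: psum_def coef_add scale_left_distrib sum.distrib)

lemma psum_scale: "x \<in> E \<Longrightarrow> psum N (a *c x) = a *c psum N x"
  by (simp add: psum_def coef_scale scale_sum_right)

lemma psum_diff: "x \<in> E \<Longrightarrow> y \<in> E \<Longrightarrow> psum N (x - y) = psum N x - psum N y"
  using psum_add[of "x - y" y N] by (simp add: algebra_simps)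

lemma coef_diff: "x \<in> E \<Longrightarrow> y \<in> E \<Longrightarrow> coef (x - y) n = coef x n - coef y n"
  using coef_add[of "x - y" y n] by (simp add: algebra_simps)

lemma coef_e_eq: "coef x n *c e n = psum (Suc n) x - psum n x"
  by (simp add: psum_def)

lemma psum_bounded: 
  assumes "x \<in> E"
  shows "\<exists>r::nat. \<forall>N. p l (psum N x) \<le> r"
proof -
  have "Bseq (\<lambda>N. p l (psum N x - x))"
    using coef_tendsto[OF assms] convergent_imp_Bseq convergentI by blast
  then obtain K where K: "\<And>N. \<bar>p l (psum N x - x)\<bar> \<le> K" by (auto simp: Bseq_def)
  have "p l (psum N x) \<le> p l x + K" for N
    using p_le_diff[OF psum_in assms, of l N x] K[of N] by simp
  moreover obtain r :: nat where "p l x + K \<le> r" using real_arch_simple by blast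
  ultimately show ?thesis by (meson order_trans)
qed

text \<open>Baire is applied to the sets on which all partial sums are bounded by \<open>r\<close>
  in \<open>p l\<close>; they exhaust \<open>E\<close> because convergent sequences of norms are
  bounded. The ball obtained has some centre \<open>x\<close>: subtracting approximations of
  \<open>y' + x\<close> and of \<open>x\<close> moves it to 0, at the cost of
  \<open>2 * real r\<close> in \<open>C\<close> (the 1 keeps \<open>C\<close> positive), and
  homogeneity gives the factor \<open>s\<close>.\<close>

lemma psum_almost_open:
  "\<exists>m C. 0 < C \<and> (\<forall>y\<in>E. \<forall>s. p m y < s \<longrightarrow>
     (\<forall>m' h. 0 < h \<longrightarrow> (\<exists>b\<in>E. (\<forall>N. p l (psum N b) \<le> C * s) \<and> p m' (y - b) < h)))"
proof -
  let ?B = "\<lambda>r::nat. {b. \<forall>N. p l (psum N b) \<le> real r}"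
  have cov: "\<exists>r. x \<in> ?B r" if "x \<in> E" for x using psum_bounded[OF that] by simp
  have "\<exists>r x m d. x \<in> E \<and> 0 < d \<and>
      (\<forall>y\<in>E. p m (y - x) < d \<longrightarrow> (\<forall>m' h. 0 < h \<longrightarrow> (\<exists>b\<in>?B r \<inter> E. p m' (y - b) < h)))"
    by (rule Baire_category) (rule cov)
  then obtain r x m d where x: "x \<in> E" "0 < d" and
    dense0: "\<forall>y\<in>E. p m (y - x) < d \<longrightarrow> (\<forall>m' h. 0 < h \<longrightarrow> (\<exists>b\<in>?B r \<inter> E. p m' (y - b) < h))"
    by (elim exE conjE) (rule that)
  have dense: "\<exists>b\<in>E. (\<forall>N. p l (psum N b) \<le> real r) \<and> p m' (y - b) < h"
    if "y \<in> E" "p m (y - x) < d" "0 < h" for y m' h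
    using dense0[rule_format, OF that, of m'] by (elim bexE) (rule bexI, auto)
  define C where "C = (2 * real r + 1) / d"
  have C: "0 < C" using x by (simp add: C_def)
  have "\<exists>b\<in>E. (\<forall>N. p l (psum N b) \<le> C * s) \<and> p m' (y - b) < h"
    if y: "y \<in> E" "p m y < s" "0 < h" for y s m' h
  proof -
    have s: "0 < s" using p_nonneg[OF y(1), of m] y by simp
    define t where "t = d / s"
    have t: "0 < t" using s x by (simp add: t_def)
    define y' where "y' = of_real t *c y"
    have y': "y' \<in> E" using y by (simp add: y'_def)
    have "p m y' = t * p m y" using y t by (simp add: y'_def p_scale)
    also have "\<dots> < t * s" using t y by (intro mult_strict_left_mono)
    finally have "p m y' < d" using s by (simp add: t_def)
    then have "p m ((y' + x) - x) < d" by simp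
    then obtain b1 where b1: "b1 \<in> E" "\<And>N. p l (psum N b1) \<le> real r" "p m' ((y' + x) - b1) < t * h / 2"
      using dense[of "y' + x" "t * h / 2" m'] y y' x t by auto
    obtain b2 where b2: "b2 \<in> E" "\<And>N. p l (psum N b2) \<le> real r" "p m' (x - b2) < t * h / 2"
      using dense[of x "t * h / 2" m'] y x t by auto
    define b where "b = of_real (1 / t) *c (b1 - b2)"
    have "p l (psum N b) \<le> C * s" for N
    proof -
      have "p l (psum N b) = 1 / t * p l (psum N b1 - psum N b2)"
        unfolding b_def using b1 b2 t by (simp add: psum_scale psum_diff p_scale norm_divide)
      also have "\<dots> \<le> 1 / t * (2 * real r + 1)"
        using b1(2)[of N] b2(2)[of N] p_diff[OF psum_in psum_in, of l N b1 N b2] t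
        by (intro mult_left_mono) auto
      finally show ?thesis using s x by (simp add: t_def C_def mult.commute)
    qed
    moreover have "p m' (y - b) < h"
    proof -
      have eq: "y - b = of_real (1 / t) *c (((y' + x) - b1) - (x - b2))"
        using t by (simp add: b_def y'_def scale_right_diff_distrib scale_right_distrib)
      have "p m' (y - b) = 1 / t * p m' (((y' + x) - b1) - (x - b2))"
        unfolding eq using t b1 b2 x y' by (subst p_scale) (auto simp: norm_divide)
      also have "\<dots> \<le> 1 / t * (p m' ((y' + x) - b1) + p m' (x - b2))"
        using t b1 b2 x y' by (intro mult_left_mono p_diff) auto
      also have "\<dots> < 1 / t * (t * h / 2 + t * h / 2)"
        using t b1 b2 by (intro mult_strict_left_mono add_strict_mono) auto
      also have "\<dots> = h" using t by simp
      finally show ?thesis .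
    qed
    moreover have "b \<in> E" using b1 b2 by (simp add: b_def)
    ultimately show ?thesis by blast
  qed
  then show ?thesis using C by blast
qed


text \<open>A basis is defined by convergence and uniqueness; continuity of its coefficients comes
  from an open mapping argument. \<open>x\<close> is split into pieces \<open>b k\<close> whose
  partial sums are at most \<open>\<sigma> / 2 ^ k\<close> in \<open>p (l + k)\<close>. The
  coefficients of the pieces add up to some \<open>\<gamma>\<close>, the series with coefficients
  \<open>\<gamma>\<close> converges to \<open>x\<close> in every norm, and uniqueness of the
  expansion carries the bound over to the partial sums of \<open>x\<close>.\<close>

lemma psum_equicontinuous:
  "\<exists>m C. 0 < C \<and> (\<forall>x\<in>E. \<forall>N. p l (psum N x) \<le> C * p m x)"
proof -
  obtain mm CC where CC: "\<And>l. 0 < CC l" and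
    open0: "\<And>l. \<forall>y\<in>E. \<forall>s. p (mm l) y < s \<longrightarrow>
     (\<forall>m' h. 0 < h \<longrightarrow> (\<exists>b\<in>E. (\<forall>N. p l (psum N b) \<le> CC l * s) \<and> p m' (y - b) < h))"
    using psum_almost_open by metis
  have main: "p l (psum N x) \<le> 2 * (CC l * s)" if x: "x \<in> E" "p (mm l) x < s" for x s N
  proof -
    define \<sigma> where "\<sigma> = CC l * s"
    have s: "0 < s" using p_nonneg[OF x(1), of "mm l"] x(2) by simp
    have \<sigma>: "0 < \<sigma>" using s CC by (simp add: \<sigma>_def)
    \<comment> \<open>\<open>sk k\<close> is the size at which almost openness for level
      \<open>l + k\<close> costs exactly \<open>\<sigma> / 2 ^ k\<close>, and
      \<open>sk 0 = s\<close> matches the hypothesis on \<open>x\<close>.\<close>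
    define sk where "sk k = \<sigma> / 2 ^ k / CC (l + k)" for k
    have sk: "0 < sk k" "CC (l + k) * sk k = \<sigma> / 2 ^ k" for k
      using \<sigma> CC[of "l + k"] by (auto simp: sk_def)
    have sk0: "sk 0 = s" using CC[of l] by (simp add: sk_def \<sigma>_def)
    define P where "P k y \<longleftrightarrow> y \<in> E \<and> p (mm (l + k)) y < sk k" for k y
    define Q where "Q k y y' \<longleftrightarrow> (\<forall>N. p (l + k) (psum N (y - y')) \<le> \<sigma> / 2 ^ k) \<and> p k y' < 1 / 2 ^ k" for k y y'
    have "\<exists>f. \<forall>k. (P k (f k) \<and> (k = 0 \<longrightarrow> f k = x)) \<and> Q k (f k) (f (Suc k))"
    proof (rule dependent_nat_choice)
      show "\<exists>y. P 0 y \<and> (0 = (0::nat) \<longrightarrow> y = x)" using x sk0 by (auto simp: P_def)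
    next
      fix y k assume "P k y \<and> (k = 0 \<longrightarrow> y = x)"
      then have y: "y \<in> E" "p (mm (l + k)) y < sk k" by (auto simp: P_def)
      \<comment> \<open>One norm controls two things: the remainder must be admissible for the next
        step, and its \<open>p k\<close> norm must tend to 0 so that the pieces sum to
        \<open>x\<close>.\<close>
      define M where "M = max (mm (l + Suc k)) k"
      define h where "h = min (sk (Suc k)) (1 / 2 ^ k)"
      have h: "0 < h" using sk by (simp add: h_def)
      obtain b where b: "b \<in> E" "\<And>N. p (l + k) (psum N b) \<le> \<sigma> / 2 ^ k" "p M (y - b) < h"
        using open0[of "l + k", rule_format, OF y h, of M] sk(2)[of k] by auto
      have "p (mm (l + Suc k)) (y - b) \<le> p M (y - b)" "p k (y - b) \<le> p M (y - b)"
        using b y by (intro p_mono; simp add: M_def)+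
      then have "P (Suc k) (y - b)" "Q k y (y - b)"
        using b y by (auto simp: P_def Q_def h_def)
      then show "\<exists>y'. (P (Suc k) y' \<and> (Suc k = 0 \<longrightarrow> y' = x)) \<and> Q k y y'" by blast
    qed
    then obtain X where X: "\<And>k. P k (X k)" "X 0 = x" "\<And>k. Q k (X k) (X (Suc k))" by blast
    have XE: "X k \<in> E" for k using X(1)[of k] by (simp add: P_def)
    define b where "b k = X k - X (Suc k)" for k
    have bE: "b k \<in> E" for k using XE by (simp add: b_def)
    have pb: "p (l + k) (psum N (b k)) \<le> \<sigma> / 2 ^ k" for k N
      using X(3)[of k] by (simp add: Q_def b_def)
    have pX: "p k (X (Suc k)) < 1 / 2 ^ k" for k using X(3)[of k] by (simp add: Q_def)
    have sum_b: "(\<Sum>k=K..<K'. b k) = X K - X K'" if "K \<le> K'" for K K'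
      using sum_Suc_diff'[OF that, of "\<lambda>k. - X k"] by (simp add: b_def)
    have sum_\<sigma>: "(\<Sum>k=K..<K'. \<sigma> / 2 ^ k) \<le> 2 * \<sigma> / 2 ^ K" for K K'
    proof (cases "K \<le> K'")
      case True
      then have "(\<Sum>k=K..<K'. \<sigma> / 2 ^ k) = 2 * \<sigma> / 2 ^ K - 2 * \<sigma> / 2 ^ K'"
      proof (induction K' rule: dec_induct)
        case (step n)
        then show ?case by (simp only: sum.atLeastLessThan_Suc power_Suc)
      qed simp
      then show ?thesis using \<sigma> by simp
    qed (use \<sigma> in simp)
    have pd: "p j (psum N (X K - X K')) \<le> 2 * \<sigma> / 2 ^ K" if "K \<le> K'" "j \<le> l + K" for j N K K'
    proof -
      have ps: "psum N (\<Sum>k=K..<K'. b k) = (\<Sum>k=K..<K'. psum N (b k))"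
        using that(1)
      proof (induction K' rule: dec_induct)
        case base
        then show ?case using psum_scale[of 0 N 0] by simp
      next
        case (step n)
        then show ?case using bE by (simp add: psum_add)
      qed
      have "p j (psum N (X K - X K')) = p j (\<Sum>k=K..<K'. psum N (b k))"
        using sum_b[OF that(1)] ps by simp
      also have "\<dots> \<le> (\<Sum>k=K..<K'. p j (psum N (b k)))" by (intro p_sum) auto
      also have "\<dots> \<le> (\<Sum>k=K..<K'. \<sigma> / 2 ^ k)"
      proof (intro sum_mono)
        fix k assume k: "k \<in> {K..<K'}"
        have "p j (psum N (b k)) \<le> p (l + k) (psum N (b k))" using that k by (intro p_mono) auto
        with pb show "p j (psum N (b k)) \<le> \<sigma> / 2 ^ k" by (rule order_trans[rotated])
      qed
      finally show ?thesis using sum_\<sigma> by (rule order_trans)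
    qed
    have summ: "summable (\<lambda>k. coef (b k) n)" for n
    proof (rule summable_comparison_test')
      have en: "0 < p l (e n)" using e_nonzero by (intro p_pos) auto
      show "norm (coef (b k) n) \<le> (2 * \<sigma> / p l (e n)) * (1 / 2) ^ k" if "0 \<le> k" for k
      proof -
        have "cmod (coef (b k) n) * p l (e n) = p l (psum (Suc n) (b k) - psum n (b k))"
          by (simp flip: coef_e_eq p_scale)
        also have "\<dots> \<le> p l (psum (Suc n) (b k)) + p l (psum n (b k))" by (intro p_diff) auto
        also have "\<dots> \<le> p (l + k) (psum (Suc n) (b k)) + p (l + k) (psum n (b k))"
          by (intro add_mono p_mono) auto
        also have "\<dots> \<le> \<sigma> / 2 ^ k + \<sigma> / 2 ^ k" by (intro add_mono pb)
        finally show ?thesis using en by (simp add: field_simps power_one_over)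
      qed
      show "summable (\<lambda>k. (2 * \<sigma> / p l (e n)) * (1 / 2) ^ k)"
        by (intro summable_mult summable_geometric) auto
    qed
    define \<gamma> where "\<gamma> n = (\<Sum>k. coef (b k) n)" for n
    define G where "G N = (\<Sum>n<N. \<gamma> n *c e n)" for N
    have GE: "G N \<in> E" for N by (simp add: G_def)
    have coef_tel: "(\<Sum>k<K. coef (b k) n) = coef (x - X K) n" for K n
    proof (induction K)
      case 0
      then show ?case using X(2) coef_scale[of 0 0 n] by simp
    next
      case (Suc K)
      have "coef (x - X (Suc K)) n = coef ((x - X K) + b K) n" by (simp add: b_def)
      also have "\<dots> = coef (x - X K) n + coef (b K) n" using x XE bE by (intro coef_add) auto
      finally show ?case using Suc by simp
    qed
    have G_lim: "(\<lambda>K. p j (G N - psum N (x - X K))) \<longlonglongrightarrow> 0" for j N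
    proof -
      have "(\<lambda>K. \<Sum>n<N. cmod (\<gamma> n - (\<Sum>k<K. coef (b k) n)) * p j (e n)) \<longlonglongrightarrow> (\<Sum>n<N. cmod (\<gamma> n - \<gamma> n) * p j (e n))"
        unfolding \<gamma>_def by (intro tendsto_intros summable_LIMSEQ summ)
      then have lim: "(\<lambda>K. \<Sum>n<N. cmod (\<gamma> n - (\<Sum>k<K. coef (b k) n)) * p j (e n)) \<longlonglongrightarrow> 0" by simp
      have "p j (G N - psum N (x - X K)) \<le> (\<Sum>n<N. cmod (\<gamma> n - (\<Sum>k<K. coef (b k) n)) * p j (e n))" for K
      proof -
        have "G N - psum N (x - X K) = (\<Sum>n<N. (\<gamma> n - (\<Sum>k<K. coef (b k) n)) *c e n)"
          by (simp add: G_def psum_def coef_tel scale_left_diff_distrib sum_subtractf)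
        then have "p j (G N - psum N (x - X K)) \<le> (\<Sum>n<N. p j ((\<gamma> n - (\<Sum>k<K. coef (b k) n)) *c e n))"
          by (simp add: p_sum)
        then show ?thesis by (simp add: p_scale)
      qed
      then show ?thesis
        by (intro Lim_null_comparison[OF _ lim] always_eventually) (simp add: p_nonneg GE)
    qed
    \<comment> \<open>The bound on a finite block of pieces does not depend on its end
      \<open>K'\<close>. Letting \<open>K'\<close> grow carries it over to \<open>G N\<close>,
      uniformly in \<open>N\<close>.\<close>
    have G_close: "p j (G N - psum N (x - X K)) \<le> 2 * \<sigma> / 2 ^ K" if "j \<le> l + K" for j N K
    proof (rule LIMSEQ_le_const[of "\<lambda>K'. p j (G N - psum N (x - X K')) + 2 * \<sigma> / 2 ^ K"])
      show "(\<lambda>K'. p j (G N - psum N (x - X K')) + 2 * \<sigma> / 2 ^ K) \<longlonglongrightarrow> 2 * \<sigma> / 2 ^ K"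
        using tendsto_add[OF G_lim[of j N] tendsto_const[of "2 * \<sigma> / 2 ^ K"]] by simp
      have "p j (G N - psum N (x - X K)) \<le> p j (G N - psum N (x - X K')) + 2 * \<sigma> / 2 ^ K" if "K \<le> K'" for K'
      proof -
        have "psum N (x - X K') - psum N (x - X K) = psum N (X K - X K')"
          using x XE by (simp add: psum_diff)
        then show ?thesis
          using p_triangle[where x = "G N" and y = "psum N (x - X K')" and z = "psum N (x - X K)" and l = j]
            pd[OF that \<open>j \<le> l + K\<close>, of N] GE by simp
      qed
      then show "\<exists>N'. \<forall>n\<ge>N'. p j (G N - psum N (x - X K)) \<le> p j (G N - psum N (x - X n)) + 2 * \<sigma> / 2 ^ K"
        by blast
    qed
    have "coef x = \<gamma>"
    proof (rule coef_eqI[OF x(1)])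
      fix j
      show "(\<lambda>N. p j ((\<Sum>n<N. \<gamma> n *c e n) - x)) \<longlonglongrightarrow> 0"
        unfolding G_def[symmetric]
      proof (rule tendstoI)
        fix r :: real assume r: "0 < r"
        have "(\<lambda>K. 2 * \<sigma> * (1 / 2) ^ K + (1 / 2) ^ K) \<longlonglongrightarrow> 2 * \<sigma> * 0 + 0"
          by (intro tendsto_intros LIMSEQ_power_zero) auto
        then have "\<forall>\<^sub>F K in sequentially. j \<le> K \<and> 2 * \<sigma> * (1 / 2) ^ K + (1 / 2) ^ K < r / 2"
          by (intro eventually_conj eventually_ge_at_top, elim order_tendstoD(2)) (use r in simp)
        then obtain K where K: "j \<le> K" "2 * \<sigma> * (1 / 2) ^ K + (1 / 2) ^ K < r / 2"
          using eventually_happens'[OF sequentially_bot] by blast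
        \<comment> \<open>\<open>u\<close> is a finite sum of pieces: \<open>G N\<close> is close to
          \<open>psum N u\<close> uniformly in \<open>N\<close>, \<open>psum N u\<close> tends to
          \<open>u\<close>, and \<open>u\<close> is close to \<open>x\<close>.\<close>
        define u where "u = x - X (Suc K)"
        have uE: "u \<in> E" using x XE by (simp add: u_def)
        have 1: "p j (G N - psum N u) \<le> 2 * \<sigma> * (1 / 2) ^ K" for N
        proof -
          have "p j (G N - psum N u) \<le> 2 * \<sigma> / 2 ^ Suc K" using G_close[of j "Suc K" N] K by (simp add: u_def)
          also have "\<dots> \<le> 2 * \<sigma> * (1 / 2) ^ K" using \<sigma> by (simp add: field_simps)
          finally show ?thesis .
        qed
        have "p j (X (Suc K)) \<le> p K (X (Suc K))" using K XE by (intro p_mono) auto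
        then have 2: "p j (u - x) < (1 / 2) ^ K"
          using pX[of K] p_minus[OF XE, of j "Suc K"] by (simp add: u_def power_one_over)
        have "\<forall>\<^sub>F N in sequentially. p j (psum N u - u) < r / 2"
          by (rule order_tendstoD(2)[OF coef_tendsto[OF uE]]) (use r in simp)
        then show "\<forall>\<^sub>F N in sequentially. dist (p j (G N - x)) 0 < r"
        proof eventually_elim
          case (elim N)
          then show ?case
            using 1[of N] 2 K(2) p_triangle[where x = "G N" and y = "psum N u" and z = x and l = j]
              p_triangle[where x = "psum N u" and y = u and z = x and l = j] uE
              p_nonneg[of "G N - x" j] GE x(1) by (simp add: dist_real_def)
        qed
      qed
    qed
    then have "psum N x = G N" by (simp add: psum_def G_def)
    moreover have "p l (G N) \<le> 2 * \<sigma>"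
      using G_close[of l 0 N] X(2) psum_scale[of 0 N 0] by simp
    ultimately show ?thesis by (simp add: \<sigma>_def)
  qed
  \<comment> \<open>\<open>main\<close> asks for a strict bound, so \<open>s\<close> is taken as
    \<open>2 * p (mm l) x\<close>; this accounts for the 4 and for the separate case
    \<open>x = 0\<close>.\<close>
  have "p l (psum N x) \<le> (4 * CC l) * p (mm l) x" if x: "x \<in> E" for x N
  proof (cases "x = 0")
    case True
    then show ?thesis using psum_scale[of 0 N 0] by simp
  next
    case False
    then show ?thesis using main[OF x, of "2 * p (mm l) x" N] p_pos[OF x False, of "mm l"] by simp
  qed
  then show ?thesis using CC[of l] by (intro exI[of _ "mm l"] exI[of _ "4 * CC l"]) auto
qed

lemma coef_equicontinuous:
  "\<exists>m C. 0 < C \<and> (\<forall>x\<in>E. \<forall>n. cmod (coef x n) * p l (e n) \<le> C * p m x)"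
proof -
  obtain m C where C: "0 < C" "\<And>x N. x \<in> E \<Longrightarrow> p l (psum N x) \<le> C * p m x"
    using psum_equicontinuous[of l] by blast
  have "cmod (coef x n) * p l (e n) \<le> (2 * C) * p m x" if x: "x \<in> E" for x n
  proof -
    have "cmod (coef x n) * p l (e n) = p l (psum (Suc n) x - psum n x)"
      by (simp flip: coef_e_eq p_scale)
    also have "\<dots> \<le> p l (psum (Suc n) x) + p l (psum n x)" by (intro p_diff) auto
    finally show ?thesis using C(2)[OF x, of "Suc n"] C(2)[OF x, of n] by simp
  qed
  then show ?thesis using C(1) by (intro exI[of _ m] exI[of _ "2 * C"]) auto
qed

end

text \<open>Gaussian elimination on the last equation with pivot \<open>g N i0\<close>; the
  eliminated unknown is recovered as \<open>- s / g N i0\<close>.\<close>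

lemma underdetermined_system:
  fixes g :: "nat \<Rightarrow> 'i \<Rightarrow> complex"
  assumes "finite I" "N < card I"
  shows "\<exists>\<xi>. (\<exists>i\<in>I. \<xi> i \<noteq> 0) \<and> (\<forall>j<N. (\<Sum>i\<in>I. \<xi> i * g j i) = 0)"
  using assms
proof (induction N arbitrary: I g)
  case 0
  then have "I \<noteq> {}" by auto
  then show ?case by (intro exI[of _ "\<lambda>_. 1"]) auto
next
  case (Suc N)
  show ?case
  proof (cases "\<forall>i\<in>I. g N i = 0")
    case True
    from Suc obtain \<xi> where "\<exists>i\<in>I. \<xi> i \<noteq> 0" "\<forall>j<N. (\<Sum>i\<in>I. \<xi> i * g j i) = 0"
      using Suc_lessD by blast
    with True show ?thesis by (intro exI[of _ \<xi>]) (auto simp: less_Suc_eq)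
  next
    case False
    then obtain i0 where i0: "i0 \<in> I" "g N i0 \<noteq> 0" by blast
    define J where "J = I - {i0}"
    have J: "finite J" "N < card J" using Suc.prems i0 by (auto simp: J_def)
    obtain \<xi> where \<xi>: "\<exists>i\<in>J. \<xi> i \<noteq> 0"
        "\<And>j. j < N \<Longrightarrow> (\<Sum>i\<in>J. \<xi> i * (g j i - g N i / g N i0 * g j i0)) = 0"
      using Suc.IH[OF J, of "\<lambda>j i. g j i - g N i / g N i0 * g j i0"] by blast
    define s where "s = (\<Sum>i\<in>J. \<xi> i * g N i)"
    define \<xi>' where "\<xi>' = \<xi>(i0 := - s / g N i0)"
    have eq: "(\<Sum>i\<in>I. \<xi>' i * g j i) = (\<Sum>i\<in>J. \<xi> i * g j i) - s / g N i0 * g j i0" for j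
    proof -
      have "(\<Sum>i\<in>J. \<xi>' i * g j i) = (\<Sum>i\<in>J. \<xi> i * g j i)"
        by (intro sum.cong) (auto simp: J_def \<xi>'_def)
      then show ?thesis
        using sum.remove[OF Suc.prems(1) i0(1), of "\<lambda>i. \<xi>' i * g j i"] by (simp add: J_def \<xi>'_def)
    qed
    have "(\<Sum>i\<in>I. \<xi>' i * g j i) = 0" if "j < Suc N" for j
    proof (cases "j = N")
      case True
      then show ?thesis using i0 by (simp add: eq s_def)
    next
      case False
      then have "(\<Sum>i\<in>J. \<xi> i * g j i) - s / g N i0 * g j i0 = 0"
        using \<xi>(2)[of j] that
        by (simp add: s_def right_diff_distrib sum_subtractf sum_divide_distrib sum_distrib_right mult.assoc)
      then show ?thesis by (simp add: eq)
    qed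
    moreover have "\<exists>i\<in>I. \<xi>' i \<noteq> 0" using \<xi>(1) by (auto simp: J_def \<xi>'_def)
    ultimately show ?thesis by blast
  qed
qed

text \<open>The numbers are the entries of a 2 by 2 matrix of rank at most one with diagonal
  \<open>\<alpha>\<close>, \<open>\<beta>\<close>, and the last term is an off-diagonal entry with
  respect to the axes rotated by 45 degrees. The vanishing determinant makes one diagonal entry at
  most \<open>cmod \<gamma> + cmod \<delta>\<close>, and the rotated entry bounds the difference of
  the two diagonal entries.\<close>

lemma diagonal_entry_bound:
  fixes \<alpha> \<beta> \<gamma> \<delta> :: complex
  assumes "\<alpha> * \<beta> = \<gamma> * \<delta>"
  shows "cmod \<alpha> \<le> 2 * cmod \<gamma> + 2 * cmod \<delta> + cmod (\<alpha> + \<gamma> - \<delta> - \<beta>)"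
proof -
  have prod: "cmod \<alpha> * cmod \<beta> = cmod \<gamma> * cmod \<delta>" using assms by (metis norm_mult)
  have "cmod \<alpha> \<le> cmod \<gamma> + cmod \<delta> \<or> cmod \<beta> \<le> cmod \<gamma> + cmod \<delta>"
  proof (rule ccontr)
    assume "\<not> ?thesis"
    then have "(cmod \<gamma> + cmod \<delta>) * (cmod \<gamma> + cmod \<delta>) < cmod \<alpha> * cmod \<beta>"
      by (intro mult_strict_mono') auto
    moreover have "cmod \<gamma> * cmod \<delta> \<le> (cmod \<gamma> + cmod \<delta>) * (cmod \<gamma> + cmod \<delta>)"
      by (intro mult_mono) auto
    ultimately show False using prod by simp
  qed
  moreover have "cmod \<alpha> \<le> cmod \<beta> + cmod (\<alpha> + \<gamma> - \<delta> - \<beta>) + cmod \<gamma> + cmod \<delta>"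
  proof -
    have "\<alpha> = \<beta> + (\<alpha> + \<gamma> - \<delta> - \<beta>) - \<gamma> + \<delta>" by simp
    then show ?thesis by (smt (verit) norm_triangle_ineq norm_triangle_ineq4)
  qed
  ultimately show ?thesis using norm_ge_zero[of \<gamma>] norm_ge_zero[of \<delta>] norm_ge_zero[of "\<alpha> + \<gamma> - \<delta> - \<beta>"] by argo
qed

context complex_vector_space
begin

lemma linear_functional_on_sum:
  assumes "linear_functional_on S f" "subspace S" "finite I" "\<And>i. i \<in> I \<Longrightarrow> x i \<in> S"
  shows "f (\<Sum>i\<in>I. c i *c x i) = (\<Sum>i\<in>I. c i * f (x i))"
  using assms(3,4)
proof (induction I rule: finite_induct)
  case empty
  have "f (0 *c 0) = 0 * f 0"
    using assms(1) subspace_0[OF assms(2)] unfolding linear_functional_on_def by blast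
  then show ?case by simp
next
  case (insert i I)
  have "f (c i *c x i + (\<Sum>i\<in>I. c i *c x i)) = f (c i *c x i) + f (\<Sum>i\<in>I. c i *c x i)"
    using assms(1) insert subspace_sum[OF assms(2), of I "\<lambda>i. c i *c x i"] subspace_scale[OF assms(2)]
    unfolding linear_functional_on_def by auto
  then show ?case using insert assms(1) by (auto simp: linear_functional_on_def)
qed

lemma linear_functional_on_diff:
  assumes "linear_functional_on S f" "subspace S" "x \<in> S" "y \<in> S"
  shows "f (x - y) = f x - f y"
proof -
  have "f x = f ((x - y) + y)" by simp
  also have "\<dots> = f (x - y) + f y"
    using assms subspace_diff[OF assms(2)] unfolding linear_functional_on_def by blast
  finally show ?thesis by simp
qed

end

section \<open>Absoluteness of bases and the trace of a block\<close>

context basis_graded_frechet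
begin

lemma functional_sums:
  assumes f: "linear_functional_on E f" "\<And>x. x \<in> E \<Longrightarrow> cmod (f x) \<le> K * p l x" and x: "x \<in> E"
  shows "(\<lambda>n. coef x n * f (e n)) sums f x"
  unfolding sums_def
proof (rule Lim_transform[OF tendsto_const])
  have lim: "(\<lambda>N. K * p l (psum N x - x)) \<longlonglongrightarrow> 0"
    using tendsto_mult[OF tendsto_const[of K] coef_tendsto[OF x, of l]] by simp
  have *: "f (psum N x) = (\<Sum>n<N. coef x n * f (e n))" for N
    unfolding psum_def by (intro linear_functional_on_sum[OF f(1) subspace_E]) auto
  show "(\<lambda>N. (\<Sum>n<N. coef x n * f (e n)) - f x) \<longlonglongrightarrow> 0"
  proof (rule Lim_null_comparison[OF _ lim])
    have "cmod (f (psum N x) - f x) \<le> K * p l (psum N x - x)" for N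
      using f(2)[of "psum N x - x"] x linear_functional_on_diff[OF f(1) subspace_E, of "psum N x" x]
      by simp
    then show "\<forall>\<^sub>F N in sequentially. cmod ((\<Sum>n<N. coef x n * f (e n)) - f x) \<le> K * p l (psum N x - x)"
      by (simp add: *)
  qed
qed

text \<open>This is a form of the Dynin-Mityagin theorem. Let the norm \<open>p m\<close> bound the
  coefficients at level \<open>l\<close>, and normalise the \<open>e i\<close> in
  \<open>p (Suc m)\<close>. Among any \<open>N + 1\<close> of them, some combination is killed by
  the first \<open>N\<close> functionals \<open>a m j\<close>, hence is tiny in \<open>p m\<close>,
  while its largest coefficient is still controlled by \<open>p m\<close>; so one ratio
  \<open>d i\<close> is at most \<open>C * (N + 1) / 2 ^ N\<close>. Removing such indices one at a
  time shows that the \<open>d i\<close> are summable.\<close>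

lemma coef_absolute:
  assumes lin: "\<And>l j. linear_functional_on E (a l j)"
    and width: "\<And>l N x. x \<in> E \<Longrightarrow> (\<And>j. j < N \<Longrightarrow> a l j x = 0) \<Longrightarrow> p l x \<le> p (Suc l) x / 2 ^ N"
  shows "\<exists>m C. 0 < C \<and> (\<forall>x\<in>E. \<forall>I. finite I \<longrightarrow> (\<Sum>i\<in>I. cmod (coef x i) * p l (e i)) \<le> C * p m x)"
proof -
  obtain m C where C: "0 < C" "\<And>x n. x \<in> E \<Longrightarrow> cmod (coef x n) * p l (e n) \<le> C * p m x"
    using coef_equicontinuous[of l] by blast
  obtain m' C' where C': "0 < C'" "\<And>x n. x \<in> E \<Longrightarrow> cmod (coef x n) * p (Suc m) (e n) \<le> C' * p m' x"
    using coef_equicontinuous[of "Suc m"] by blast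
  define w where "w i = p (Suc m) (e i)" for i
  have w: "0 < w i" for i unfolding w_def using e_nonzero by (intro p_pos) auto
  define d where "d i = p l (e i) / w i" for i
  have d0: "0 \<le> d i" for i using w[of i] p_nonneg[OF e_in, of l i] by (simp add: d_def)
  have small: "\<exists>i\<in>I. d i \<le> C * (real (Suc N) / 2 ^ N)" if I: "finite I" "card I = Suc N" for I :: "nat set" and N
  proof -
    obtain \<xi> where \<xi>: "\<exists>i\<in>I. \<xi> i \<noteq> 0" "\<And>j. j < N \<Longrightarrow> (\<Sum>i\<in>I. \<xi> i * (a m j (e i) / of_real (w i))) = 0"
      using underdetermined_system[of I N "\<lambda>j i. a m j (e i) / of_real (w i)"] I by auto
    define M where "M = Max ((\<lambda>i. cmod (\<xi> i)) ` I)"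
    have M: "cmod (\<xi> i) \<le> M" if "i \<in> I" for i using I that by (auto simp: M_def)
    have "I \<noteq> {}" using I by auto
    then have "M \<in> (\<lambda>i. cmod (\<xi> i)) ` I" unfolding M_def using I by (intro Max_in) auto
    then obtain i0 where i0: "i0 \<in> I" "cmod (\<xi> i0) = M" by blast
    have Mpos: "0 < M" using \<xi>(1) M by (metis less_le_trans zero_less_norm_iff)
    define x where "x = (\<Sum>i\<in>I. (\<xi> i / of_real (w i)) *c e i)"
    have xE: "x \<in> E" by (simp add: x_def)
    have "a m j x = 0" if "j < N" for j
      using \<xi>(2)[OF that] I unfolding x_def by (subst linear_functional_on_sum[OF lin subspace_E]) auto
    then have "p m x \<le> p (Suc m) x / 2 ^ N" by (rule width[OF xE])
    also have "p (Suc m) x \<le> (\<Sum>i\<in>I. p (Suc m) ((\<xi> i / of_real (w i)) *c e i))"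
      unfolding x_def using I by (intro p_sum) auto
    also have "\<dots> = (\<Sum>i\<in>I. cmod (\<xi> i))"
      using w by (intro sum.cong) (auto simp: p_scale norm_divide less_imp_neq[symmetric] abs_of_pos simp flip: w_def)
    also have "\<dots> \<le> real (Suc N) * M" using sum_bounded_above[of I "\<lambda>i. cmod (\<xi> i)" M] M I by simp
    finally have pm: "p m x \<le> real (Suc N) * M / 2 ^ N" by (simp add: divide_right_mono)
    have "coef x i0 = \<xi> i0 / of_real (w i0)"
      unfolding x_def by (subst coef_finite_sum) (use I i0 in auto)
    then have "M * d i0 = cmod (coef x i0) * p l (e i0)"
      using i0 w[of i0] by (simp add: norm_divide d_def)
    also have "\<dots> \<le> C * p m x" by (rule C(2)[OF xE])
    also have "\<dots> \<le> C * (real (Suc N) * M / 2 ^ N)" using pm C(1) by (intro mult_left_mono) auto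
    finally have "M * d i0 \<le> M * (C * (real (Suc N) / 2 ^ N))" by (simp add: mult_ac)
    then have "d i0 \<le> C * (real (Suc N) / 2 ^ N)" using Mpos by (simp only: mult_le_cancel_left_pos)
    then show ?thesis using i0 by blast
  qed
  \<comment> \<open>\<open>4 - (2 * n + 4) / 2 ^ n\<close> is the closed form of the sum of
    \<open>(k + 1) / 2 ^ k\<close> over \<open>k < n\<close>.\<close>
  have sum_d: "(\<Sum>i\<in>I. d i) \<le> C * (4 - (2 * real n + 4) / 2 ^ n)" if "finite I" "card I = n" for I n
    using that
  proof (induction n arbitrary: I)
    case 0
    then show ?case by simp
  next
    case (Suc n)
    from small[OF Suc.prems] obtain i where i: "i \<in> I" "d i \<le> C * (real (Suc n) / 2 ^ n)" by blast
    have "(\<Sum>i\<in>I. d i) = d i + (\<Sum>i\<in>I - {i}. d i)" using Suc.prems i by (simp add: sum.remove)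
    also have "\<dots> \<le> C * (real (Suc n) / 2 ^ n) + C * (4 - (2 * real n + 4) / 2 ^ n)"
      using Suc i by (intro add_mono Suc.IH) auto
    also have "\<dots> = C * (4 - (2 * real (Suc n) + 4) / 2 ^ Suc n)" by (simp add: field_simps)
    finally show ?case .
  qed
  have "(\<Sum>i\<in>I. cmod (coef x i) * p l (e i)) \<le> (C' * C * 4) * p m' x" if x: "x \<in> E" "finite I" for x I
  proof -
    have "(\<Sum>i\<in>I. cmod (coef x i) * p l (e i)) = (\<Sum>i\<in>I. cmod (coef x i) * w i * d i)"
      using w by (intro sum.cong) (auto simp: d_def less_imp_neq[symmetric])
    also have "\<dots> \<le> (\<Sum>i\<in>I. C' * p m' x * d i)"
      unfolding w_def using C'(2)[OF x(1)] d0 by (intro sum_mono mult_right_mono) auto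
    also have "\<dots> = C' * p m' x * (\<Sum>i\<in>I. d i)" by (simp add: sum_distrib_left)
    also have "\<dots> \<le> C' * p m' x * (C * 4)"
    proof (intro mult_left_mono)
      have "C * (4 - (2 * real (card I) + 4) / 2 ^ card I) \<le> C * 4" using C(1) by (intro mult_left_mono) auto
      then show "(\<Sum>i\<in>I. d i) \<le> C * 4" using sum_d[OF x(2) refl] by simp
      show "0 \<le> C' * p m' x" using C'(1) p_nonneg[OF x(1)] by simp
    qed
    finally show ?thesis by (simp add: mult_ac)
  qed
  then show ?thesis using C(1) C'(1) by (intro exI[of _ m'] exI[of _ "C' * C * 4"]) auto
qed

text \<open>\<open>f u\<close> is the sum of one diagonal entry of each rank one operator
  \<open>x \<mapsto> coef x i *c e i\<close>. Such an entry is bounded by the two off-diagonal ones,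
  each with factor 2, and the rotated one: \<open>5 = 2 + 2 + 1\<close>.\<close>

lemma basis_trace_estimate:
  assumes f: "linear_functional_on E f" "linear_functional_on E g" "\<And>x. x \<in> E \<Longrightarrow> cmod (f x) \<le> K * p l x"
    and uv: "u \<in> E" "v \<in> E"
    and S1: "\<And>I. finite I \<Longrightarrow> (\<Sum>i\<in>I. cmod (coef v i) * cmod (f (e i))) \<le> \<eta>"
    and S2: "\<And>I. finite I \<Longrightarrow> (\<Sum>i\<in>I. cmod (coef u i) * cmod (g (e i))) \<le> \<eta>"
    and S3: "\<And>I. finite I \<Longrightarrow> (\<Sum>i\<in>I. cmod (coef (u - v) i) * cmod (f (e i) + g (e i))) \<le> \<eta>"
  shows "cmod (f u) \<le> 5 * \<eta>"
proof -
  have "cmod (\<Sum>i<N. coef u i * f (e i)) \<le> 5 * \<eta>" for N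
  proof -
    have "cmod (\<Sum>i<N. coef u i * f (e i)) \<le> (\<Sum>i<N. cmod (coef u i * f (e i)))" by (rule norm_sum)
    also have "\<dots> \<le> (\<Sum>i<N. 2 * (cmod (coef u i) * cmod (g (e i))) + 2 * (cmod (coef v i) * cmod (f (e i)))
        + cmod (coef (u - v) i) * cmod (f (e i) + g (e i)))"
    proof (rule sum_mono)
      fix i
      have eq: "coef (u - v) i * (f (e i) + g (e i)) =
          coef u i * f (e i) + coef u i * g (e i) - coef v i * f (e i) - coef v i * g (e i)"
        using uv by (simp add: coef_diff algebra_simps)
      show "cmod (coef u i * f (e i)) \<le> 2 * (cmod (coef u i) * cmod (g (e i))) +
          2 * (cmod (coef v i) * cmod (f (e i))) + cmod (coef (u - v) i) * cmod (f (e i) + g (e i))"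
        unfolding norm_mult[symmetric] eq by (rule diagonal_entry_bound) (simp add: mult_ac)
    qed
    also have "\<dots> \<le> 2 * \<eta> + 2 * \<eta> + \<eta>"
      unfolding sum.distrib sum_distrib_left[symmetric]
      by (intro add_mono mult_left_mono S1 S2 S3) auto
    finally show ?thesis by simp
  qed
  moreover have "(\<lambda>N. \<Sum>i<N. coef u i * f (e i)) \<longlonglongrightarrow> f u"
    using functional_sums[OF f(1,3) uv(1)] by (simp add: sums_def)
  ultimately show ?thesis
    by (intro LIMSEQ_le_const2[OF tendsto_norm]) auto
qed

end

context graded_frechet
begin

text \<open>The hypothesis \<open>blocks\<close> ranges over all \<open>\<mu>\<close> and
  \<open>C\<close> because absoluteness supplies them only once the basis is given. In each of its
  three lines the functional has dual norm at most \<open>1 / t\<close> for one norm, while the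
  paired vector is below \<open>t / 6\<close> in the absorbing norm, so the corresponding entries
  have absolute sum at most \<open>1 / 6\<close>. The 6 is chosen to get
  \<open>5 * (1 / 6) < 1 = f u\<close>.\<close>

theorem no_schauder_basis:
  assumes lin: "\<And>l j. linear_functional_on E (a l j)"
    and width: "\<And>l N x. x \<in> E \<Longrightarrow> (\<And>j. j < N \<Longrightarrow> a l j x = 0) \<Longrightarrow> p l x \<le> p (Suc l) x / 2 ^ N"
    and blocks: "\<And>\<mu> C. (\<And>l. 0 < C l) \<Longrightarrow> \<exists>u\<in>E. \<exists>v\<in>E. \<exists>f g l1 l2 l3 t1 t2 t3.
        linear_functional_on E f \<and> linear_functional_on E g \<and> f u = 1 \<and>
        0 < t1 \<and> (\<forall>x\<in>E. t1 * cmod (f x) \<le> p l1 x) \<and> C l1 * p (\<mu> l1) v \<le> t1 / 6 \<and>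
        0 < t2 \<and> (\<forall>x\<in>E. t2 * cmod (g x) \<le> p l2 x) \<and> C l2 * p (\<mu> l2) u \<le> t2 / 6 \<and>
        0 < t3 \<and> (\<forall>x\<in>E. t3 * cmod (f x + g x) \<le> p l3 x) \<and> C l3 * p (\<mu> l3) (u - v) \<le> t3 / 6"
  shows "\<not> (\<exists>e. schauder_basis E \<tau> e)"
proof
  assume "\<exists>e. schauder_basis E \<tau> e"
  then obtain e where e: "schauder_basis E \<tau> e" ..
  interpret basis_graded_frechet scale E p e by unfold_locales (rule e)
  have "\<forall>l. \<exists>m C. 0 < C \<and> (\<forall>x\<in>E. \<forall>I. finite I \<longrightarrow> (\<Sum>i\<in>I. cmod (coef x i) * p l (e i)) \<le> C * p m x)"
    by (intro allI coef_absolute[of a] lin width)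
  then obtain \<mu> C where C: "\<And>l. 0 < C l"
    "\<And>l x I. x \<in> E \<Longrightarrow> finite I \<Longrightarrow> (\<Sum>i\<in>I. cmod (coef x i) * p l (e i)) \<le> C l * p (\<mu> l) x"
    by metis
  obtain u v f g l1 l2 l3 t1 t2 t3 where uv: "u \<in> E" "v \<in> E"
    and f: "linear_functional_on E f" "linear_functional_on E g" "f u = 1"
    and t1: "0 < t1" "\<forall>x\<in>E. t1 * cmod (f x) \<le> p l1 x" "C l1 * p (\<mu> l1) v \<le> t1 / 6"
    and t2: "0 < t2" "\<forall>x\<in>E. t2 * cmod (g x) \<le> p l2 x" "C l2 * p (\<mu> l2) u \<le> t2 / 6"
    and t3: "0 < t3" "\<forall>x\<in>E. t3 * cmod (f x + g x) \<le> p l3 x" "C l3 * p (\<mu> l3) (u - v) \<le> t3 / 6"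
    using blocks[of C \<mu>, OF C(1)] by (elim bexE exE conjE) (rule that)
  have key: "(\<Sum>i\<in>I. cmod (coef x i) * cmod (h (e i))) \<le> 1 / 6"
    if "0 < t" "\<forall>x\<in>E. t * cmod (h x) \<le> p l x" "C l * p (\<mu> l) x \<le> t / 6" "x \<in> E" "finite I" for t h l x I
  proof -
    have "t * (\<Sum>i\<in>I. cmod (coef x i) * cmod (h (e i))) = (\<Sum>i\<in>I. cmod (coef x i) * (t * cmod (h (e i))))"
      by (simp add: sum_distrib_left mult_ac)
    also have "\<dots> \<le> (\<Sum>i\<in>I. cmod (coef x i) * p l (e i))"
      using that(2) by (intro sum_mono mult_left_mono) auto
    also have "\<dots> \<le> C l * p (\<mu> l) x" using that by (intro C(2)) auto
    also have "\<dots> \<le> t * (1 / 6)" using that by simp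
    finally show ?thesis using that(1) by (simp only: mult_le_cancel_left_pos)
  qed
  have "cmod (f u) \<le> 5 * (1 / 6)"
  proof (rule basis_trace_estimate[OF f(1,2) _ uv])
    show "cmod (f x) \<le> 1 / t1 * p l1 x" if "x \<in> E" for x
      using t1(1) t1(2)[rule_format, OF that] by (simp add: field_simps)
    show "(\<Sum>i\<in>I. cmod (coef v i) * cmod (f (e i))) \<le> 1 / 6" if "finite I" for I
      using key[OF t1 uv(2) that] .
    show "(\<Sum>i\<in>I. cmod (coef u i) * cmod (g (e i))) \<le> 1 / 6" if "finite I" for I
      using key[OF t2 uv(1) that] .
    show "(\<Sum>i\<in>I. cmod (coef (u - v) i) * cmod (f (e i) + g (e i))) \<le> 1 / 6" if "finite I" for I
      using key[OF t3 _ that] uv by simp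
  qed
  with f(3) show False by simp
qed

end

section \<open>Sequence spaces as spaces of entire functions\<close>

definition seq_space :: "(nat \<Rightarrow> nat \<Rightarrow> (nat \<Rightarrow> complex) \<Rightarrow> complex) \<Rightarrow> (nat \<Rightarrow> complex) set" where
  "seq_space a = {x. \<forall>l. summable (\<lambda>j. cmod (a l j x))}"

definition seq_norm :: "(nat \<Rightarrow> nat \<Rightarrow> (nat \<Rightarrow> complex) \<Rightarrow> complex) \<Rightarrow> nat \<Rightarrow> (nat \<Rightarrow> complex) \<Rightarrow> real" where
  "seq_norm a l x = (\<Sum>j. cmod (a l j x))"

lemma seq_norm_ge: "x \<in> seq_space a \<Longrightarrow> cmod (a l j x) \<le> seq_norm a l x"
  unfolding seq_norm_def seq_space_def using sum_le_suminf[of "\<lambda>j. cmod (a l j x)" "{j}"] by simp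

text \<open>The \<open>v l j\<close> are dual to the functionals of one level and give the nuclear
  expansion; the second case of \<open>a_v_diag\<close> admits functionals vanishing on the whole
  space, as happens at the hubs of the first example. The \<open>\<phi> j\<close> and
  \<open>u j\<close> form a separate biorthogonal system for the smallest norm and become Taylor
  coefficients and monomials. Single coordinates may be bounded by a larger norm, which is enough
  for completeness.\<close>

locale coordinate_space =
  fixes a :: "nat \<Rightarrow> nat \<Rightarrow> (nat \<Rightarrow> complex) \<Rightarrow> complex"
    and v :: "nat \<Rightarrow> nat \<Rightarrow> nat \<Rightarrow> complex"
    and \<phi> :: "nat \<Rightarrow> (nat \<Rightarrow> complex) \<Rightarrow> complex"
    and u :: "nat \<Rightarrow> nat \<Rightarrow> complex"
    and G :: "complex set"
  assumes a_add: "a l j (x + y) = a l j x + a l j y"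
    and a_scale: "a l j (\<lambda>i. c * x i) = c * a l j x"
    and a_tendsto: "(\<And>i. (\<lambda>k. Y k i) \<longlonglongrightarrow> x i) \<Longrightarrow> (\<lambda>k. a l j (Y k)) \<longlonglongrightarrow> a l j x"
    and coord_bound: "\<exists>l C. \<forall>x\<in>seq_space a. cmod (x i) \<le> C * seq_norm a l x"
    and step_bound: "x \<in> seq_space a \<Longrightarrow> cmod (a l j x) \<le> seq_norm a (Suc l) x / 2 ^ Suc j"
    and v_in: "v l j \<in> seq_space a"
    and a_v_off: "i \<noteq> j \<Longrightarrow> a l i (v l j) = 0"
    and a_v_diag: "a l j (v l j) = 1 \<or> (a l j (v l j) = 0 \<and> (\<forall>x\<in>seq_space a. a l j x = 0))"
    and \<phi>_add: "\<phi> j (x + y) = \<phi> j x + \<phi> j y"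
    and \<phi>_scale: "\<phi> j (\<lambda>i. c * x i) = c * \<phi> j x"
    and \<phi>_bound: "\<exists>C. \<forall>x\<in>seq_space a. cmod (\<phi> j x) \<le> C * seq_norm a 0 x"
    and u_in: "u j \<in> seq_space a"
    and \<phi>_u: "\<phi> i (u j) = (if i = j then 1 else 0)"
    and \<phi>_sep: "x \<in> seq_space a \<Longrightarrow> (\<And>j. \<phi> j x = 0) \<Longrightarrow> x = 0"
    and open_G: "open G"
    and zero_G: "0 \<in> G"
begin

section \<open>Norms, widths and completeness of the sequence space\<close>

abbreviation X where "X \<equiv> seq_space a"
abbreviation q where "q \<equiv> seq_norm a"

lemma a_0 [simp]: "a l j 0 = 0"
  using a_add[of l j 0 0] by simp

lemma a_diff: "a l j (x - y) = a l j x - a l j y"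
  using a_add[of l j "x - y" y] by simp

lemma \<phi>_diff: "\<phi> j (x - y) = \<phi> j x - \<phi> j y"
  using \<phi>_add[of j "x - y" y] by simp

lemma X_summable: "x \<in> X \<Longrightarrow> summable (\<lambda>j. cmod (a l j x))"
  by (simp add: seq_space_def)

lemma X_0 [simp]: "0 \<in> X"
  by (simp add: seq_space_def)

lemma X_add:
  assumes "x \<in> X" "y \<in> X"
  shows "x + y \<in> X"
  unfolding seq_space_def
proof safe
  fix l
  show "summable (\<lambda>j. cmod (a l j (x + y)))"
    by (rule summable_comparison_test'[OF summable_add[OF X_summable[OF assms(1), of l] X_summable[OF assms(2), of l]]])
       (simp add: a_add norm_triangle_ineq)
qed

lemma X_scale: "x \<in> X \<Longrightarrow> (\<lambda>i. c * x i) \<in> X"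
  by (auto simp: seq_space_def a_scale norm_mult)

lemma X_diff: "x \<in> X \<Longrightarrow> y \<in> X \<Longrightarrow> x - y \<in> X"
  using X_add[OF _ X_scale[of y "-1"]] by (simp add: plus_fun_def fun_diff_def)

lemma q_add: "x \<in> X \<Longrightarrow> y \<in> X \<Longrightarrow> q l (x + y) \<le> q l x + q l y"
  unfolding seq_norm_def
  by (subst suminf_add)
     (auto intro!: suminf_le X_summable summable_add X_summable[OF X_add, unfolded a_add]
       simp: a_add norm_triangle_ineq)

lemma q_scale: "x \<in> X \<Longrightarrow> q l (\<lambda>i. c * x i) = cmod c * q l x"
  unfolding seq_norm_def by (simp add: a_scale norm_mult suminf_mult X_summable)

lemma q_nonneg: "x \<in> X \<Longrightarrow> 0 \<le> q l x"
  unfolding seq_norm_def by (intro suminf_nonneg X_summable) auto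

text \<open>The gains \<open>2 ^ Suc j\<close> of one level, summed over the tail
  \<open>j \<ge> N\<close>, leave \<open>2 ^ N\<close>. The case \<open>N = 0\<close> is
  monotonicity of the norms; large \<open>N\<close> makes tails small in the lower norm.\<close>

lemma q_width:
  assumes x: "x \<in> X" "\<And>j. j < N \<Longrightarrow> a l j x = 0"
  shows "q l x \<le> q (Suc l) x / 2 ^ N"
proof -
  have "q l x = (\<Sum>j. cmod (a l (j + N) x))"
    using suminf_split_initial_segment[OF X_summable[OF x(1), of l], of N] x(2) by (simp add: seq_norm_def)
  also have "\<dots> \<le> q (Suc l) x / 2 ^ N"
  proof (rule sums_le)
    show "cmod (a l (j + N) x) \<le> q (Suc l) x / 2 ^ N * (1 / 2) ^ Suc j" for j
      using step_bound[OF x(1), of l "j + N"] by (simp add: power_add field_simps)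
    show "(\<lambda>j. cmod (a l (j + N) x)) sums (\<Sum>j. cmod (a l (j + N) x))"
      by (intro summable_sums summable_ignore_initial_segment X_summable x)
    show "(\<lambda>j. q (Suc l) x / 2 ^ N * (1 / 2) ^ Suc j) sums (q (Suc l) x / 2 ^ N)"
      using sums_mult[OF power_half_series, of "q (Suc l) x / 2 ^ N"] by simp
  qed
  finally show ?thesis .
qed

lemma q_Suc: "x \<in> X \<Longrightarrow> q l x \<le> q (Suc l) x"
  using q_width[of x 0 l] by simp

lemma q_zero_imp:
  assumes "x \<in> X" "q 0 x = 0"
  shows "x = 0"
proof (rule \<phi>_sep[OF assms(1)])
  fix j
  obtain C where "\<forall>x\<in>X. cmod (\<phi> j x) \<le> C * q 0 x" using \<phi>_bound by blast
  then show "\<phi> j x = 0" using assms by force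
qed

lemma q_complete:
  assumes Y: "\<And>k. Y k \<in> X"
    and Cauchy: "\<And>l e. 0 < e \<Longrightarrow> \<exists>N. \<forall>m\<ge>N. \<forall>n\<ge>N. q l (Y m - Y n) < e"
  shows "\<exists>x\<in>X. \<forall>l. (\<lambda>k. q l (Y k - x)) \<longlonglongrightarrow> 0"
proof -
  have "convergent (\<lambda>k. Y k i)" for i
  proof -
    obtain l C where C: "\<forall>x\<in>X. cmod (x i) \<le> C * q l x" using coord_bound by blast
    have "Cauchy (\<lambda>k. Y k i)"
    proof (rule CauchyI)
      fix e :: real assume e: "0 < e"
      then obtain N where N: "\<forall>m\<ge>N. \<forall>n\<ge>N. q l (Y m - Y n) < e / (\<bar>C\<bar> + 1)"
        using Cauchy[of "e / (\<bar>C\<bar> + 1)" l] by auto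
      have "cmod (Y m i - Y n i) < e" if "m \<ge> N" "n \<ge> N" for m n
      proof -
        have mem: "Y m - Y n \<in> X" using Y by (intro X_diff)
        have "cmod (Y m i - Y n i) \<le> C * q l (Y m - Y n)" using C mem by (auto simp: fun_diff_def)
        also have "\<dots> \<le> (\<bar>C\<bar> + 1) * q l (Y m - Y n)" using q_nonneg[OF mem] by (intro mult_right_mono) auto
        also have "\<dots> < e" using N that by (simp add: field_simps)
        finally show ?thesis .
      qed
      then show "\<exists>M. \<forall>m\<ge>M. \<forall>n\<ge>M. norm (Y m i - Y n i) < e" by blast
    qed
    then show ?thesis by (rule Cauchy_convergent)
  qed
  then obtain x where x: "\<And>i. (\<lambda>k. Y k i) \<longlonglongrightarrow> x i" unfolding convergent_def by metis
  \<comment> \<open>Finite partial sums pass to the coordinatewise limit, and a bound independent of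
    \<open>J\<close> then covers the whole norm.\<close>
  have partial: "(\<Sum>j<J. cmod (a l j (Y m - x))) \<le> e"
    if N: "\<forall>m\<ge>N. \<forall>n\<ge>N. q l (Y m - Y n) < e" "m \<ge> N" for l e N m J
  proof (rule LIMSEQ_le_const2)
    show "(\<lambda>n. \<Sum>j<J. cmod (a l j (Y m - Y n))) \<longlonglongrightarrow> (\<Sum>j<J. cmod (a l j (Y m - x)))"
      by (intro tendsto_sum tendsto_norm a_tendsto) (use x in \<open>auto simp: fun_diff_def intro!: tendsto_intros\<close>)
    have "(\<Sum>j<J. cmod (a l j (Y m - Y n))) \<le> e" if "n \<ge> N" for n
    proof -
      have "(\<Sum>j<J. cmod (a l j (Y m - Y n))) \<le> q l (Y m - Y n)"
        unfolding seq_norm_def using Y by (intro sum_le_suminf X_summable X_diff) auto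
      then show ?thesis using N that by (meson less_imp_le order_trans)
    qed
    then show "\<exists>N. \<forall>n\<ge>N. (\<Sum>j<J. cmod (a l j (Y m - Y n))) \<le> e" by blast
  qed
  have summ: "\<exists>N. \<forall>m\<ge>N. summable (\<lambda>j. cmod (a l j (Y m - x))) \<and> q l (Y m - x) \<le> e" if e: "0 < e" for l e
  proof -
    obtain N where N: "\<forall>m\<ge>N. \<forall>n\<ge>N. q l (Y m - Y n) < e" using Cauchy[OF e] by blast
    have "summable (\<lambda>j. cmod (a l j (Y m - x)))" if "m \<ge> N" for m
      by (rule summableI_nonneg_bounded) (use partial[OF N that] in auto)
    moreover from this have "q l (Y m - x) \<le> e" if "m \<ge> N" for m
      unfolding seq_norm_def by (rule suminf_le_const) (use partial[OF N that] that in auto)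
    ultimately show ?thesis by blast
  qed
  have "x \<in> X"
    unfolding seq_space_def
  proof safe
    fix l
    obtain m where m: "summable (\<lambda>j. cmod (a l j (Y m - x)))" using summ[of 1 l] by auto
    have "cmod (a l j x) \<le> cmod (a l j (Y m - x)) + cmod (a l j (Y m))" for j
      using norm_triangle_ineq4[of "a l j (Y m)" "a l j (Y m - x)"] by (simp add: a_diff)
    then show "summable (\<lambda>j. cmod (a l j x))"
      by (intro summable_comparison_test'[OF summable_add[OF m X_summable[OF Y]]]) auto
  qed
  moreover have "(\<lambda>k. q l (Y k - x)) \<longlonglongrightarrow> 0" for l
  proof (rule LIMSEQ_I)
    fix e :: real assume "0 < e"
    then obtain N where "\<forall>m\<ge>N. summable (\<lambda>j. cmod (a l j (Y m - x))) \<and> q l (Y m - x) \<le> e / 2"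
      using summ[of "e / 2" l] by auto
    then show "\<exists>N. \<forall>k\<ge>N. norm (q l (Y k - x) - 0) < e"
      using \<open>0 < e\<close> q_nonneg[OF X_diff[OF Y \<open>x \<in> X\<close>]] by (intro exI[of _ N]) fastforce
  qed
  ultimately show ?thesis by blast
qed

section \<open>Embedding by power series\<close>

definition wt :: "nat \<Rightarrow> real" where
  "wt j = (SOME C. 0 < C \<and> (\<forall>x\<in>X. cmod (\<phi> j x) \<le> C * q 0 x))"

lemma wt: "0 < wt j" "x \<in> X \<Longrightarrow> cmod (\<phi> j x) \<le> wt j * q 0 x"
proof -
  obtain C where C: "\<forall>x\<in>X. cmod (\<phi> j x) \<le> C * q 0 x" using \<phi>_bound by blast
  have "\<exists>C. 0 < C \<and> (\<forall>x\<in>X. cmod (\<phi> j x) \<le> C * q 0 x)"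
  proof (intro exI[of _ "\<bar>C\<bar> + 1"] conjI ballI)
    fix x assume x: "x \<in> X"
    have "C * q 0 x \<le> (\<bar>C\<bar> + 1) * q 0 x" using q_nonneg[OF x] by (intro mult_right_mono) auto
    then show "cmod (\<phi> j x) \<le> (\<bar>C\<bar> + 1) * q 0 x" using C x by force
  qed auto
  from someI_ex[OF this] show "0 < wt j" "x \<in> X \<Longrightarrow> cmod (\<phi> j x) \<le> wt j * q 0 x"
    unfolding wt_def by auto
qed

text \<open>Division by \<open>wt j\<close> bounds the numerator by \<open>q 0 x\<close>; the
  factorial then makes the series entire and dominated by \<open>q 0 x * exp (cmod z)\<close>, so
  the embedding is continuous already for the smallest norm.\<close>

definition tcoeff :: "nat \<Rightarrow> (nat \<Rightarrow> complex) \<Rightarrow> complex" where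
  "tcoeff j x = \<phi> j x / of_real (wt j * fact j)"

definition Phi :: "(nat \<Rightarrow> complex) \<Rightarrow> complex \<Rightarrow> complex" where
  "Phi x z = (if z \<in> G then \<Sum>j. tcoeff j x * z ^ j else 0)"

lemma tcoeff_add: "tcoeff j (x + y) = tcoeff j x + tcoeff j y"
  by (simp add: tcoeff_def \<phi>_add add_divide_distrib)

lemma tcoeff_scale: "tcoeff j (\<lambda>i. c * x i) = c * tcoeff j x"
  by (simp add: tcoeff_def \<phi>_scale)

lemma tcoeff_bound:
  assumes "x \<in> X"
  shows "cmod (tcoeff j x * z ^ j) \<le> q 0 x * (cmod z ^ j /\<^sub>R fact j)"
proof -
  have "cmod (tcoeff j x * z ^ j) = cmod (\<phi> j x) / wt j * (cmod z ^ j / fact j)"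
    using wt(1)[of j] by (simp add: tcoeff_def norm_mult norm_divide norm_power)
  also have "\<dots> \<le> q 0 x * (cmod z ^ j / fact j)"
    using wt(1)[of j] wt(2)[OF assms, of j] by (intro mult_right_mono) (auto simp: field_simps)
  finally show ?thesis by (simp add: field_simps)
qed

lemma tcoeff_summable: "x \<in> X \<Longrightarrow> summable (\<lambda>j. tcoeff j x * z ^ j)"
  by (rule summable_comparison_test'[OF summable_mult[OF summable_exp_generic]]) (rule tcoeff_bound)

lemma Phi_bound:
  assumes "x \<in> X"
  shows "cmod (Phi x z) \<le> exp (cmod z) * q 0 x"
proof -
  have "cmod (\<Sum>j. tcoeff j x * z ^ j) \<le> (\<Sum>j. q 0 x * (cmod z ^ j /\<^sub>R fact j))"
    by (rule norm_suminf_le[OF tcoeff_bound[OF assms]]) (intro summable_mult summable_exp_generic)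
  also have "\<dots> = q 0 x * exp (cmod z)" unfolding exp_def by (rule suminf_mult) (rule summable_exp_generic)
  finally show ?thesis using q_nonneg[OF assms] by (auto simp: Phi_def mult.commute)
qed

lemma Phi_add: "x \<in> X \<Longrightarrow> y \<in> X \<Longrightarrow> Phi (x + y) = Phi x + Phi y"
  by (auto simp: fun_eq_iff Phi_def plus_fun_def tcoeff_add[unfolded plus_fun_def] distrib_right suminf_add tcoeff_summable)

lemma Phi_scale: "x \<in> X \<Longrightarrow> Phi (\<lambda>i. c * x i) = (\<lambda>z. c * Phi x z)"
  by (auto simp: fun_eq_iff Phi_def tcoeff_scale mult.assoc suminf_mult tcoeff_summable)

lemma Phi_diff: "x \<in> X \<Longrightarrow> y \<in> X \<Longrightarrow> Phi (x - y) = Phi x - Phi y"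
  using Phi_add[of "x - y" y] X_diff[of x y] by simp

lemma Phi_hol: "x \<in> X \<Longrightarrow> Phi x \<in> hol_funs G"
  unfolding hol_funs_def
proof safe
  assume x: "x \<in> X"
  have "(\<lambda>z. \<Sum>j. tcoeff j x * z ^ j) holomorphic_on G"
    unfolding holomorphic_on_open[OF open_G]
    using termdiffs_strong_converges_everywhere[OF tcoeff_summable[OF x]] by blast
  then show "Phi x holomorphic_on G" by (rule holomorphic_transform) (simp add: Phi_def)
qed (simp add: Phi_def)

text \<open>A power series with zero constant term and some nonzero coefficient has an isolated zero
  at 0, whereas \<open>Phi x\<close> vanishes on a disc inside \<open>G\<close>. So all Taylor
  coefficients are 0 and \<open>\<phi>_sep\<close> applies.\<close>

lemma Phi_eq_0:
  assumes x: "x \<in> X" and "Phi x = 0"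
  shows "x = 0"
proof -
  obtain r where r: "0 < r" "ball 0 r \<subseteq> G" using open_G zero_G openE by blast
  have zero: "(\<Sum>j. tcoeff j x * z ^ j) = 0" if "z \<in> G" for z
    using assms(2) that by (metis Phi_def zero_fun_apply)
  have t0: "tcoeff 0 x = 0" using zero[OF zero_G] by (simp add: powser_zero)
  have "tcoeff m x = 0" for m
  proof (rule ccontr)
    assume m: "tcoeff m x \<noteq> 0"
    then have "0 < m" using t0 by (cases m) auto
    obtain s where s: "0 < s" "\<And>z. z \<in> cball 0 s - {0} \<Longrightarrow> (\<Sum>j. tcoeff j x * z ^ j) \<noteq> 0"
      by (rule powser_0_nonzero[of 1 0 "\<lambda>j. tcoeff j x" "\<lambda>z. \<Sum>j. tcoeff j x * z ^ j" m])
        (use m \<open>0 < m\<close> zero[OF zero_G] summable_sums[OF tcoeff_summable[OF x]] in auto)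
    define z :: complex where "z = of_real (min s (r / 2))"
    have "z \<in> cball 0 s - {0}" "z \<in> G" using s r by (auto simp: z_def)
    then show False using s zero by blast
  qed
  then have "\<phi> j x = 0" for j using wt(1)[of j] by (simp add: tcoeff_def) (metis less_irrefl)
  then show ?thesis by (rule \<phi>_sep[OF x])
qed

lemma inj_Phi: "inj_on Phi X"
proof
  fix x y assume "x \<in> X" "y \<in> X" "Phi x = Phi y"
  then have "x - y = 0" by (intro Phi_eq_0 X_diff) (simp_all add: Phi_diff)
  then show "x = y" by simp
qed

section \<open>The function space with the transported norms\<close>

definition E :: "(complex \<Rightarrow> complex) set" where "E = Phi ` X"
definition J :: "(complex \<Rightarrow> complex) \<Rightarrow> nat \<Rightarrow> complex" where "J = inv_into X Phi"
definition p :: "nat \<Rightarrow> (complex \<Rightarrow> complex) \<Rightarrow> real" where "p l f = q l (J f)"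

lemma J_Phi [simp]: "x \<in> X \<Longrightarrow> J (Phi x) = x"
  by (simp add: J_def inj_Phi)

lemma Phi_in [simp]: "x \<in> X \<Longrightarrow> Phi x \<in> E" by (simp add: E_def)

lemma p_Phi [simp]: "x \<in> X \<Longrightarrow> p l (Phi x) = q l x" by (simp add: p_def)

lemma J_in [simp]: "f \<in> E \<Longrightarrow> J f \<in> X" and Phi_J [simp]: "f \<in> E \<Longrightarrow> Phi (J f) = f"
  by (auto simp: E_def)

lemma J_add: "f \<in> E \<Longrightarrow> g \<in> E \<Longrightarrow> J (f + g) = J f + J g"
  by (auto simp: E_def X_add simp flip: Phi_add)

lemma J_scale: "f \<in> E \<Longrightarrow> J (\<lambda>z. c * f z) = (\<lambda>i. c * J f i)"
  by (auto simp: E_def X_scale simp flip: Phi_scale)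

sublocale graded_frechet "\<lambda>c f z. c * f z" E p
proof
  show "cfun.subspace E"
    unfolding cfun.subspace_def
  proof safe
    show "0 \<in> E" using Phi_in[OF X_0] Phi_scale[OF X_0, of 0] by (simp add: zero_fun_def)
    show "f + g \<in> E" if "f \<in> E" "g \<in> E" for f g
      using that by (auto simp: E_def simp flip: Phi_add intro: X_add)
    show "(\<lambda>z. c * f z) \<in> E" if "f \<in> E" for f c
      using that by (auto simp: E_def simp flip: Phi_scale intro: X_scale)
  qed
  show "cfun.seminorm_on E (p l)" for l
    unfolding cfun.seminorm_on_def by (simp add: p_def J_add J_scale q_add q_scale)
  show "p l f \<le> p (Suc l) f" if "f \<in> E" for f l using that by (simp add: p_def q_Suc)
  show "f = 0" if f: "f \<in> E" "p 0 f = 0" for f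
  proof -
    have "J f = 0" using f by (intro q_zero_imp) (simp_all add: p_def)
    then have "f = Phi 0" using Phi_J[OF f(1)] by simp
    then show ?thesis using Phi_scale[OF X_0, of 0] by (simp add: zero_fun_def)
  qed
  fix F :: "nat \<Rightarrow> complex \<Rightarrow> complex"
  assume F: "\<And>n. F n \<in> E" "\<And>l e. 0 < e \<Longrightarrow> \<exists>N. \<forall>m\<ge>N. \<forall>n\<ge>N. p l (F m - F n) < e"
  have eq: "p l (f - g) = q l (J f - J g)" if "f \<in> E" "g \<in> E" for f g l
    using that by (auto simp: E_def X_diff simp flip: Phi_diff)
  have "\<exists>x\<in>X. \<forall>l. (\<lambda>k. q l (J (F k) - x)) \<longlonglongrightarrow> 0"
    by (rule q_complete) (use F eq in auto)
  then obtain x where "x \<in> X" "\<forall>l. (\<lambda>k. q l (J (F k) - x)) \<longlonglongrightarrow> 0" by blast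
  then show "\<exists>f\<in>E. \<forall>l. (\<lambda>n. p l (F n - f)) \<longlonglongrightarrow> 0"
    by (intro bexI[of _ "Phi x"]) (simp_all add: eq F)
qed

lemma functional_J:
  assumes "\<And>x y. f (x + y) = f x + f y" "\<And>c x. f (\<lambda>i. c * x i) = c * f x"
  shows "cfun.linear_functional_on E (\<lambda>g. f (J g))"
  unfolding cfun.linear_functional_on_def by (simp add: J_add J_scale assms)

lemma a_functional: "cfun.linear_functional_on E (\<lambda>g. a l j (J g))"
  by (rule functional_J) (rule a_add a_scale)+

lemma E_separating:
  assumes "b \<in> E" "b \<noteq> 0"
  shows "\<exists>\<psi> C. cfun.linear_functional_on E \<psi> \<and> (\<forall>f\<in>E. cmod (\<psi> f) \<le> C * p 0 f) \<and> \<psi> b \<noteq> 0"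
proof -
  have "\<exists>j. \<phi> j (J b) \<noteq> 0"
  proof (rule ccontr)
    assume "\<not> ?thesis"
    then have "J b = 0" using assms by (intro \<phi>_sep) auto
    then have "p 0 b = 0" by (simp add: p_def seq_norm_def)
    with p_zero_imp assms show False by blast
  qed
  then obtain j where "\<phi> j (J b) \<noteq> 0" ..
  then show ?thesis using wt(2)[of _ j]
    by (intro exI[of _ "\<lambda>g. \<phi> j (J g)"] exI[of _ "wt j"]) (auto simp: p_def intro: functional_J \<phi>_add \<phi>_scale)
qed

lemma E_width:
  assumes "f \<in> E" "\<And>j. j < N \<Longrightarrow> a l j (J f) = 0"
  shows "p l f \<le> p (Suc l) f / 2 ^ N"
  unfolding p_def using assms by (intro q_width) auto


lemma sup_bound:
  assumes "compact K" "K \<noteq> {}"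
  shows "\<exists>A>0. \<forall>f\<in>E. (SUP z\<in>K. cmod (f z)) \<le> A * p 0 f"
proof -
  obtain R where R: "\<And>z. z \<in> K \<Longrightarrow> cmod z \<le> R"
    using compact_imp_bounded[OF assms(1)] by (auto simp: bounded_iff)
  have "(SUP z\<in>K. cmod (f z)) \<le> exp R * p 0 f" if f: "f \<in> E" for f
  proof (rule cSUP_least[OF assms(2)])
    fix z assume z: "z \<in> K"
    have "cmod (Phi (J f) z) \<le> exp (cmod z) * q 0 (J f)" using f by (intro Phi_bound) auto
    also have "\<dots> \<le> exp R * q 0 (J f)" using R[OF z] f by (intro mult_right_mono) (auto simp: q_nonneg)
    finally show "cmod (f z) \<le> exp R * p 0 f" using f by (simp add: p_def)
  qed
  then show ?thesis by (intro exI[of _ "exp R"]) auto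
qed

lemma continuous_inclusion: "continuous_map \<tau> (hol_topology G) id"
  unfolding continuous_map_def
proof (intro conjI allI impI)
  have E_sub: "E \<subseteq> hol_funs G" by (auto simp: E_def Phi_hol)
  then show "id \<in> topspace \<tau> \<rightarrow> topspace (hol_topology G)" by (auto simp: hol_topology_def)
  let ?S = "{\<lambda>f. SUP z\<in>K. cmod (f z) |K. compact K \<and> K \<noteq> {} \<and> K \<subseteq> G}"
  fix U assume U: "openin (hol_topology G) U"
  show "openin \<tau> {f \<in> topspace \<tau>. id f \<in> U}"
    unfolding openin_seminorm_topology
  proof safe
    fix f assume f: "f \<in> topspace \<tau>" "id f \<in> U"
    then have "seminorm_nhd (hol_funs G) ?S U f"
      using U unfolding hol_topology_def openin_seminorm_topology by simp
    then obtain F r where F: "finite F" "F \<subseteq> ?S" "0 < r"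
        "{g\<in>hol_funs G. \<forall>s\<in>F. s (g - f) < r} \<subseteq> U" by (rule seminorm_nhdE)
    have "\<forall>s\<in>F. \<exists>A>0. \<forall>g\<in>E. s g \<le> A * p 0 g"
      using F(2) sup_bound by blast
    then obtain A where A: "\<And>s. s \<in> F \<Longrightarrow> 0 < A s" "\<And>s g. s \<in> F \<Longrightarrow> g \<in> E \<Longrightarrow> s g \<le> A s * p 0 g"
      by metis
    \<comment> \<open>One constant for all of the finitely many suprema; the 1 keeps it positive
      when \<open>F\<close> is empty.\<close>
    define B where "B = sum A F + 1"
    have B: "A s \<le> B" if "s \<in> F" for s
      unfolding B_def using member_le_sum[OF that, of A] A(1) F(1) by (smt (verit) DiffD1)
    have B0: "0 < B" unfolding B_def using A(1) by (intro add_nonneg_pos sum_nonneg) (auto intro: less_imp_le)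
    show "seminorm_nhd E (range p) {f \<in> topspace \<tau>. id f \<in> U} f"
    proof (rule seminorm_nhdI[of "{p 0}" _ "r / B"])
      have "s (g - f) < r" if g: "g \<in> E" "p 0 (g - f) < r / B" "s \<in> F" for g s
      proof -
        have gf: "g - f \<in> E" using g f by simp
        have "s (g - f) \<le> A s * p 0 (g - f)" using A(2) g gf by simp
        also have "\<dots> \<le> B * p 0 (g - f)" using B[OF g(3)] p_nonneg[OF gf] by (intro mult_right_mono)
        also have "\<dots> < r" using g B0 by (simp add: field_simps)
        finally show ?thesis .
      qed
      then show "{g \<in> E. \<forall>s\<in>{p 0}. s (g - f) < r / B} \<subseteq> {f \<in> topspace \<tau>. id f \<in> U}"
        using F(4) E_sub by auto
    qed (use F B0 in auto)
  qed simp
qed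

lemma Phi_u: "Phi (u j) = (\<lambda>z. if z \<in> G then z ^ j / of_real (wt j * fact j) else 0)"
proof
  fix z
  have "(\<Sum>i. tcoeff i (u j) * z ^ i) = (\<Sum>i. if i = j then z ^ j / of_real (wt j * fact j) else 0)"
    by (intro arg_cong[of _ _ suminf]) (auto simp: tcoeff_def \<phi>_u)
  also have "\<dots> = z ^ j / of_real (wt j * fact j)"
    using sums_single[of j "\<lambda>_. z ^ j / of_real (wt j * fact j)"] by (simp add: sums_iff eq_commute)
  finally show "Phi (u j) z = (if z \<in> G then z ^ j / of_real (wt j * fact j) else 0)"
    by (simp add: Phi_def)
qed

lemma polynomial_in: "(\<lambda>z. if z \<in> G then poly P z else 0) \<in> E"
proof -
  have mono: "(\<lambda>z. if z \<in> G then c * z ^ j else 0) \<in> E" for c j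
  proof -
    have "(\<lambda>z. (c * of_real (wt j * fact j)) * Phi (u j) z) \<in> E" using Phi_in[OF u_in] by simp
    also have "(\<lambda>z. (c * of_real (wt j * fact j)) * Phi (u j) z) = (\<lambda>z. if z \<in> G then c * z ^ j else 0)"
      using wt(1)[of j] by (auto simp: Phi_u fun_eq_iff)
    finally show ?thesis .
  qed
  have "(\<lambda>z. if z \<in> G then \<Sum>i<n. coeff P i * z ^ i else 0) \<in> E" for n
  proof (induction n)
    case 0
    then show ?case using zero_in by (simp add: zero_fun_def cong: if_cong)
  next
    case (Suc n)
    have "(\<lambda>z. if z \<in> G then \<Sum>i<Suc n. coeff P i * z ^ i else 0) =
        (\<lambda>z. if z \<in> G then \<Sum>i<n. coeff P i * z ^ i else 0) + (\<lambda>z. if z \<in> G then coeff P n * z ^ n else 0)"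
      by (auto simp: fun_eq_iff plus_fun_def)
    then show ?case using add_in[OF Suc mono] by simp
  qed
  from this[of "Suc (degree P)"] show ?thesis by (simp only: poly_altdef lessThan_Suc_atMost)
qed

theorem frechet_space_of_hol_funs: "frechet_space_of_hol_funs G E \<tau>"
  unfolding frechet_space_of_hol_funs_def
  using frechet continuous_inclusion polynomial_in by (auto simp: E_def Phi_hol)

text \<open>Subtracting \<open>a l N x\<close> times \<open>v l N\<close> kills the functional with
  index \<open>N\<close> and touches no other, so the norm of the remainder is exactly a tail of the
  series \<open>q l x\<close>. Where the functional vanishes identically, the subtracted term is
  0.\<close>

lemma expansion_tendsto:
  assumes x: "x \<in> X"
  shows "(\<lambda>N. q l (J (Phi x - (\<Sum>n<N. (\<lambda>z. a l n x * Phi (v l n) z))))) \<longlonglongrightarrow> 0"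
proof -
  define R where "R N = x - (\<Sum>n<N. (\<lambda>i. a l n x * v l n i))" for N
  have R_in: "R N \<in> X \<and> Phi (R N) = Phi x - (\<Sum>n<N. (\<lambda>z. a l n x * Phi (v l n) z)) \<and>
      (\<forall>i. a l i (R N) = (if i < N then 0 else a l i x))" for N
  proof (induction N)
    case 0
    then show ?case using x by (simp add: R_def)
  next
    case (Suc N)
    let ?t = "\<lambda>i. a l N x * v l N i"
    have RS: "R (Suc N) = R N - ?t" by (simp only: R_def sum.lessThan_Suc diff_diff_eq)
    have t: "?t \<in> X" "Phi ?t = (\<lambda>z. a l N x * Phi (v l N) z)" by (simp_all add: X_scale Phi_scale v_in)
    have "a l i (R (Suc N)) = (if i < Suc N then 0 else a l i x)" for i
      using Suc a_v_off[of i N l] a_v_diag[of l N] x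
      by (cases "i = N") (auto simp: RS a_diff a_scale less_Suc_eq)
    moreover have "R (Suc N) \<in> X" unfolding RS using Suc t by (intro X_diff) auto
    moreover have "Phi (R (Suc N)) = Phi (R N) - Phi ?t" unfolding RS using Suc t by (intro Phi_diff) auto
    ultimately show ?case using Suc t(2) by (simp only: sum.lessThan_Suc diff_diff_eq) simp
  qed
  have "q l (R N) = q l x - (\<Sum>n<N. cmod (a l n x))" for N
  proof -
    have "q l (R N) = (\<Sum>n. cmod (a l (n + N) (R N))) + (\<Sum>n<N. cmod (a l n (R N)))"
      unfolding seq_norm_def using R_in by (intro suminf_split_initial_segment X_summable) auto
    also have "\<dots> = (\<Sum>n. cmod (a l (n + N) x))" using R_in by simp
    also have "\<dots> = q l x - (\<Sum>n<N. cmod (a l n x))"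
      unfolding seq_norm_def by (intro suminf_minus_initial_segment X_summable x)
    finally show ?thesis .
  qed
  moreover have "(\<lambda>N. q l x - (\<Sum>n<N. cmod (a l n x))) \<longlonglongrightarrow> q l x - q l x"
    unfolding seq_norm_def by (intro tendsto_intros summable_LIMSEQ X_summable x)
  moreover have "q l (J (Phi x - (\<Sum>n<N. (\<lambda>z. a l n x * Phi (v l n) z)))) = q l (R N)" for N
    using R_in[of N] by (metis J_Phi)
  ultimately show ?thesis by simp
qed

theorem nuclear: "cfun.nuclear E \<tau>"
  unfolding cfun.nuclear_def
proof safe
  fix s assume s: "cfun.continuous_seminorm E \<tau> s"
  then obtain l C where C: "0 < C" "\<And>f. f \<in> E \<Longrightarrow> s f \<le> C * p l f"
    using continuous_seminorm_bounded by blast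
  have "s (\<lambda>z. 0 * (0 :: complex \<Rightarrow> complex) z) = cmod 0 * s 0"
    using s zero_in unfolding cfun.continuous_seminorm_def cfun.seminorm_on_def by blast
  then have s_hom: "s (\<lambda>z. 0) = 0" by simp
  have s_nonneg: "0 \<le> s f" if f: "f \<in> E" for f
  proof -
    have add: "s (f + g) \<le> s f + s g" if "f \<in> E" "g \<in> E" for f g
      using s that unfolding cfun.continuous_seminorm_def cfun.seminorm_on_def by blast
    have "s (\<lambda>z. - 1 * f z) = cmod (- 1) * s f"
      using s f unfolding cfun.continuous_seminorm_def cfun.seminorm_on_def by blast
    moreover have "f + (\<lambda>z. - 1 * f z) = (\<lambda>z. 0)" by (simp add: fun_eq_iff plus_fun_def)
    ultimately show ?thesis using add[OF f scale_in[OF f, of "- 1"]] s_hom by simp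
  qed
  \<comment> \<open>\<open>C\<close> enters twice: \<open>s\<close> is at most
    \<open>C * p l\<close>, and dual norms are taken with respect to \<open>C * p (Suc l)\<close>,
    hence the constants \<open>1 / (C * 2 ^ Suc n)\<close>. Together with
    \<open>s (Phi (v l n)) \<le> C\<close> they leave a geometric series.\<close>
  have "cfun.canonical_map_nuclear E (\<lambda>f. C * p (Suc l) f) s"
    unfolding cfun.canonical_map_nuclear_def
  proof (intro conjI exI[of _ "\<lambda>n f. a l n (J f)"] exI[of _ "\<lambda>n. 1 / (C * 2 ^ Suc n)"]
      exI[of _ "\<lambda>n. Phi (v l n)"] allI ballI)
    show "s f \<le> C * p (Suc l) f" if "f \<in> E" for f
      using C(2)[OF that] mult_left_mono[OF p_Suc[OF that, of l], of C] C(1) by linarith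
    show "cfun.linear_functional_on E (\<lambda>f. a l n (J f))" for n by (rule a_functional)
    show "0 \<le> 1 / (C * 2 ^ Suc n)" for n using C(1) by simp
    show "cmod (a l n (J f)) \<le> 1 / (C * 2 ^ Suc n) * (C * p (Suc l) f)" if "f \<in> E" for n f
      using step_bound[of "J f" l n] that C(1) by (simp add: p_def)
    show "Phi (v l n) \<in> E" for n by (simp add: v_in)
    have qv: "q l (v l n) \<le> 1" for n
    proof -
      have "q l (v l n) = (\<Sum>i. if i = n then cmod (a l n (v l n)) else 0)"
        unfolding seq_norm_def by (intro arg_cong[of _ _ suminf]) (auto simp: a_v_off)
      also have "\<dots> = cmod (a l n (v l n))"
        using sums_single[of n "\<lambda>_. cmod (a l n (v l n))"] by (simp add: sums_iff eq_commute)
      finally show ?thesis using a_v_diag[of l n] by auto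
    qed
    show "summable (\<lambda>n. 1 / (C * 2 ^ Suc n) * s (Phi (v l n)))"
    proof (rule summable_comparison_test')
      show "summable (\<lambda>n. (1 / 2 :: real) ^ Suc n)" by (intro summable_Suc_iff[THEN iffD2] summable_geometric) auto
      show "norm (1 / (C * 2 ^ Suc n) * s (Phi (v l n))) \<le> (1 / 2) ^ Suc n" if "0 \<le> n" for n
      proof -
        have "s (Phi (v l n)) \<le> C * 1"
          using C(2)[OF Phi_in[OF v_in]] mult_left_mono[OF qv, of C] C(1) by (metis less_imp_le order_trans p_Phi v_in)
        then have "1 / (C * 2 ^ Suc n) * s (Phi (v l n)) \<le> 1 / (C * 2 ^ Suc n) * (C * 1)"
          using C(1) by (intro mult_left_mono) auto
        also have "\<dots> = (1 / 2) ^ Suc n" using C(1) by (simp add: field_simps)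
        finally show ?thesis using s_nonneg[OF Phi_in[OF v_in]] C(1) by (simp add: abs_mult)
      qed
    qed
    show "(\<lambda>N. s (f - (\<Sum>n<N. (\<lambda>z. a l n (J f) * Phi (v l n) z)))) \<longlonglongrightarrow> 0" if f: "f \<in> E" for f
    proof (rule Lim_null_comparison)
      have in_E: "f - (\<Sum>n<N. (\<lambda>z. a l n (J f) * Phi (v l n) z)) \<in> E" for N
        using f by (intro diff_in sum_in scale_in) (auto simp: v_in)
      show "\<forall>\<^sub>F N in sequentially. norm (s (f - (\<Sum>n<N. (\<lambda>z. a l n (J f) * Phi (v l n) z)))) \<le>
          C * p l (f - (\<Sum>n<N. (\<lambda>z. a l n (J f) * Phi (v l n) z)))"
        using C(2)[OF in_E] s_nonneg[OF in_E] by simp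
      show "(\<lambda>N. C * p l (f - (\<Sum>n<N. (\<lambda>z. a l n (J f) * Phi (v l n) z)))) \<longlonglongrightarrow> 0"
        using tendsto_mult[OF tendsto_const[of C] expansion_tendsto[OF J_in[OF f], of l]] f by (simp add: p_def)
    qed
  qed
  moreover have "cfun.continuous_seminorm E \<tau> (\<lambda>f. C * p (Suc l) f)"
    using C(1) by (intro continuous_seminorm_scaled) auto
  ultimately show "\<exists>q. cfun.continuous_seminorm E \<tau> q \<and> cfun.canonical_map_nuclear E q s" by blast
qed

end

section \<open>Failure of the bounded approximation property\<close>

context coordinate_space
begin

lemma p_Phi_diff: "x \<in> X \<Longrightarrow> y \<in> X \<Longrightarrow> p l (Phi x - Phi y) = q l (x - y)"
  by (simp add: X_diff flip: Phi_diff)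

theorem not_bounded_approximation_property_coordinates:
  assumes z: "\<And>l. \<exists>k. \<forall>m0. \<exists>m\<ge>m0. \<exists>z w. range z \<subseteq> X \<and> (\<lambda>N. q l (z N)) \<longlonglongrightarrow> 0 \<and>
        (\<forall>e>0. \<exists>M. \<forall>N\<ge>M. q m (z N - z M) < e) \<and> 0 < w \<and> (\<forall>\<^sub>F N in sequentially. w \<le> q k (z N))"
  shows "\<not> cfun.bounded_approximation_property E \<tau>"
proof (rule not_bounded_approximation_property)
  show "\<exists>\<psi> C. cfun.linear_functional_on E \<psi> \<and> (\<forall>f\<in>E. cmod (\<psi> f) \<le> C * p 0 f) \<and> \<psi> b \<noteq> 0"
    if "b \<in> E" "b \<noteq> 0" for b using that by (rule E_separating)
next
  fix l
  obtain k where k: "\<And>m0. \<exists>m\<ge>m0. \<exists>z w. range z \<subseteq> X \<and> (\<lambda>N. q l (z N)) \<longlonglongrightarrow> 0 \<and>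
        (\<forall>e>0. \<exists>M. \<forall>N\<ge>M. q m (z N - z M) < e) \<and> 0 < w \<and> (\<forall>\<^sub>F N in sequentially. w \<le> q k (z N))"
    using z[of l] by blast
  show "\<exists>k. \<forall>m0. \<exists>m\<ge>m0. \<exists>z w. range z \<subseteq> E \<and> (\<lambda>N. p l (z N)) \<longlonglongrightarrow> 0 \<and>
        (\<forall>e>0. \<exists>M. \<forall>N\<ge>M. p m (z N - z M) < e) \<and> 0 < w \<and> (\<forall>\<^sub>F N in sequentially. w \<le> p k (z N))"
  proof (rule exI[of _ k], rule allI)
    fix m0
    obtain m z w where z: "m0 \<le> m" "range z \<subseteq> X" "(\<lambda>N. q l (z N)) \<longlonglongrightarrow> 0"
        "\<forall>e>0. \<exists>M. \<forall>N\<ge>M. q m (z N - z M) < e" "0 < w" "\<forall>\<^sub>F N in sequentially. w \<le> q k (z N)"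
      using k[of m0] by (elim exE conjE) (rule that)
    have "z N \<in> X" for N using z(2) by auto
    then show "\<exists>m\<ge>m0. \<exists>z w. range z \<subseteq> E \<and> (\<lambda>N. p l (z N)) \<longlonglongrightarrow> 0 \<and>
        (\<forall>e>0. \<exists>M. \<forall>N\<ge>M. p m (z N - z M) < e) \<and> 0 < w \<and> (\<forall>\<^sub>F N in sequentially. w \<le> p k (z N))"
      using z by (intro exI[of _ m] exI[of _ "\<lambda>N. Phi (z N)"] exI[of _ w] conjI) (auto simp: p_Phi_diff)
  qed
qed

end

definition unit_seq :: "nat \<Rightarrow> nat \<Rightarrow> complex" where
  "unit_seq j = (\<lambda>i. if i = j then 1 else 0)"

text \<open>
  The index \<open>prod_encode (g, i)\<close> is the coordinate i of the group g. In a group with parameters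
  (\<open>lev0\<close>, \<open>lev1\<close>), the first \<open>lev0\<close> norms only see the differences to the coordinate 0, so that the constant
  sequence 1 is a limit of null sequences for them; up to the level \<open>lev1\<close> the weights are summable, so
  that this sequence belongs to the completion. It is not in the space, since the next weight is 1.
\<close>

definition grp :: "nat \<Rightarrow> nat" where "grp j = fst (prod_decode j)"
definition hub :: "nat \<Rightarrow> nat" where "hub j = prod_encode (grp j, 0)"
definition lev0 :: "nat \<Rightarrow> nat" where "lev0 j = fst (prod_decode (grp j))"
definition lev1 :: "nat \<Rightarrow> nat" where "lev1 j = Suc (lev0 j + snd (prod_decode (grp j)))"
definition nonhub :: "nat \<Rightarrow> nat" where
  "nonhub j = prod_encode (fst (prod_decode j), Suc (snd (prod_decode j)))"

text \<open>Normalised to 1 at level \<open>Suc (lev1 j)\<close>, with a factor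
  \<open>2 ^ (j + 2)\<close> per level: one power of 2 more than \<open>step_bound\<close> asks for,
  because a difference of two coordinates has to be estimated.\<close>

definition wgt :: "nat \<Rightarrow> nat \<Rightarrow> real" where
  "wgt l j = 2 ^ ((j + 2) * l) / 2 ^ ((j + 2) * Suc (lev1 j))"

definition acoord :: "nat \<Rightarrow> nat \<Rightarrow> (nat \<Rightarrow> complex) \<Rightarrow> complex" where
  "acoord l j x = of_real (wgt l j) * (if l \<le> lev0 j then x j - x (hub j) else x j)"

text \<open>At a hub and a level up to \<open>lev0\<close> the functional is a multiple of
  \<open>x j - x j\<close>, so no dual vector exists and 0 is used.\<close>

definition avec :: "nat \<Rightarrow> nat \<Rightarrow> nat \<Rightarrow> complex" where
  "avec l j = (\<lambda>i. if l \<le> lev0 j \<and> hub j = j then 0 else unit_seq j i / of_real (wgt l j))"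

lemma grp_hub [simp]: "grp (hub j) = grp j"
  by (simp add: hub_def grp_def)
lemma hub_hub [simp]: "hub (hub j) = hub j"
  by (simp add: hub_def[of "hub j"]) (simp add: hub_def)
lemma lev_hub [simp]: "lev0 (hub j) = lev0 j" "lev1 (hub j) = lev1 j"
  by (simp_all add: lev0_def lev1_def)
lemma lev0_less_lev1: "lev0 j < lev1 j"
  by (simp add: lev1_def)
lemma hub_le: "hub j \<le> j"
proof -
  have "prod_encode (n, 0) \<le> prod_encode (n, i)" for n i
  proof -
    have "n * Suc n \<le> (n + i) * Suc (n + i)" by (intro mult_le_mono) auto
    then show ?thesis by (simp add: prod_encode_def triangle_def div_le_mono del: mult_Suc_right)
  qed
  from this[of "grp j" "snd (prod_decode j)"] show ?thesis
    by (simp add: hub_def grp_def)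
qed
lemma grp_nonhub [simp]: "grp (nonhub j) = fst (prod_decode j)"
  by (simp add: nonhub_def grp_def)
lemma hub_neq_nonhub [simp]: "hub i \<noteq> nonhub j"
  by (simp add: hub_def nonhub_def)
lemma nonhub_eq_iff [simp]: "nonhub i = nonhub j \<longleftrightarrow> i = j"
  by (simp add: nonhub_def flip: prod_eq_iff)
lemma hub_or_nonhub: "hub j = j \<or> (\<exists>i. j = nonhub i)"
proof (cases "snd (prod_decode j)")
  case 0
  then have "prod_decode j = (grp j, 0)" by (simp add: grp_def prod_eq_iff)
  then show ?thesis by (metis prod_decode_inverse hub_def)
next
  case (Suc i)
  then have "prod_decode j = (grp j, Suc i)" by (simp add: grp_def prod_eq_iff)
  then have "j = nonhub (prod_encode (grp j, i))"
    by (metis fst_conv nonhub_def prod_decode_inverse prod_encode_inverse snd_conv)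
  then show ?thesis by blast
qed

section \<open>Weights and coordinate functionals of the groups\<close>

lemma wgt_pos: "0 < wgt l j" by (simp add: wgt_def)
lemma wgt_Suc: "wgt (Suc l) j = 2 ^ (j + 2) * wgt l j"
  by (simp add: wgt_def power_add)
lemma wgt_le: "l \<le> lev1 j \<Longrightarrow> wgt l j \<le> (1 / 2) ^ (j + 2)"
proof -
  assume "l \<le> lev1 j"
  then have "(j + 2) * l + (j + 2) \<le> (j + 2) * Suc (lev1 j)" by (simp add: algebra_simps add_mono)
  then have "(2::real) ^ ((j + 2) * l + (j + 2)) \<le> 2 ^ ((j + 2) * Suc (lev1 j))"
    by (intro power_increasing) auto
  then show ?thesis by (simp only: wgt_def power_add) (simp add: field_simps)
qed
lemma wgt_Suc_lev1: "wgt (Suc (lev1 j)) j = 1" by (simp add: wgt_def)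
text \<open>With \<open>d = lev1 j - l\<close> the two weights are
  \<open>(1 / 2) ^ ((j + 2) * (d + 1))\<close> and \<open>(1 / 2) ^ ((hub j + 2) * d)\<close>, and
  the hub has the smallest index of its group. This pays for the coordinate \<open>x (hub j)\<close>
  at the level where the norms change their form.\<close>

lemma wgt_hub:
  assumes "l \<le> lev1 j"
  shows "wgt l j \<le> (1 / 2) ^ (j + 2) * wgt (Suc l) (hub j)"
proof -
  define d where "d = lev1 j - l"
  have l: "lev1 j = l + d" using assms by (simp add: d_def)
  have 1: "wgt l j = (1 / 2) ^ (j + 2) * (1 / 2) ^ ((j + 2) * d)"
    by (simp add: wgt_def l algebra_simps power_add power_mult field_simps)
  have 2: "wgt (Suc l) (hub j) = (1 / 2) ^ ((hub j + 2) * d)"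
    by (simp add: wgt_def l algebra_simps power_add power_mult field_simps)
  have "(hub j + 2) * d \<le> (j + 2) * d" using hub_le[of j] by (intro mult_le_mono1) simp
  then show ?thesis unfolding 1 2 by (intro mult_left_mono power_decreasing) auto
qed

lemma acoord_add: "acoord l j (x + y) = acoord l j x + acoord l j y"
  by (simp add: acoord_def algebra_simps)
lemma acoord_scale: "acoord l j (\<lambda>i. c * x i) = c * acoord l j x"
  by (simp add: acoord_def algebra_simps)

lemma acoord_bounded:
  assumes "\<And>i. cmod (x i) \<le> M" "l \<le> lev1 j"
  shows "cmod (acoord l j x) \<le> M * (1 / 2) ^ Suc j"
proof -
  have M: "0 \<le> M" using assms(1)[of 0] norm_ge_zero order_trans by blast
  have "cmod (if l \<le> lev0 j then x j - x (hub j) else x j) \<le> 2 * M"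
    using norm_triangle_ineq4[of "x j" "x (hub j)"] assms(1)[of j] assms(1)[of "hub j"] M by auto
  then have "cmod (acoord l j x) \<le> wgt l j * (2 * M)"
    using wgt_pos[of l j] by (simp add: acoord_def norm_mult)
  also have "\<dots> \<le> (1 / 2) ^ (j + 2) * (2 * M)" using wgt_le[OF assms(2)] M by (intro mult_right_mono) auto
  finally show ?thesis by simp
qed

lemma acoord_finite_support:
  assumes "\<And>i. N \<le> i \<Longrightarrow> x i = 0"
  shows "x \<in> seq_space acoord"
  unfolding seq_space_def
proof safe
  fix l
  define M where "M = (\<Sum>i<N. cmod (x i))"
  have M: "cmod (x i) \<le> M" for i
  proof (cases "i < N")
    case True then show ?thesis unfolding M_def by (intro member_le_sum) auto
  next
    case False then show ?thesis using assms[of i] by (simp add: M_def sum_nonneg)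
  qed
  have le: "cmod (acoord l j x) \<le> M * (1 / 2) ^ Suc j" if "N \<le> j" for j
  proof (cases "l \<le> lev1 j")
    case True then show ?thesis using M by (intro acoord_bounded)
  next
    case False
    then have "acoord l j x = 0" using lev0_less_lev1[of j] assms[OF that] by (simp add: acoord_def)
    then show ?thesis using order_trans[OF norm_ge_zero M] by simp
  qed
  have sm: "summable (\<lambda>j. M * (1 / 2) ^ Suc j)"
    by (intro summable_mult summable_Suc_iff[THEN iffD2] summable_geometric) auto
  show "summable (\<lambda>j. cmod (acoord l j x))"
    by (rule summable_comparison_test'[OF sm]) (use le in auto)
qed

text \<open>Away from \<open>l = lev0 j\<close> the two levels use the same functional up to the
  factor \<open>2 ^ (j + 2)\<close>. At \<open>l = lev0 j\<close> the difference is split into its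
  two coordinates, each visible by itself one level up; adding the two estimates costs the spare
  factor 2.\<close>

lemma acoord_step:
  assumes x: "x \<in> seq_space acoord"
  shows "cmod (acoord l j x) \<le> seq_norm acoord (Suc l) x / 2 ^ Suc j"
proof -
  have le: "cmod (acoord (Suc l) i x) \<le> seq_norm acoord (Suc l) x" for i by (rule seq_norm_ge[OF x])
  have q0: "0 \<le> seq_norm acoord (Suc l) x" using order_trans[OF norm_ge_zero le] .
  show ?thesis
  proof (cases "l = lev0 j")
    case True
    have "wgt l j * cmod (x j) = (1 / 2) ^ (j + 2) * cmod (acoord (Suc l) j x)"
      using True wgt_pos[of l j] by (simp add: acoord_def norm_mult norm_power wgt_Suc power_one_over)
    also have "\<dots> \<le> (1 / 2) ^ (j + 2) * seq_norm acoord (Suc l) x" using le by (intro mult_left_mono) auto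
    finally have 1: "wgt l j * cmod (x j) \<le> (1 / 2) ^ (j + 2) * seq_norm acoord (Suc l) x" .
    have "wgt l j * cmod (x (hub j)) \<le> (1 / 2) ^ (j + 2) * wgt (Suc l) (hub j) * cmod (x (hub j))"
      using wgt_hub[of l j] True lev0_less_lev1[of j] by (intro mult_right_mono) auto
    also have "\<dots> = (1 / 2) ^ (j + 2) * cmod (acoord (Suc l) (hub j) x)"
      using True wgt_pos[of "Suc l" "hub j"] by (simp add: acoord_def norm_mult)
    also have "\<dots> \<le> (1 / 2) ^ (j + 2) * seq_norm acoord (Suc l) x" using le by (intro mult_left_mono) auto
    finally have 2: "wgt l j * cmod (x (hub j)) \<le> (1 / 2) ^ (j + 2) * seq_norm acoord (Suc l) x" .
    have "cmod (acoord l j x) = wgt l j * cmod (x j - x (hub j))"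
      using True wgt_pos[of l j] by (simp add: acoord_def norm_mult)
    also have "\<dots> \<le> wgt l j * (cmod (x j) + cmod (x (hub j)))"
      using wgt_pos[of l j] by (intro mult_left_mono norm_triangle_ineq4) auto
    finally have "cmod (acoord l j x) \<le> 2 * ((1 / 2) ^ (j + 2) * seq_norm acoord (Suc l) x)"
      using 1 2 unfolding distrib_left by linarith
    then show ?thesis by (simp add: power_one_over field_simps)
  next
    case False
    then have "acoord (Suc l) j x = 2 ^ (j + 2) * acoord l j x"
      by (simp add: acoord_def wgt_Suc)
    then have "cmod (acoord (Suc l) j x) = 2 ^ (j + 2) * cmod (acoord l j x)" by (simp add: norm_mult norm_power)
    then have "2 ^ (j + 2) * cmod (acoord l j x) \<le> seq_norm acoord (Suc l) x" using le[of j] by simp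
    then have "2 ^ Suc j * cmod (acoord l j x) \<le> seq_norm acoord (Suc l) x"
      by (simp add: power_add) (use q0 in linarith)
    then show ?thesis by (simp add: field_simps)
  qed
qed

lemma unit_seq_in: "unit_seq j \<in> seq_space acoord"
  by (rule acoord_finite_support[of "Suc j"]) (simp add: unit_seq_def)

lemma acoord_unit:
  assumes "i \<noteq> j" "lev0 j < l \<or> hub j \<noteq> j"
  shows "acoord l i (unit_seq j) = 0"
  using assms by (auto simp: acoord_def unit_seq_def)

text \<open>Differences to the hub are all that the smallest norm sees, since
  \<open>0 \<le> lev0 j\<close> for every \<open>j\<close>; a single coordinate \<open>i\<close>
  becomes visible at level \<open>Suc (lev0 i)\<close>. The differences separate points because a
  vector that is constant on a group, where the weights of level \<open>Suc (lev1 j)\<close> are 1,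
  is summable only if the constant is 0.\<close>

lemma coordinate_space_acoord:
  assumes "open G" "0 \<in> G"
  shows "coordinate_space acoord avec (\<lambda>j x. x (nonhub j) - x (hub (nonhub j))) (\<lambda>j. unit_seq (nonhub j)) G"
proof
  show "(\<lambda>k. acoord l j (Y k)) \<longlonglongrightarrow> acoord l j x" if "\<And>i. (\<lambda>k. Y k i) \<longlonglongrightarrow> x i" for Y x l j
    unfolding acoord_def using that by (auto intro!: tendsto_intros)
  show "\<exists>l C. \<forall>x\<in>seq_space acoord. cmod (x i) \<le> C * seq_norm acoord l x" for i
    using seq_norm_ge[of _ acoord "Suc (lev0 i)" i] wgt_pos[of "Suc (lev0 i)" i]
    by (intro exI[of _ "Suc (lev0 i)"] exI[of _ "1 / wgt (Suc (lev0 i)) i"])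
       (auto simp: acoord_def norm_mult field_simps)
  show "avec l j \<in> seq_space acoord" for l j
    by (rule acoord_finite_support[of "Suc j"]) (simp add: avec_def unit_seq_def)
  have avec: "avec l j = (\<lambda>i. (if l \<le> lev0 j \<and> hub j = j then 0 else 1 / of_real (wgt l j)) * unit_seq j i)" for l j
    by (auto simp: avec_def)
  show "acoord l i (avec l j) = 0" if "i \<noteq> j" for l i j
    unfolding avec acoord_scale using acoord_unit[OF that, of l] by (auto simp: not_le)
  show "acoord l j (avec l j) = 1 \<or> (acoord l j (avec l j) = 0 \<and> (\<forall>x\<in>seq_space acoord. acoord l j x = 0))" for l j
    unfolding avec acoord_scale using wgt_pos[of l j] by (auto simp: acoord_def unit_seq_def)
  show "\<exists>C. \<forall>x\<in>seq_space acoord. cmod (x (nonhub j) - x (hub (nonhub j))) \<le> C * seq_norm acoord 0 x" for j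
  proof (intro exI[of _ "1 / wgt 0 (nonhub j)"] ballI)
    fix x assume x: "x \<in> seq_space acoord"
    have "cmod (acoord 0 (nonhub j) x) = wgt 0 (nonhub j) * cmod (x (nonhub j) - x (hub (nonhub j)))"
      using wgt_pos[of 0 "nonhub j"] by (simp add: acoord_def norm_mult)
    then show "cmod (x (nonhub j) - x (hub (nonhub j))) \<le> 1 / wgt 0 (nonhub j) * seq_norm acoord 0 x"
      using seq_norm_ge[OF x, of 0 "nonhub j"] wgt_pos[of 0 "nonhub j"]
      by (simp add: pos_le_divide_eq mult.commute)
  qed
  show "unit_seq (nonhub i) (nonhub j) - unit_seq (nonhub i) (hub (nonhub j)) = (if j = i then 1 else 0)" for i j
    by (simp add: unit_seq_def)
  show "x = 0" if x: "x \<in> seq_space acoord" "\<And>j. x (nonhub j) - x (hub (nonhub j)) = 0" for x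
  proof
    fix j
    define l where "l = Suc (lev1 j)"
    define f where "f i = prod_encode (grp j, i)" for i
    have f: "grp (f i) = grp j" "hub (f i) = hub j" for i by (simp_all add: f_def grp_def hub_def)
    have "strict_mono f" unfolding strict_mono_Suc_iff f_def prod_encode_def by simp
    have xr: "x i = x (hub i)" for i using hub_or_nonhub[of i] x(2) by auto
    have eq: "acoord l (f i) x = x (hub j)" for i
      using wgt_Suc_lev1[of "f i"] lev0_less_lev1[of j] xr[of "f i"] f
      by (simp add: acoord_def l_def lev0_def lev1_def)
    have "(\<lambda>i. cmod (acoord l i x)) \<longlonglongrightarrow> 0"
      using x(1) by (intro summable_LIMSEQ_zero) (simp add: seq_space_def)
    then have "(\<lambda>i. cmod (acoord l (f i) x)) \<longlonglongrightarrow> 0"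
      using LIMSEQ_subseq_LIMSEQ[OF _ \<open>strict_mono f\<close>] by (simp add: o_def)
    then have "(\<lambda>i::nat. cmod (x (hub j))) \<longlonglongrightarrow> 0" unfolding eq .
    from LIMSEQ_unique[OF this tendsto_const] have "x (hub j) = 0" by simp
    then show "x j = 0 j" using xr[of j] by simp
  qed
qed (use assms acoord_step unit_seq_in in \<open>auto simp: acoord_add acoord_scale algebra_simps\<close>)

theorem nuclear_without_bounded_approximation_property:
  assumes "open G" "0 \<in> G"
  shows "\<exists>E \<tau>. frechet_space_of_hol_funs G E \<tau> \<and> cfun.nuclear E \<tau> \<and>
           \<not> cfun.bounded_approximation_property E \<tau>"
proof -
  interpret coordinate_space acoord avec "\<lambda>j x. x (nonhub j) - x (hub (nonhub j))" "\<lambda>j. unit_seq (nonhub j)" G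
    by (rule coordinate_space_acoord[OF assms])
  have "\<exists>k. \<forall>m0. \<exists>m\<ge>m0. \<exists>z w. range z \<subseteq> X \<and> (\<lambda>N. q l (z N)) \<longlonglongrightarrow> 0 \<and>
        (\<forall>e>0. \<exists>M. \<forall>N\<ge>M. q m (z N - z M) < e) \<and> 0 < w \<and> (\<forall>\<^sub>F N in sequentially. w \<le> q k (z N))" for l
  proof (rule exI[of _ "Suc l"], rule allI)
    fix m0
    define m where "m = max m0 (Suc l)"
    \<comment> \<open>This group has \<open>lev0 = l\<close> and \<open>lev1 = Suc m\<close>. The
      extra level serves \<open>q_width\<close>, which bounds \<open>q m\<close> by
      \<open>q (Suc m)\<close>, where the weights must still be summable.\<close>
    define g where "g = prod_encode (l, m - l)"
    define r where "r = prod_encode (g, 0)"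
    have lev: "lev0 j = l" "lev1 j = Suc m" "hub j = r" if "grp j = g" for j
      using that by (auto simp: lev0_def lev1_def g_def m_def hub_def r_def)
    have grp_r: "grp r = g" by (simp add: r_def grp_def)
    define z :: "nat \<Rightarrow> nat \<Rightarrow> complex" where "z N = (\<lambda>j. if grp j = g \<and> j < N then 1 else 0)" for N
    have z_in: "z N \<in> X" for N by (rule acoord_finite_support[of N]) (simp add: z_def)
    have bound: "q i x \<le> 1"
      if i: "l < i" "i \<le> Suc m" and x: "x \<in> X" "\<And>j. cmod (x j) \<le> 1" "\<And>j. grp j \<noteq> g \<Longrightarrow> x j = 0" for i x
    proof -
      have "q i x \<le> (\<Sum>j. (1 / 2) ^ Suc j)"
        unfolding seq_norm_def
      proof (intro suminf_le X_summable x)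
        show "cmod (acoord i j x) \<le> (1 / 2) ^ Suc j" for j
        proof (cases "grp j = g")
          case True
          then show ?thesis using acoord_bounded[of x 1 i j] x(2) i lev(2)[of j] by simp
        next
          case False
          then show ?thesis using x(3) by (simp add: acoord_def)
        qed
        show "summable (\<lambda>j. (1 / 2 :: real) ^ Suc j)" using power_half_series sums_summable by blast
      qed
      then show ?thesis using sums_unique[OF power_half_series] by simp
    qed
    \<comment> \<open>Once the hub is below \<open>N\<close>, the differences of level
      \<open>l\<close> cancel at all \<open>j < N\<close>, so only the tail contributes.\<close>
    have null: "q l (z N) \<le> 1 / 2 ^ N" if "r < N" for N
    proof -
      have "acoord l j (z N) = 0" if "j < N" for j
        using that \<open>r < N\<close> lev[of j] grp_r by (auto simp: acoord_def z_def)
      then have "q l (z N) \<le> q (Suc l) (z N) / 2 ^ N" by (intro q_width z_in)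
      also have "\<dots> \<le> 1 / 2 ^ N"
        by (intro divide_right_mono bound z_in) (auto simp: z_def m_def)
      finally show ?thesis .
    qed
    have cauchy: "q m (z N - z M) \<le> 1 / 2 ^ M" if "M \<le> N" for N M
    proof -
      have "acoord m j (z N - z M) = 0" if "j < M" for j
        using that \<open>M \<le> N\<close> lev[of j] by (auto simp: acoord_def z_def m_def)
      then have "q m (z N - z M) \<le> q (Suc m) (z N - z M) / 2 ^ M" by (intro q_width X_diff z_in)
      also have "\<dots> \<le> 1 / 2 ^ M"
        by (intro divide_right_mono bound X_diff z_in) (auto simp: z_def m_def)
      finally show ?thesis .
    qed
    have half: "(\<lambda>N. 1 / 2 ^ N :: real) \<longlonglongrightarrow> 0"
      using LIMSEQ_power_zero[of "1 / 2 :: real"] by (simp add: power_one_over)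
    show "\<exists>m\<ge>m0. \<exists>z w. range z \<subseteq> X \<and> (\<lambda>N. q l (z N)) \<longlonglongrightarrow> 0 \<and>
        (\<forall>e>0. \<exists>M. \<forall>N\<ge>M. q m (z N - z M) < e) \<and> 0 < w \<and> (\<forall>\<^sub>F N in sequentially. w \<le> q (Suc l) (z N))"
    proof (rule exI[of _ m], rule conjI[rotated], rule exI[of _ z], rule exI[of _ "wgt (Suc l) r"], intro conjI allI impI)
      show "m0 \<le> m" by (simp add: m_def)
      show "range z \<subseteq> X" using z_in by auto
      show "(\<lambda>N. q l (z N)) \<longlonglongrightarrow> 0"
      proof (rule Lim_null_comparison[OF _ half])
        show "\<forall>\<^sub>F N in sequentially. norm (q l (z N)) \<le> 1 / 2 ^ N"
          using eventually_gt_at_top[of r] by eventually_elim (use null q_nonneg[OF z_in] in auto)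
      qed
      show "\<exists>M. \<forall>N\<ge>M. q m (z N - z M) < e" if e: "0 < e" for e
      proof -
        have "\<forall>\<^sub>F M in sequentially. 1 / 2 ^ M < e" by (rule order_tendstoD(2)[OF half e])
        then obtain M where "1 / 2 ^ M < e" using eventually_happens'[OF sequentially_bot] by blast
        then show ?thesis using cauchy by (intro exI[of _ M]) (meson le_less_trans)
      qed
      \<comment> \<open>At level \<open>Suc l\<close> the hub coordinate is visible by itself and
        equals 1, which yields this lower bound.\<close>
      show "0 < wgt (Suc l) r" by (rule wgt_pos)
      show "\<forall>\<^sub>F N in sequentially. wgt (Suc l) r \<le> q (Suc l) (z N)"
        using eventually_gt_at_top[of r]
      proof eventually_elim
        case (elim N)
        then have "cmod (acoord (Suc l) r (z N)) = wgt (Suc l) r"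
          using grp_r lev[of r] wgt_pos[of "Suc l" r] by (simp add: acoord_def z_def)
        then show ?case using seq_norm_ge[OF z_in, of "Suc l" r N] by simp
      qed
    qed
  qed
  then have "\<not> cfun.bounded_approximation_property E \<tau>"
    by (rule not_bounded_approximation_property_coordinates)
  then show ?thesis using frechet_space_of_hol_funs nuclear by blast
qed

section \<open>Bounded approximation property without basis\<close>

context graded_frechet
begin

theorem bounded_approximation_property_by_contractions:
  assumes T: "\<And>N x y. x \<in> E \<Longrightarrow> y \<in> E \<Longrightarrow> T N (x + y) = T N x + T N y"
      "\<And>N c x. x \<in> E \<Longrightarrow> T N (c *c x) = c *c T N x"
    and contr: "\<And>N x l. x \<in> E \<Longrightarrow> p l (T N x) \<le> p l x"
    and T_in: "\<And>N x. x \<in> E \<Longrightarrow> T N x \<in> E"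
    and fin: "\<And>N. \<exists>B. finite B \<and> T N ` E \<subseteq> span B"
    and lim: "\<And>x l. x \<in> E \<Longrightarrow> (\<lambda>N. p l (T N x - x)) \<longlonglongrightarrow> 0"
  shows "bounded_approximation_property E \<tau>"
  unfolding bounded_approximation_property_def
proof (intro exI conjI ballI)
  have diff: "T N (x - y) = T N x - T N y" if "x \<in> E" "y \<in> E" for N x y
    using T(1)[of "x - y" y N] that by (simp add: algebra_simps)
  show "finite_rank_operator E \<tau> S" if S: "S \<in> range T" for S
  proof -
    obtain N where "S = T N" using S by blast
    moreover have "continuous_map \<tau> \<tau> (T N)"
    proof (rule continuous_map_operator)
      show "\<exists>m C. 0 \<le> C \<and> (\<forall>x\<in>E. p l (T N x) \<le> C * p m x)" for l
        using contr by (intro exI[of _ l] exI[of _ "1 :: real"]) auto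
    qed (use T_in diff in auto)
    ultimately show ?thesis using T fin[of N] by (simp add: finite_rank_operator_def)
  qed
  show "equicontinuous \<tau> (range T)"
    unfolding equicontinuous_def
  proof (intro allI impI, elim conjE)
    fix V assume V: "openin \<tau> V" "0 \<in> V"
    obtain l r where r: "0 < r" "{y\<in>E. p l (y - 0) < r} \<subseteq> V" using V by (rule openin_nhd)
    have "S ` {y\<in>E. p l (y - 0) < r} \<subseteq> V" if S: "S \<in> range T" for S
    proof safe
      fix y assume y: "y \<in> E" "p l (y - 0) < r"
      obtain N where N: "S = T N" using S by blast
      have "p l (S y) < r" using contr[OF y(1), of l N] y(2) by (simp add: N)
      then show "S y \<in> V" using r(2) T_in[OF y(1), of N] by (auto simp: N)
    qed
    then show "\<exists>U. openin \<tau> U \<and> 0 \<in> U \<and> (\<forall>S\<in>range T. S ` U \<subseteq> V)"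
      using r openin_ball[of 0 l r] by (intro exI[of _ "{y\<in>E. p l (y - 0) < r}"]) auto
  qed
  show "filtermap T sequentially \<noteq> bot" by (simp add: filtermap_bot_iff)
  show "filtermap T sequentially \<le> principal (range T)" by (simp add: le_principal eventually_filtermap)
  show "limitin \<tau> (\<lambda>S. S x) x (filtermap T sequentially)" if x: "x \<in> E" for x
    by (rule limitin_I) (use x T_in lim in \<open>auto simp: eventually_filtermap filterlim_filtermap\<close>)
qed

end

definition lo :: "nat \<Rightarrow> nat" where "lo n = fst (prod_decode (fst (prod_decode n)))"
definition hi :: "nat \<Rightarrow> nat" where "hi n = lo n + snd (prod_decode (fst (prod_decode n)))"
text \<open>The exponent exceeds \<open>Suc j\<close> for both coordinates \<open>j\<close> of block
  \<open>n\<close>, so one factor \<open>base n\<close> per level pays for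
  \<open>step_bound\<close>.\<close>

definition base :: "nat \<Rightarrow> real" where "base n = 2 ^ (2 * n + 4)"
definition eps :: "nat \<Rightarrow> real" where "eps n = 1 / base n ^ n"

text \<open>
  Every pair \<open>lo n \<le> hi n\<close> occurs for infinitely many blocks n. The norms change their shape after the levels
  \<open>lo n\<close> and \<open>hi n\<close>; \<open>eps n\<close> is smaller than any fixed power of \<open>1 / base n\<close>, the ratio of the
  scaling factors of consecutive levels.
\<close>

definition bcoord :: "nat \<Rightarrow> nat \<Rightarrow> bool \<Rightarrow> complex \<Rightarrow> complex \<Rightarrow> complex" where
  "bcoord l n first y z =
     (if l \<le> lo n then (if first then y else of_real (eps n) * z)
      else if l \<le> hi n then (if first then y else z / of_real (eps n))
      else (if first then (y + z) / of_real (eps n ^ 2) else (y - z) / of_real (eps n)))"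

definition ccoord :: "nat \<Rightarrow> nat \<Rightarrow> (nat \<Rightarrow> complex) \<Rightarrow> complex" where
  "ccoord l j x = of_real (base (j div 2) ^ l) *
     bcoord l (j div 2) (even j) (x (2 * (j div 2))) (x (2 * (j div 2) + 1))"

text \<open>The columns of the inverse of the 2 by 2 matrix of the block at level \<open>l\<close>:
  diagonal for the first two shapes; for the rotated shape the halves come from solving for
  \<open>y + z\<close> and \<open>y - z\<close>.\<close>

definition cvec :: "nat \<Rightarrow> nat \<Rightarrow> nat \<Rightarrow> complex" where
  "cvec l j = (let n = j div 2; w = of_real (1 / base n ^ l); e = of_real (eps n) in
     (\<lambda>i. if i div 2 \<noteq> n then 0
       else if l \<le> lo n then (if i = j then (if even j then w else w / e) else 0)
       else if l \<le> hi n then (if i = j then (if even j then w else w * e) else 0)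
       else (if even j then w * e ^ 2 / 2 else if even i then w * e / 2 else - w * e / 2)))"

section \<open>Estimates for the blocks\<close>

lemma base_ge: "1 \<le> base n" by (simp add: base_def)
lemma base_pos: "0 < base n" by (simp add: base_def)
lemma eps_pos: "0 < eps n" by (simp add: eps_def base_pos)
lemma eps_le: "eps n \<le> 1" by (simp add: eps_def base_pos base_ge one_le_power)

lemma bcoord_add: "bcoord l n b (y + y') (z + z') = bcoord l n b y z + bcoord l n b y' z'"
  by (simp add: bcoord_def algebra_simps add_divide_distrib diff_divide_distrib)
lemma bcoord_scale: "bcoord l n b (c * y) (c * z) = c * bcoord l n b y z"
  by (simp add: bcoord_def algebra_simps)
lemma bcoord_0 [simp]: "bcoord l n b 0 0 = 0"
  by (simp add: bcoord_def)

lemma ccoord_add: "ccoord l j (x + y) = ccoord l j x + ccoord l j y"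
  by (simp add: ccoord_def bcoord_add algebra_simps)
lemma ccoord_scale: "ccoord l j (\<lambda>i. c * x i) = c * ccoord l j x"
  by (simp add: ccoord_def bcoord_scale)

text \<open>The first change of shape only enlarges the weight of \<open>z\<close>. At the rotation,
  \<open>cmod y + cmod z \<le> cmod (y + z) + cmod (y - z)\<close> loses no constant, and both new
  weights are at least \<open>1 / eps n\<close>, the largest old one. If \<open>lo n = hi n\<close>,
  the changes coincide and both estimates combine.\<close>

lemma bcoord_mono:
  "cmod (bcoord l n True y z) + cmod (bcoord l n False y z) \<le>
   cmod (bcoord (Suc l) n True y z) + cmod (bcoord (Suc l) n False y z)"
proof -
  define e where "e = eps n"
  have e: "0 < e" "e \<le> 1" using eps_pos eps_le by (auto simp: e_def)
  have e1: "e * cmod z \<le> cmod z / e"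
  proof -
    have "e * e \<le> 1" using e by (simp add: mult_le_one)
    then show ?thesis using e mult_right_mono[of "e * e" 1 "cmod z"] by (simp add: field_simps)
  qed
  have 23: "cmod y + cmod z / e \<le> cmod (y + z) / e ^ 2 + cmod (y - z) / e"
  proof -
    have yz: "cmod y + cmod z \<le> cmod (y + z) + cmod (y - z)"
    proof -
      have "2 * cmod y = cmod ((y + z) + (y - z))" "2 * cmod z = cmod ((y + z) - (y - z))"
        by (simp_all flip: mult_2 add: norm_mult)
      then show ?thesis
        using norm_triangle_ineq[of "y + z" "y - z"] norm_triangle_ineq4[of "y + z" "y - z"] by linarith
    qed
    have "cmod y \<le> cmod y / e" using e by (simp add: pos_le_divide_eq mult_right_le_one_le)
    then have "cmod y + cmod z / e \<le> (cmod y + cmod z) / e" by (simp add: add_divide_distrib)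
    also have "\<dots> \<le> (cmod (y + z) + cmod (y - z)) / e" using yz e by (intro divide_right_mono) auto
    also have "\<dots> \<le> cmod (y + z) / e ^ 2 + cmod (y - z) / e"
      using e unfolding add_divide_distrib
      by (intro add_right_mono divide_left_mono) (auto simp: power2_eq_square mult_left_le)
    finally show ?thesis .
  qed
  have "lo n \<le> hi n" by (simp add: hi_def)
  then show ?thesis using e1 23 e
    by (auto simp: bcoord_def norm_mult norm_divide norm_power not_le simp flip: e_def)
qed

lemma ccoord_finite_support:
  assumes "\<And>i. N \<le> i \<Longrightarrow> x i = 0"
  shows "x \<in> seq_space ccoord"
  unfolding seq_space_def
proof safe
  fix l
  have "ccoord l j x = 0" if "j \<notin> {..<Suc N}" for j
    using assms[of "2 * (j div 2)"] assms[of "2 * (j div 2) + 1"] that by (simp add: ccoord_def)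
  then show "summable (\<lambda>j. cmod (ccoord l j x))" by (intro summable_finite[of "{..<Suc N}"]) auto
qed

lemma ccoord_block_le_norm:
  assumes "x \<in> seq_space ccoord"
  shows "cmod (ccoord l (2 * n) x) + cmod (ccoord l (2 * n + 1) x) \<le> seq_norm ccoord l x"
  using assms unfolding seq_norm_def seq_space_def
  using sum_le_suminf[of "\<lambda>j. cmod (ccoord l j x)" "{2 * n, 2 * n + 1}"] by simp

lemma seq_norm_block:
  assumes "\<And>i. i div 2 \<noteq> n \<Longrightarrow> x i = 0"
  shows "seq_norm ccoord l x = cmod (ccoord l (2 * n) x) + cmod (ccoord l (2 * n + 1) x)"
proof -
  have "ccoord l j x = 0" if "j \<notin> {2 * n, 2 * n + 1}" for j
  proof -
    have "j div 2 \<noteq> n" using that by auto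
    then show ?thesis using assms[of "2 * (j div 2)"] assms[of "2 * (j div 2) + 1"] by (simp add: ccoord_def)
  qed
  then have "seq_norm ccoord l x = (\<Sum>j\<in>{2 * n, 2 * n + 1}. cmod (ccoord l j x))"
    unfolding seq_norm_def by (intro suminf_finite) auto
  then show ?thesis by simp
qed

lemma ccoord_step:
  assumes x: "x \<in> seq_space ccoord"
  shows "cmod (ccoord l j x) \<le> seq_norm ccoord (Suc l) x / 2 ^ Suc j"
proof -
  define n where "n = j div 2"
  define b where "b l f = cmod (bcoord l n f (x (2 * n)) (x (2 * n + 1)))" for l f
  have c: "cmod (ccoord l i x) = base n ^ l * b l (even i)" if "i div 2 = n" for l i
    using that base_pos[of n] by (simp add: ccoord_def b_def norm_mult norm_power)
  have "b l (even j) \<le> b l True + b l False"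
    by (cases "even j") (auto simp: b_def)
  also have "\<dots> \<le> b (Suc l) True + b (Suc l) False" unfolding b_def by (rule bcoord_mono)
  finally have "base n ^ Suc l * b l (even j) \<le> base n ^ Suc l * b (Suc l) True + base n ^ Suc l * b (Suc l) False"
    using base_pos[of n] by (simp flip: distrib_left)
  also have "\<dots> \<le> seq_norm ccoord (Suc l) x"
    using ccoord_block_le_norm[OF x, of "Suc l" n] c[of "2 * n" "Suc l"] c[of "2 * n + 1" "Suc l"] by simp
  finally have "base n * cmod (ccoord l j x) \<le> seq_norm ccoord (Suc l) x"
    using c[of j l] by (simp add: n_def mult_ac)
  moreover have "2 ^ Suc j \<le> base n"
    unfolding base_def by (rule power_increasing) (auto simp: n_def)
  then have "2 ^ Suc j * cmod (ccoord l j x) \<le> base n * cmod (ccoord l j x)"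
    by (intro mult_right_mono) auto
  ultimately show ?thesis by (simp add: field_simps)
qed

lemma coordinate_bound:
  assumes x: "x \<in> seq_space ccoord"
  shows "cmod (x j) \<le> 1 / eps (j div 2) * seq_norm ccoord 0 x"
proof -
  have q0: "0 \<le> seq_norm ccoord 0 x"
    using order_trans[OF norm_ge_zero seq_norm_ge[OF x, of 0 0]] .
  show ?thesis
  proof (cases "even j")
    case True
    have "cmod (x j) \<le> 1 * seq_norm ccoord 0 x"
      using seq_norm_ge[OF x, of 0 j] True by (simp add: ccoord_def bcoord_def)
    also have "\<dots> \<le> 1 / eps (j div 2) * seq_norm ccoord 0 x"
      using q0 eps_pos[of "j div 2"] eps_le[of "j div 2"] by (intro mult_right_mono) auto
    finally show ?thesis .
  next
    case False
    then have "2 * (j div 2) + 1 = j" by presburger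
    then show ?thesis
      using seq_norm_ge[OF x, of 0 j] False eps_pos[of "j div 2"]
      by (simp add: ccoord_def bcoord_def norm_mult field_simps)
  qed
qed

lemma coordinate_space_ccoord:
  assumes "open G" "0 \<in> G"
  shows "coordinate_space ccoord cvec (\<lambda>j x. x j) unit_seq G"
proof
  show "(\<lambda>k. ccoord l j (Y k)) \<longlonglongrightarrow> ccoord l j x" if "\<And>i. (\<lambda>k. Y k i) \<longlonglongrightarrow> x i" for Y x l j
    unfolding ccoord_def bcoord_def using that eps_pos[of "j div 2"] by (auto intro!: tendsto_intros)
  show "\<exists>l C. \<forall>x\<in>seq_space ccoord. cmod (x i) \<le> C * seq_norm ccoord l x" for i
    using coordinate_bound by blast
  show "\<exists>C. \<forall>x\<in>seq_space ccoord. cmod (x j) \<le> C * seq_norm ccoord 0 x" for j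
    using coordinate_bound by blast
  show "cvec l j \<in> seq_space ccoord" for l j
    by (rule ccoord_finite_support[of "2 * (j div 2) + 2"]) (auto simp: cvec_def Let_def)
  show "unit_seq j \<in> seq_space ccoord" for j
    by (rule ccoord_finite_support[of "Suc j"]) (auto simp: unit_seq_def)
  show "ccoord l i (cvec l j) = 0" if "i \<noteq> j" for l i j
  proof (cases "i div 2 = j div 2")
    case True
    define n where "n = j div 2"
    have "i = 2 * n \<and> j = 2 * n + 1 \<or> i = 2 * n + 1 \<and> j = 2 * n"
      using True that div_mult_mod_eq[of i 2] div_mult_mod_eq[of j 2]
        mod2_eq_if[of i] mod2_eq_if[of j] unfolding n_def by (auto split: if_splits)
    then show ?thesis by (elim disjE conjE; simp add: ccoord_def bcoord_def cvec_def Let_def)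
  qed (simp add: ccoord_def cvec_def Let_def)
  have "ccoord l j (cvec l j) = 1" for l j
  proof -
    define n where "n = j div 2"
    have "base n \<noteq> 0" "eps n \<noteq> 0" using base_pos[of n] eps_pos[of n] by auto
    moreover have "j = 2 * n \<or> j = 2 * n + 1" unfolding n_def by presburger
    ultimately show ?thesis
      by (elim disjE; simp add: ccoord_def bcoord_def cvec_def Let_def power2_eq_square)
  qed
  then show "ccoord l j (cvec l j) = 1 \<or> (ccoord l j (cvec l j) = 0 \<and> (\<forall>x\<in>seq_space ccoord. ccoord l j x = 0))" for l j
    by blast
qed (use assms ccoord_step in \<open>auto simp: ccoord_add ccoord_scale unit_seq_def fun_eq_iff\<close>)

text \<open>The last component of the encoding is free and only enlarges \<open>n\<close>:
  \<open>Suc (m + k) \<le> n\<close> makes \<open>base n ^ m * eps n\<close> at most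
  \<open>1 / base n\<close>, and \<open>2 ^ k \<le> base n\<close> absorbs \<open>K\<close>.\<close>

lemma exists_block:
  assumes "a \<le> b"
  shows "\<exists>n. lo n = a \<and> hi n = b \<and> K * (base n ^ m * eps n) \<le> 1"
proof -
  obtain k where k: "max K 1 < 2 ^ k" using real_arch_pow[of 2 "max K 1"] by auto
  define n where "n = prod_encode (prod_encode (a, b - a), Suc (m + k))"
  have n: "Suc (m + k) \<le> n" unfolding n_def by (rule le_prod_encode_2)
  have "base n ^ m * eps n * base n = base n ^ Suc m / base n ^ n" by (simp add: eps_def)
  also have "\<dots> \<le> 1" using n base_ge[of n] base_pos[of n] power_increasing[of "Suc m" n "base n"] by simp
  finally have "base n ^ m * eps n \<le> 1 / base n" using base_pos[of n] by (simp add: field_simps)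
  moreover have "(2::real) ^ k \<le> base n" unfolding base_def using n by (intro power_increasing) auto
  ultimately have "max K 1 * (base n ^ m * eps n) \<le> base n * (1 / base n)"
    using k base_pos[of n] eps_pos[of n] by (intro mult_mono) auto
  moreover have "K * (base n ^ m * eps n) \<le> max K 1 * (base n ^ m * eps n)"
    using base_pos[of n] eps_pos[of n] by (intro mult_right_mono) auto
  moreover have "base n * (1 / base n) = 1" using base_pos[of n] by simp
  ultimately have "K * (base n ^ m * eps n) \<le> 1" by linarith
  moreover have "lo n = a" "hi n = b" using assms by (simp_all add: lo_def hi_def n_def)
  ultimately show ?thesis by blast
qed

theorem nuclear_with_bounded_approximation_property_without_basis:
  assumes "open G" "0 \<in> G"
  shows "\<exists>E \<tau>. frechet_space_of_hol_funs G E \<tau> \<and> cfun.nuclear E \<tau> \<and>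
           cfun.bounded_approximation_property E \<tau> \<and> \<not> (\<exists>e. cfun.schauder_basis E \<tau> e)"
proof -
  interpret coordinate_space ccoord cvec "\<lambda>j x. x j" unit_seq G
    by (rule coordinate_space_ccoord[OF assms])
  \<comment> \<open>Cutting at \<open>2 * N\<close> never splits a block. Functionals of different
    blocks share no coordinate, so \<open>T N\<close> merely deletes terms of each norm and is a
    contraction.\<close>
  define T where "T N x = (\<lambda>i. if i < 2 * N then x i else 0)" for N and x :: "nat \<Rightarrow> complex"
  have T_in: "T N x \<in> X" for N x by (rule ccoord_finite_support[of "2 * N"]) (simp add: T_def)
  have T_coord: "ccoord l j (T N x) = (if j < 2 * N then ccoord l j x else 0)" for l j N x
  proof -
    have "2 * (j div 2) + 1 < 2 * N" if "j < 2 * N" using that by presburger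
    then show ?thesis by (auto simp: ccoord_def T_def)
  qed
  have T_le: "q l (T N x) \<le> q l x" if "x \<in> X" for l N x
    unfolding seq_norm_def by (intro suminf_le X_summable that T_in) (simp add: T_coord)
  have T_lim: "(\<lambda>N. q l (T N x - x)) \<longlonglongrightarrow> 0" if x: "x \<in> X" for l x
  proof (rule Lim_null_comparison)
    have "q l (T N x - x) \<le> q (Suc l) x * (1 / 2) ^ N" for N
    proof -
      have "q l (T N x - x) \<le> q (Suc l) (T N x - x) / 2 ^ (2 * N)"
        by (intro q_width X_diff T_in x) (simp add: a_diff T_coord)
      also have "q (Suc l) (T N x - x) \<le> q (Suc l) x"
        unfolding seq_norm_def
        by (intro suminf_le X_summable X_diff T_in x) (simp add: a_diff T_coord)
      finally have "q l (T N x - x) \<le> q (Suc l) x / 2 ^ (2 * N)" by (simp add: divide_right_mono)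
      also have "\<dots> \<le> q (Suc l) x / 2 ^ N"
        using q_nonneg[OF x] by (intro divide_left_mono power_increasing) auto
      finally show ?thesis by (simp add: power_one_over)
    qed
    then show "\<forall>\<^sub>F N in sequentially. norm (q l (T N x - x)) \<le> q (Suc l) x * (1 / 2) ^ N"
      using q_nonneg[OF X_diff[OF T_in x]] by simp
    show "(\<lambda>N. q (Suc l) x * (1 / 2) ^ N) \<longlonglongrightarrow> 0"
      using tendsto_mult[OF tendsto_const LIMSEQ_power_zero[of "1 / 2 :: real"]] by force
  qed
  have "cfun.bounded_approximation_property E \<tau>"
  proof (rule bounded_approximation_property_by_contractions[where T = "\<lambda>N f. Phi (T N (J f))"])
    show "Phi (T N (J (f + g))) = Phi (T N (J f)) + Phi (T N (J g))" if "f \<in> E" "g \<in> E" for N f g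
    proof -
      have "T N (J (f + g)) = T N (J f) + T N (J g)" using that by (auto simp: J_add T_def fun_eq_iff)
      then show ?thesis by (simp only: Phi_add[OF T_in T_in])
    qed
    show "Phi (T N (J (\<lambda>z. c * f z))) = (\<lambda>z. c * Phi (T N (J f)) z)" if "f \<in> E" for N c f
    proof -
      have "T N (J (\<lambda>z. c * f z)) = (\<lambda>i. c * T N (J f) i)" using that by (auto simp: J_scale T_def)
      then show ?thesis by (simp only: Phi_scale[OF T_in])
    qed
    show "p l (Phi (T N (J f))) \<le> p l f" if "f \<in> E" for N f l
      using T_le[OF J_in[OF that]] T_in by (simp add: p_def)
    show "Phi (T N (J f)) \<in> E" for N f using T_in by simp
    show "(\<lambda>N. p l (Phi (T N (J f)) - f)) \<longlonglongrightarrow> 0" if "f \<in> E" for f l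
    proof -
      have "p l (Phi (T N (J f)) - f) = q l (T N (J f) - J f)" for N
        using p_Phi_diff[OF T_in J_in[OF that], of l N "J f"] that by simp
      then show ?thesis using T_lim[OF J_in[OF that]] by simp
    qed
    show "\<exists>B. finite B \<and> (\<lambda>f. Phi (T N (J f))) ` E \<subseteq> cfun.span B" for N
    proof (intro exI[of _ "Phi ` unit_seq ` {..<2 * N}"] conjI)
      have fin: "Phi (\<lambda>i. if i < M then x i else 0) \<in> cfun.span (Phi ` unit_seq ` {..<M})" for M and x :: "nat \<Rightarrow> complex"
      proof (induction M)
        case 0
        have "Phi (\<lambda>i. 0) = 0" using Phi_scale[OF X_0, of 0] by (simp add: zero_fun_def)
        moreover have "(\<lambda>i. if i < 0 then x i else 0) = (\<lambda>i. 0)" by auto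
        ultimately show ?case by (simp only: cfun.span_zero)
      next
        case (Suc M)
        have eq: "(\<lambda>i. if i < Suc M then x i else 0) = (\<lambda>i. if i < M then x i else 0) + (\<lambda>i. x M * unit_seq M i)"
          by (auto simp: fun_eq_iff unit_seq_def less_Suc_eq)
        have "(\<lambda>i. if i < M then x i else 0) \<in> X" by (rule ccoord_finite_support[of M]) simp
        then have "Phi (\<lambda>i. if i < Suc M then x i else 0) =
            Phi (\<lambda>i. if i < M then x i else 0) + (\<lambda>z. x M * Phi (unit_seq M) z)"
          unfolding eq using u_in by (simp add: Phi_add Phi_scale X_scale)
        moreover have "Phi (\<lambda>i. if i < M then x i else 0) \<in> cfun.span (Phi ` unit_seq ` {..<Suc M})"
          by (rule subsetD[OF cfun.span_mono Suc]) (intro image_mono, auto)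
        moreover have "(\<lambda>z. x M * Phi (unit_seq M) z) \<in> cfun.span (Phi ` unit_seq ` {..<Suc M})"
          by (intro cfun.span_scale cfun.span_base) auto
        ultimately show ?case by (simp only: cfun.span_add)
      qed
      show "(\<lambda>f. Phi (T N (J f))) ` E \<subseteq> cfun.span (Phi ` unit_seq ` {..<2 * N})"
        unfolding T_def using fin by blast
    qed auto
  qed
  moreover have "\<not> (\<exists>e. cfun.schauder_basis E \<tau> e)"
  proof (rule no_schauder_basis[where a = "\<lambda>l j f. ccoord l j (J f)"])
    show "cfun.linear_functional_on E (\<lambda>f. ccoord l j (J f))" for l j by (rule a_functional)
    show "p l f \<le> p (Suc l) f / 2 ^ N" if "f \<in> E" "\<And>j. j < N \<Longrightarrow> ccoord l j (J f) = 0" for l N f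
      using that by (rule E_width)
    fix \<mu> :: "nat \<Rightarrow> nat" and C :: "nat \<Rightarrow> real" assume C: "\<And>l. 0 < C l"
    \<comment> \<open>The block is to have its first shape from 0 to \<open>\<mu> 0\<close>, the
      second from \<open>Suc a\<close> to at least \<open>\<mu> (Suc a)\<close>, and the third from
      \<open>Suc b\<close> on; \<open>m\<close> dominates \<open>\<mu> (Suc b)\<close> for the last
      estimate.\<close>
    define a where "a = \<mu> 0"
    define b where "b = max (Suc a) (\<mu> (Suc a))"
    define m where "m = max (Suc b) (\<mu> (Suc b))"
    have "Suc b \<le> m" by (simp add: m_def)
    \<comment> \<open>6 is the threshold of the criterion, a further 2 comes from the norm
      \<open>B ^ m * (2 / e)\<close> of \<open>U - V\<close>, and the sum dominates each of the
      three constants.\<close>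
    define K where "K = 12 * (C 0 + C (Suc a) + C (Suc b))"
    have ab: "Suc a \<le> b" by (simp add: b_def)
    then have "a \<le> b" by simp
    then obtain n where n: "lo n = a" "hi n = b" "K * (base n ^ m * eps n) \<le> 1"
      using exists_block by blast
    define e where "e = eps n"
    define B where "B = base n"
    have e: "0 < e" "e \<le> 1" and B: "1 \<le> B"
      using eps_pos eps_le base_ge by (auto simp: e_def B_def)
    have small: "12 * (C l * (B ^ i * e)) \<le> 1" if "l \<in> {0, Suc a, Suc b}" "i \<le> m" for l i
    proof -
      have "12 * C l \<le> K" using that(1) C[of 0] C[of "Suc a"] C[of "Suc b"] by (auto simp: K_def)
      moreover have "B ^ i * e \<le> B ^ m * e" using that(2) B e by (intro mult_right_mono power_increasing) auto
      ultimately have "(12 * C l) * (B ^ i * e) \<le> K * (B ^ m * e)"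
        using C[of l] B e by (intro mult_mono) auto
      then show ?thesis using n(3) by (simp add: B_def e_def mult_ac)
    qed
    define U where "U = unit_seq (2 * n)"
    define V where "V = unit_seq (2 * n + 1)"
    have UV: "U \<in> X" "V \<in> X" by (simp_all add: U_def V_def u_in)
    have blocks: "q l U = B ^ l * (cmod (bcoord l n True 1 0) + cmod (bcoord l n False 1 0))"
      "q l V = B ^ l * (cmod (bcoord l n True 0 1) + cmod (bcoord l n False 0 1))"
      "q l (U - V) = B ^ l * (cmod (bcoord l n True 1 (- 1)) + cmod (bcoord l n False 1 (- 1)))" for l
      by (subst seq_norm_block[of n];
          use base_pos[of n] in \<open>force simp: U_def V_def unit_seq_def ccoord_def B_def norm_mult norm_power distrib_left\<close>)+
    have le_p: "B ^ l * cmod (bcoord l n first (J f (2 * n)) (J f (2 * n + 1))) \<le> p l f" if "f \<in> E" for l first f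
      using seq_norm_ge[OF J_in[OF that], of l "2 * n"] seq_norm_ge[OF J_in[OF that], of l "2 * n + 1"] base_pos[of n]
      by (cases first) (simp_all add: p_def ccoord_def B_def norm_mult norm_power)
    show "\<exists>u\<in>E. \<exists>v\<in>E. \<exists>f g l1 l2 l3 t1 t2 t3.
        cfun.linear_functional_on E f \<and> cfun.linear_functional_on E g \<and> f u = 1 \<and>
        0 < t1 \<and> (\<forall>x\<in>E. t1 * cmod (f x) \<le> p l1 x) \<and> C l1 * p (\<mu> l1) v \<le> t1 / 6 \<and>
        0 < t2 \<and> (\<forall>x\<in>E. t2 * cmod (g x) \<le> p l2 x) \<and> C l2 * p (\<mu> l2) u \<le> t2 / 6 \<and>
        0 < t3 \<and> (\<forall>x\<in>E. t3 * cmod (f x + g x) \<le> p l3 x) \<and> C l3 * p (\<mu> l3) (u - v) \<le> t3 / 6"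
    \<comment> \<open>Each \<open>t\<close> is the weight of its functional in the shape at hand: 1,
      \<open>1 / e\<close>, \<open>1 / e ^ 2\<close>, up to powers of \<open>B\<close>. The paired
      vector lies on the other axis, where the weight is smaller by the factor \<open>e\<close>, and
      \<open>e\<close> beats all powers of \<open>B\<close> up to \<open>m\<close>.\<close>
    proof (rule bexI[OF _ Phi_in[OF UV(1)]], rule bexI[OF _ Phi_in[OF UV(2)]],
        rule exI[of _ "\<lambda>f. J f (2 * n)"], rule exI[of _ "\<lambda>f. J f (2 * n + 1)"],
        rule exI[of _ 0], rule exI[of _ "Suc a"], rule exI[of _ "Suc b"],
        rule exI[of _ 1], rule exI[of _ "B ^ Suc a / e"], rule exI[of _ "B ^ Suc b / e ^ 2"],
        intro conjI ballI)
      show "cfun.linear_functional_on E (\<lambda>f. J f (2 * n))" "cfun.linear_functional_on E (\<lambda>f. J f (2 * n + 1))"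
        by (rule functional_J; simp)+
      show "J (Phi U) (2 * n) = 1" using UV by (simp add: U_def unit_seq_def)
      show "0 < (1 :: real)" by simp
      show "0 < B ^ Suc a / e" "0 < B ^ Suc b / e ^ 2" using B e by simp_all
      show "1 * cmod (J f (2 * n)) \<le> p 0 f" if "f \<in> E" for f
        using le_p[OF that, of 0 True] by (simp add: bcoord_def)
      show "B ^ Suc a / e * cmod (J f (2 * n + 1)) \<le> p (Suc a) f" if "f \<in> E" for f
        using le_p[OF that, of "Suc a" False] n e ab by (simp add: bcoord_def norm_divide e_def)
      show "B ^ Suc b / e ^ 2 * cmod (J f (2 * n) + J f (2 * n + 1)) \<le> p (Suc b) f" if "f \<in> E" for f
        using le_p[OF that, of "Suc b" True] n e ab by (simp add: bcoord_def norm_divide norm_power e_def)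
      show "C 0 * p (\<mu> 0) (Phi V) \<le> 1 / 6"
      proof -
        have "q a V = B ^ a * e" using n e by (simp add: blocks bcoord_def e_def)
        moreover have "12 * (C 0 * (B ^ a * e)) \<le> 1" using ab \<open>Suc b \<le> m\<close> by (intro small) auto
        ultimately show ?thesis using UV by (simp flip: a_def)
      qed
      show "C (Suc a) * p (\<mu> (Suc a)) (Phi U) \<le> B ^ Suc a / e / 6"
      proof -
        have "p (\<mu> (Suc a)) (Phi U) \<le> p b (Phi U)" using UV by (intro p_mono) (auto simp: b_def)
        also have "\<dots> = B ^ b" using n UV ab by (simp add: blocks bcoord_def)
        finally have "C (Suc a) * p (\<mu> (Suc a)) (Phi U) \<le> C (Suc a) * B ^ b"
          using C by (intro mult_left_mono) (auto intro: less_imp_le)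
        also have "\<dots> \<le> 1 / e / 6"
        proof -
          have "12 * (C (Suc a) * (B ^ b * e)) \<le> 1" using \<open>Suc b \<le> m\<close> by (intro small) auto
          then show ?thesis using e by (simp add: field_simps)
        qed
        also have "\<dots> \<le> B ^ Suc a / e / 6"
          using B e one_le_power[OF B, of "Suc a"] by (intro divide_right_mono) auto
        finally show ?thesis .
      qed
      show "C (Suc b) * p (\<mu> (Suc b)) (Phi U - Phi V) \<le> B ^ Suc b / e ^ 2 / 6"
      proof -
        have "p (\<mu> (Suc b)) (Phi U - Phi V) \<le> p m (Phi U - Phi V)"
          using UV by (intro p_mono) (auto simp: m_def)
        also have "\<dots> = B ^ m * (2 / e)"
          using n e UV ab \<open>Suc b \<le> m\<close> by (simp add: p_Phi_diff blocks bcoord_def norm_divide e_def)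
        finally have "C (Suc b) * p (\<mu> (Suc b)) (Phi U - Phi V) \<le> C (Suc b) * (B ^ m * (2 / e))"
          using C by (intro mult_left_mono) (auto intro: less_imp_le)
        also have "\<dots> \<le> 1 / e ^ 2 / 6"
          using small[of "Suc b" m] e by (simp add: field_simps power2_eq_square)
        also have "\<dots> \<le> B ^ Suc b / e ^ 2 / 6"
          using B e one_le_power[OF B, of "Suc b"] by (intro divide_right_mono) auto
        finally show ?thesis .
      qed
    qed
  qed
  ultimately show ?thesis using frechet_space_of_hol_funs nuclear by blast
qed

theorem corollary2p3:
  fixes G :: "complex set"
  assumes "G = ball 0 1 \<or> G = UNIV"
  shows "(\<exists>E \<tau>. frechet_space_of_hol_funs G E \<tau> \<and> cfun.nuclear E \<tau> \<and>
            \<not> cfun.bounded_approximation_property E \<tau>) \<and>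
         (\<exists>E \<tau>. frechet_space_of_hol_funs G E \<tau> \<and> cfun.nuclear E \<tau> \<and>
            cfun.bounded_approximation_property E \<tau> \<and>
            \<not> (\<exists>e. cfun.schauder_basis E \<tau> e))"
proof -
  have G: "open G" "0 \<in> G" using assms by auto
  show ?thesis
    using nuclear_without_bounded_approximation_property[OF G]
      nuclear_with_bounded_approximation_property_without_basis[OF G] by (rule conjI)
qed

end
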